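(* Let $\mathcal{P}$ be a contact toral poset constructed from the (contact) toral-pairs $\{(\mathcal{S}_i,\varphi_{\mathcal{S}_i})\}_{i=1}^n$ with contact sequence $\mathcal{S}_1=\mathcal{Q}_1\subset\mathcal{Q}_2\subset\dots\subset\mathcal{Q}_n=\mathcal{P}$, and let $\varphi_{\mathcal{Q}_i}\in(\mathfrak{g}_A(\mathcal{Q}_i))^*$, $i=1,\dots,n$, be the associated contact toral one-forms. Then $\varphi_{\mathcal{Q}_i}$ is a contact form on $\mathfrak{g}_A(\mathcal{Q}_i)$ for all $i=1,\dots,n$.
   Context: **Posets and Lie algebras.** All posets are finite; a poset is taken on $\mathcal{P}=\{1,\dots,n\}$, labelled so that $x\preceq y$ implies $x\le y$ as integers. $Rel(\mathcal{P})$ is the set of strict relations (pairs $(p,q)$ with $p\prec q$); $Ext(\mathcal{P})$ is the set of minimal and maximal elements. $\mathcal{P}$ is connected if its Hasse diagram is connected. An order ideal is a subset $I$ with $y\prec x\in I\Rightarrow y\in I$; a filter is a subset $F$ with $F\ni x\prec y\Rightarrow y\in F$. $\mathfrak{g}(\mathcal{P})$ is the complex Lie algebra with basis $E_{p,q}$ ($p\preceq q$), with commutator bracket of the product $E_{p,q}E_{r,s}=\delta_{q,r}E_{p,s}$; $\mathfrak{g}_A(\mathcal{P})$ is its subalgebra of trace-zero elements ($\sum c_{p,q}E_{p,q}$ has trace $\sum c_{p,p}$). For a one-form $\varphi\in\mathfrak{g}^*$, $d\varphi(x,y)=-\varphi([x,y])$, and the kernel of $d\varphi$ is $\{x: \varphi([x,y])=0\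 \forall y\in\mathfrak{g}\}$. $\mathrm{ind}(\mathfrak{g})=\min_{\varphi\in\mathfrak g^*}\dim\ker(d\varphi)$. $\mathfrak{g}$ is Frobenius if $\mathrm{ind}(\mathfrak{g})=0$; a $\varphi$ with $\ker(d\varphi)=0$ is then a Frobenius one-form. A $(2k+1)$-dimensional $\mathfrak{g}$ is contact if some $\varphi\in\mathfrak{g}^*$ (a contact form) satisfies $\varphi\wedge(d\varphi)^k\neq0$. $\mathcal{P}$ is called Frobenius (contact) if $\mathfrak{g}_A(\mathcal{P})$ is. **One-forms.** $E^*_{p,q}$ ($p\preceq q$) is the functional taking an element to its coefficient of $E_{p,q}$. For a set $S$ of pairs $(p,q)$ with $p\preceq q$, $\varphi_S=\sum_{(p,q)\in S}E^*_{p,q}$; such a form may be regarded on $\mathfrak{g}(\mathcal{P})$ or on $\mathfrak{g}_A(\mathcal{P})$. $\ker(d\varphi)$ denotes the kernel for $\varphi$ on $\mathfrak{g}(\mathcal{P})$ and $\ker_A(d\varphi)$ the kernel for $\varphi$ on $\mathfrak{g}_A(\mathcal{P})$. For $S\subseteq Rel(\mathcal{P})$, $\Gamma_{\varphi_S}$ is the directed graph on $\mathcal{P}$ with edge $p\to q$ for $(p,q)\in S$; $\varphi_S$ is small if $\Gamma_{\varphi_S}$ is a spanning tree of the comparability graph of $\mathcal{P}$ (the graph on $\mathcal P$ joining comparable distinct elements). $U_{\varphi_S}(\mathcal{P})$, $D_{\varphi_S}(\mathcal{P})$, $O_{\varphi_S}(\mathcal{P})$ are the sets of sinks, of sources, and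 of the remaining vertices of $\Gamma_{\varphi_S}$. **Binary spectrum.** For a Frobenius Lie algebra with Frobenius one-form $\varphi$, let $\widehat\varphi$ be the unique element with $\varphi([\widehat\varphi,-])=\varphi$; the multiset of eigenvalues of $\mathrm{ad}(\widehat\varphi)$ is independent of $\varphi$ and is the spectrum. The spectrum is binary if it consists of an equal number of 0's and 1's. **Toral-pair.** $(\mathcal{P},\varphi)$ with $\mathcal{P}$ a Frobenius poset and $\varphi=\varphi_S$, $S\subseteq Rel(\mathcal{P})$, a Frobenius one-form on $\mathfrak{g}_A(\mathcal{P})$, such that: (P1) $|Ext(\mathcal{P})|\in\{2,3\}$; (P2) $\mathfrak{g}_A(\mathcal{P})$ has a binary spectrum; (F1) $\varphi$ is small; (F2) $U_\varphi(\mathcal{P})$ is a filter, $D_\varphi(\mathcal{P})$ is an order ideal, $O_\varphi(\mathcal{P})=\emptyset$; (F3) $\Gamma_\varphi$ contains all edges between comparable elements of $Ext(\mathcal{P})$; (F4) every $B\in\ker(d\varphi)$ satisfies $E^*_{p,p}(B)=E^*_{q,q}(B)$ for all $p,q\in\mathcal{P}$ and $E^*_{p,q}(B)=0$ for all $p\prec q$. **Contact toral-pair.** $(\mathcal{P},\varphi)$ with $\mathcal{P}$ a contact poset and $\varphi=\varphi_S$, $S\subseteq Rel(\mathcal{P})\cup\{(p,p):p\in\mathcal{P}\}$, a contact form on $\mathfrak{g}_A(\mathcal{P})$, such that: (CP1) $\mathcal{P}$ is connected; (CP2) $|Ext(\mathcal{P})|\in\{2,3\}$; (CF1) $E^*_{p,p}$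 is a summand of $\varphi$ iff $p=1$; (CF2) $\varphi-E^*_{1,1}$ is small; (CF3) $U_{\varphi-E^*_{1,1}}(\mathcal{P})$ is a filter, $D_{\varphi-E^*_{1,1}}(\mathcal{P})$ is an order ideal, $O_{\varphi-E^*_{1,1}}(\mathcal{P})=\emptyset$; (CF4) $\Gamma_{\varphi-E^*_{1,1}}$ contains all edges between comparable elements of $Ext(\mathcal{P})$. "(Contact) toral-pair" means a toral-pair or a contact toral-pair. **Gluing rules.** Let $\mathcal{Q}$ be a poset and $\mathcal{S}$ (a disjoint copy of) the poset of a (contact) toral-pair. If $|Ext(\mathcal{S})|=2$ write $Ext(\mathcal{S})=\{a_1,c\}$ with $c\prec a_1$; if $|Ext(\mathcal{S})|=3$ write $Ext(\mathcal{S})=\{a_1,a_2,c\}$ with either $c\prec a_1,a_2$ or $a_1,a_2\prec c$. Combine $\mathcal{S}$ and $\mathcal{Q}$ by identifying some of $c,a_1,a_2$ with distinct elements $x,y,z\in Ext(\mathcal{Q})$ respectively, minimal elements with minimal elements and maximal with maximal, the relations being those inherited from $\mathcal{S}$ and $\mathcal{Q}$. Write $\sim$ for comparable in $\mathcal{Q}$; "$=$" means identified, and elements not mentioned are not identified with anything (rules identifying $a_2$ apply only if $|Ext(\mathcal{S})|=3$). The rules needed here: $A_1$: $a_1=y$ only. $A_2$: $a_2=z$ only. $C$: $c=x$ only. $D_1$: $c=x,\ a_1=y$, $y\sim x$. $D_2$: $c=x,\ a_2=z$, $z\sim x$. $F$: $c=x,a_1=y,a_2=z$, $y\sim x$, $z\sim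 x$. **Contact sequence, contact toral poset.** Let $\{(\mathcal{S}_i,\varphi_{\mathcal{S}_i})\}_{i=1}^n$ be (contact) toral-pairs and $\mathcal{S}_1=\mathcal{Q}_1\subset\mathcal{Q}_2\subset\dots\subset\mathcal{Q}_n=\mathcal{P}$ posets such that $\mathcal{Q}_i$ is formed from $\mathcal{Q}_{i-1}$ and $\mathcal{S}_i$ by a rule from $\{A_1,A_2,C,D_1,D_2,F\}$ for $i=2,\dots,n$, and exactly one of the pairs is a contact toral-pair. The sequence of $\mathcal{Q}_i$'s is then a contact sequence, and $\mathcal{P}$ a contact toral poset. Convention: the unique contact toral-pair is $(\mathcal{S}_1,\varphi_{\mathcal{S}_1})$, and $1$ denotes in every $\mathcal{Q}_i$ the element labelled $1$ of $\mathcal{S}_1$. **Contact toral one-forms.** When $\mathcal{S}_i$ is glued to $\mathcal{Q}_{i-1}$, let $x_i,y_i,z_i$ denote the glued elements $c=x$, $a_1=y$, $a_2=z$. Forms $\varphi_{\mathcal{Q}_{i-1}},\varphi_{\mathcal{S}_i}$ are regarded on $\mathfrak{g}_A(\mathcal{Q}_i)$ through the coordinate functionals $E^*_{p,q}$. Define $\varphi_{\mathcal{Q}_1}=\varphi_{\mathcal{S}_1}$ and, for $1<i\le n$: under rules $A_1,A_2,C$, $\varphi_{\mathcal{Q}_i}=\varphi_{\mathcal{Q}_{i-1}}+\varphi_{\mathcal{S}_i}$; under $D_1$, $\varphi_{\mathcal{Q}_i}=\varphi_{\mathcal{Q}_{i-1}}+\varphi_{\mathcal{S}_i}-E^*_{x_i,y_i}$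 if $c$ is the unique minimal element of $\mathcal{S}_i$, and with $E^*_{y_i,x_i}$ in place of $E^*_{x_i,y_i}$ if $c$ is the unique maximal element; under $D_2$, the same with $z_i$ in place of $y_i$; under $F$, $\varphi_{\mathcal{Q}_i}=\varphi_{\mathcal{Q}_{i-1}}+\varphi_{\mathcal{S}_i}-E^*_{x_i,y_i}-E^*_{x_i,z_i}$ if $c$ is the unique minimal element of $\mathcal{S}_i$, and $\varphi_{\mathcal{Q}_{i-1}}+\varphi_{\mathcal{S}_i}-E^*_{y_i,x_i}-E^*_{z_i,x_i}$ if $c$ is the unique maximal element. *)

theory Defs
  imports Complex_Main "HOL-Library.Function_Algebras" "HOL-Combinatorics.Permutations"
begin

section \<open>Posets\<close>

text \<open>
  A poset is given by its reflexive order relation \<open>r\<close>; the underlying set is \<open>Field r\<close>.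
\<close>

definition labelled_poset :: "nat rel \<Rightarrow> bool" where
  "labelled_poset r \<longleftrightarrow>
     (\<exists>n. Field r = {1..n}) \<and> Partial_order r \<and> (\<forall>x y. (x, y) \<in> r \<longrightarrow> x \<le> y)"

definition Rel :: "'a rel \<Rightarrow> 'a rel" where
  "Rel r = r - Id"

definition min_elems :: "'a rel \<Rightarrow> 'a set" where
  "min_elems r = {x \<in> Field r. \<forall>y. (y, x) \<in> r \<longrightarrow> y = x}"

definition max_elems :: "'a rel \<Rightarrow> 'a set" where
  "max_elems r = {x \<in> Field r. \<forall>y. (x, y) \<in> r \<longrightarrow> y = x}"

definition Ext :: "'a rel \<Rightarrow> 'a set" where
  "Ext r = min_elems r \<union> max_elems r"

definition comparable :: "'a rel \<Rightarrow> 'a \<Rightarrow> 'a \<Rightarrow> bool" where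
  "comparable r x y \<longleftrightarrow> (x, y) \<in> r \<or> (y, x) \<in> r"

definition order_ideal :: "'a rel \<Rightarrow> 'a set \<Rightarrow> bool" where
  "order_ideal r I \<longleftrightarrow> I \<subseteq> Field r \<and> (\<forall>x\<in>I. \<forall>y. (y, x) \<in> Rel r \<longrightarrow> y \<in> I)"

definition order_filter :: "'a rel \<Rightarrow> 'a set \<Rightarrow> bool" where
  "order_filter r A \<longleftrightarrow> A \<subseteq> Field r \<and> (\<forall>x\<in>A. \<forall>y. (x, y) \<in> Rel r \<longrightarrow> y \<in> A)"

definition Hasse :: "'a rel \<Rightarrow> 'a rel" where
  "Hasse r = {(p, q) \<in> Rel r. \<not> (\<exists>z. (p, z) \<in> Rel r \<and> (z, q) \<in> Rel r)}"


section \<open>Graphs\<close>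

text \<open>
  Undirected graphs are given by a vertex set and a symmetric adjacency relation;
  \<open>S \<union> S\<inverse>\<close> forgets the directions of the edges in \<open>S\<close>.
\<close>

definition graph_connected :: "'a set \<Rightarrow> 'a rel \<Rightarrow> bool" where
  "graph_connected V E \<longleftrightarrow> (\<forall>p\<in>V. \<forall>q\<in>V. (p, q) \<in> E\<^sup>*)"

definition graph_cycle :: "'a rel \<Rightarrow> 'a list \<Rightarrow> bool" where
  "graph_cycle E xs \<longleftrightarrow> 3 \<le> length xs \<and> distinct xs \<and>
     (\<forall>i<length xs. (xs ! i, xs ! (Suc i mod length xs)) \<in> E)"

definition graph_tree :: "'a set \<Rightarrow> 'a rel \<Rightarrow> bool" where
  "graph_tree V E \<longleftrightarrow> V \<noteq> {} \<and> E \<subseteq> V \<times> V \<and> graph_connected V E \<and> (\<nexists>xs. graph_cycle E xs)"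

definition spanning_tree_of :: "'a set \<Rightarrow> 'a rel \<Rightarrow> 'a rel \<Rightarrow> bool" where
  "spanning_tree_of V G E \<longleftrightarrow> E \<subseteq> G \<and> graph_tree V E"

definition comparability_graph :: "'a rel \<Rightarrow> 'a rel" where
  "comparability_graph r = {(p, q). p \<noteq> q \<and> comparable r p q}"

definition connected_poset :: "'a rel \<Rightarrow> bool" where
  "connected_poset r \<longleftrightarrow> graph_connected (Field r) (Hasse r \<union> (Hasse r)\<inverse>)"

definition sinks :: "'a rel \<Rightarrow> 'a rel \<Rightarrow> 'a set" where
  "sinks r S = {p \<in> Field r. \<forall>q. (p, q) \<notin> S}"

definition sources :: "'a rel \<Rightarrow> 'a rel \<Rightarrow> 'a set" where
  "sources r S = {p \<in> Field r. \<forall>q. (q, p) \<notin> S}"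

definition others :: "'a rel \<Rightarrow> 'a rel \<Rightarrow> 'a set" where
  "others r S = Field r - sinks r S - sources r S"

definition small :: "'a rel \<Rightarrow> 'a rel \<Rightarrow> bool" where
  "small r S \<longleftrightarrow> S \<subseteq> Rel r \<and> spanning_tree_of (Field r) (comparability_graph r) (S \<union> S\<inverse>)"


section \<open>Lie poset algebras\<close>

text \<open>
  The element \<open>\<Sum> c\<^bsub>p,q\<^esub> E\<^bsub>p,q\<^esub>\<close> is the function \<open>\<lambda>p q. c\<^bsub>p,q\<^esub>\<close>, which vanishes off the
  order relation. The algebras of all posets on subsets of one type are thereby subspaces of
  one complex vector space, and the functionals \<open>E\<^sup>*\<^bsub>p,q\<^esub>\<close> are defined on all of them at once.
\<close>

type_synonym 'a elt = "'a \<Rightarrow> 'a \<Rightarrow> complex"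

definition cscale :: "complex \<Rightarrow> 'a elt \<Rightarrow> 'a elt" where
  "cscale c B = (\<lambda>p q. c * B p q)"

global_interpretation elt: vector_space "cscale :: complex \<Rightarrow> 'a elt \<Rightarrow> 'a elt"
  by unfold_locales (auto simp: cscale_def fun_eq_iff algebra_simps)

definition elt_prod :: "'a rel \<Rightarrow> 'a elt \<Rightarrow> 'a elt \<Rightarrow> 'a elt" where
  "elt_prod r B C = (\<lambda>p s. \<Sum>q\<in>Field r. B p q * C q s)"

definition bracket :: "'a rel \<Rightarrow> 'a elt \<Rightarrow> 'a elt \<Rightarrow> 'a elt" where
  "bracket r B C = elt_prod r B C - elt_prod r C B"

definition lie_g :: "'a rel \<Rightarrow> 'a elt set" where
  "lie_g r = {B. \<forall>p q. (p, q) \<notin> r \<longrightarrow> B p q = 0}"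

definition lie_gA :: "'a rel \<Rightarrow> 'a elt set" where
  "lie_gA r = {B \<in> lie_g r. (\<Sum>p\<in>Field r. B p p) = 0}"

type_synonym 'a form = "'a elt \<Rightarrow> complex"

definition Estar :: "'a \<Rightarrow> 'a \<Rightarrow> 'a form" where
  "Estar p q = (\<lambda>B. B p q)"

definition phi_of :: "'a rel \<Rightarrow> 'a form" where
  "phi_of S = (\<Sum>(p, q)\<in>S. Estar p q)"


section \<open>One-forms on a Lie algebra\<close>

text \<open>
  \<open>L\<close> is the carrier of the Lie algebra and \<open>br\<close> its bracket. A one-form on \<open>L\<close> is a function
  on the ambient space that is linear on \<open>L\<close>; its values off \<open>L\<close> play no role.
\<close>

definition dual :: "'a elt set \<Rightarrow> 'a form set" where
  "dual L = {\<phi>. (\<forall>x\<in>L. \<forall>y\<in>L. \<phi> (x + y) = \<phi> x + \<phi> y) \<and>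
                 (\<forall>c. \<forall>x\<in>L. \<phi> (cscale c x) = c * \<phi> x)}"

definition form_ker :: "'a elt set \<Rightarrow> ('a elt \<Rightarrow> 'a elt \<Rightarrow> 'a elt) \<Rightarrow> 'a form \<Rightarrow> 'a elt set" where
  "form_ker L br \<phi> = {x \<in> L. \<forall>y\<in>L. \<phi> (br x y) = 0}"

definition lie_index :: "'a elt set \<Rightarrow> ('a elt \<Rightarrow> 'a elt \<Rightarrow> 'a elt) \<Rightarrow> nat" where
  "lie_index L br = (LEAST d. \<exists>\<phi>\<in>dual L. d = elt.dim (form_ker L br \<phi>))"

definition frobenius :: "'a elt set \<Rightarrow> ('a elt \<Rightarrow> 'a elt \<Rightarrow> 'a elt) \<Rightarrow> bool" where
  "frobenius L br \<longleftrightarrow> lie_index L br = 0"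

definition frobenius_form :: "'a elt set \<Rightarrow> ('a elt \<Rightarrow> 'a elt \<Rightarrow> 'a elt) \<Rightarrow> 'a form \<Rightarrow> bool" where
  "frobenius_form L br \<phi> \<longleftrightarrow> \<phi> \<in> dual L \<and> form_ker L br \<phi> = {0}"

text \<open>
  An alternating \<open>k\<close>-form is a function of infinite sequences that only reads the entries
  \<open>0, \<dots>, k - 1\<close>; \<open>wedge p q\<close> is the exterior product of a \<open>p\<close>-form and a \<open>q\<close>-form.
\<close>

type_synonym 'a multiform = "(nat \<Rightarrow> 'a elt) \<Rightarrow> complex"

definition wedge :: "nat \<Rightarrow> nat \<Rightarrow> 'a multiform \<Rightarrow> 'a multiform \<Rightarrow> 'a multiform" where
  "wedge p q \<alpha> \<beta> = (\<lambda>v. (\<Sum>\<sigma> | \<sigma> permutes {..<p + q}.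
      of_int (sign \<sigma>) * \<alpha> (\<lambda>i. v (\<sigma> i)) * \<beta> (\<lambda>i. v (\<sigma> (p + i)))) / (fact p * fact q))"

primrec wedge_power :: "'a multiform \<Rightarrow> nat \<Rightarrow> 'a multiform" where
  "wedge_power \<omega> 0 = (\<lambda>v. 1)"
| "wedge_power \<omega> (Suc k) = wedge 2 (2 * k) \<omega> (wedge_power \<omega> k)"

definition one_form :: "'a form \<Rightarrow> 'a multiform" where
  "one_form \<phi> = (\<lambda>v. \<phi> (v 0))"

definition d_form :: "('a elt \<Rightarrow> 'a elt \<Rightarrow> 'a elt) \<Rightarrow> 'a form \<Rightarrow> 'a multiform" where
  "d_form br \<phi> = (\<lambda>v. - \<phi> (br (v 0) (v 1)))"

definition contact_form :: "'a elt set \<Rightarrow> ('a elt \<Rightarrow> 'a elt \<Rightarrow> 'a elt) \<Rightarrow> 'a form \<Rightarrow> bool" where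
  "contact_form L br \<phi> \<longleftrightarrow> \<phi> \<in> dual L \<and>
     (\<exists>k. elt.dim L = 2 * k + 1 \<and>
       (\<exists>v. (\<forall>i. v i \<in> L) \<and>
            wedge 1 (2 * k) (one_form \<phi>) (wedge_power (d_form br \<phi>) k) v \<noteq> 0))"

definition contact :: "'a elt set \<Rightarrow> ('a elt \<Rightarrow> 'a elt \<Rightarrow> 'a elt) \<Rightarrow> bool" where
  "contact L br \<longleftrightarrow> (\<exists>\<phi>. contact_form L br \<phi>)"


section \<open>Spectrum\<close>

definition principal_element ::
    "'a elt set \<Rightarrow> ('a elt \<Rightarrow> 'a elt \<Rightarrow> 'a elt) \<Rightarrow> 'a form \<Rightarrow> 'a elt" where
  "principal_element L br \<phi> = (THE h. h \<in> L \<and> (\<forall>y\<in>L. \<phi> (br h y) = \<phi> y))"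

text \<open>Algebraic multiplicity of an eigenvalue, as the dimension of the generalized eigenspace.\<close>

definition alg_mult :: "'a elt set \<Rightarrow> ('a elt \<Rightarrow> 'a elt) \<Rightarrow> complex \<Rightarrow> nat" where
  "alg_mult L T \<mu> = elt.dim {x \<in> L. \<exists>m. ((\<lambda>y. T y - cscale \<mu> y) ^^ m) x = 0}"

text \<open>
  The multiset of eigenvalues of the adjoint of the principal element, as a multiplicity
  function. It does not depend on the choice of the Frobenius one-form \<open>\<phi>\<close>.
\<close>

definition spectrum ::
    "'a elt set \<Rightarrow> ('a elt \<Rightarrow> 'a elt \<Rightarrow> 'a elt) \<Rightarrow> 'a form \<Rightarrow> complex \<Rightarrow> nat" where
  "spectrum L br \<phi> = alg_mult L (br (principal_element L br \<phi>))"

definition binary_spectrum :: "'a elt set \<Rightarrow> ('a elt \<Rightarrow> 'a elt \<Rightarrow> 'a elt) \<Rightarrow> bool" where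
  "binary_spectrum L br \<longleftrightarrow> (\<exists>\<phi>. frobenius_form L br \<phi> \<and>
     (\<forall>\<mu>. \<mu> \<noteq> 0 \<and> \<mu> \<noteq> 1 \<longrightarrow> spectrum L br \<phi> \<mu> = 0) \<and>
     spectrum L br \<phi> 0 = spectrum L br \<phi> 1)"


section \<open>Toral-pairs\<close>

text \<open>
  The pair consisting of the poset \<open>r\<close> and the one-form \<open>phi_of S\<close> is represented by \<open>r\<close> and
  \<open>S\<close>; the form \<open>phi_of S\<close> determines \<open>S\<close>, being a sum of distinct coordinate functionals.
\<close>

definition toral_pair :: "nat rel \<Rightarrow> nat rel \<Rightarrow> bool" where
  "toral_pair r S \<longleftrightarrow>
     labelled_poset r \<and> frobenius (lie_gA r) (bracket r) \<and>
     S \<subseteq> Rel r \<and> frobenius_form (lie_gA r) (bracket r) (phi_of S) \<and>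
     card (Ext r) \<in> {2, 3} \<and>
     binary_spectrum (lie_gA r) (bracket r) \<and>
     small r S \<and>
     order_filter r (sinks r S) \<and> order_ideal r (sources r S) \<and> others r S = {} \<and>
     (\<forall>p\<in>Ext r. \<forall>q\<in>Ext r. (p, q) \<in> Rel r \<longrightarrow> (p, q) \<in> S) \<and>
     (\<forall>B\<in>form_ker (lie_g r) (bracket r) (phi_of S).
        (\<forall>p\<in>Field r. \<forall>q\<in>Field r. Estar p p B = Estar q q B) \<and>
        (\<forall>p q. (p, q) \<in> Rel r \<longrightarrow> Estar p q B = 0))"

definition contact_toral_pair :: "nat rel \<Rightarrow> nat rel \<Rightarrow> bool" where
  "contact_toral_pair r S \<longleftrightarrow>
     labelled_poset r \<and> contact (lie_gA r) (bracket r) \<and>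
     S \<subseteq> Rel r \<union> Id_on (Field r) \<and> contact_form (lie_gA r) (bracket r) (phi_of S) \<and>
     connected_poset r \<and>
     card (Ext r) \<in> {2, 3} \<and>
     (\<forall>p\<in>Field r. (p, p) \<in> S \<longleftrightarrow> p = 1) \<and>
     (let S' = S - {(1, 1)} in
        small r S' \<and>
        order_filter r (sinks r S') \<and> order_ideal r (sources r S') \<and> others r S' = {} \<and>
        (\<forall>p\<in>Ext r. \<forall>q\<in>Ext r. (p, q) \<in> Rel r \<longrightarrow> (p, q) \<in> S'))"


section \<open>Gluing\<close>

datatype glue_rule = Rule_A1 | Rule_A2 | Rule_C | Rule_D1 | Rule_D2 | Rule_F

text \<open>
  A gluing of a poset \<open>s\<close> onto a poset \<open>Q\<close> consists of a rule, the names \<open>c\<close>, \<open>a\<^sub>1\<close>, \<open>a\<^sub>2\<close> of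
  the extremal elements of \<open>s\<close>, and an injection placing a copy of \<open>s\<close> beside \<open>Q\<close>, such that
  the copy meets \<open>Q\<close> exactly in the elements to be identified. The glued elements
  \<open>x\<close>, \<open>y\<close>, \<open>z\<close> of \<open>Q\<close> are then the images of \<open>c\<close>, \<open>a\<^sub>1\<close>, \<open>a\<^sub>2\<close>. If \<open>s\<close> has only two
  extremal elements then \<open>el_a2\<close> is meaningless and never used.
\<close>

record gluing =
  rule_of :: glue_rule
  emb :: "nat \<Rightarrow> nat"
  el_c :: nat
  el_a1 :: nat
  el_a2 :: nat

definition copy :: "gluing \<Rightarrow> nat rel \<Rightarrow> nat rel" where
  "copy g s = map_prod (emb g) (emb g) ` s"

definition ext_names :: "gluing \<Rightarrow> nat rel \<Rightarrow> bool" where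
  "ext_names g s \<longleftrightarrow>
     (let c = el_c g; a1 = el_a1 g; a2 = el_a2 g in
        card (Ext s) = 2 \<and> Ext s = {a1, c} \<and> (c, a1) \<in> Rel s \<or>
        card (Ext s) = 3 \<and> Ext s = {a1, a2, c} \<and>
          ((c, a1) \<in> Rel s \<and> (c, a2) \<in> Rel s \<or> (a1, c) \<in> Rel s \<and> (a2, c) \<in> Rel s))"

definition identified :: "gluing \<Rightarrow> nat set" where
  "identified g = (case rule_of g of
      Rule_A1 \<Rightarrow> {el_a1 g}
    | Rule_A2 \<Rightarrow> {el_a2 g}
    | Rule_C \<Rightarrow> {el_c g}
    | Rule_D1 \<Rightarrow> {el_c g, el_a1 g}
    | Rule_D2 \<Rightarrow> {el_c g, el_a2 g}
    | Rule_F \<Rightarrow> {el_c g, el_a1 g, el_a2 g})"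

definition rule_applicable :: "gluing \<Rightarrow> nat rel \<Rightarrow> nat rel \<Rightarrow> bool" where
  "rule_applicable g s Q \<longleftrightarrow>
     (let x = emb g (el_c g); y = emb g (el_a1 g); z = emb g (el_a2 g) in
      case rule_of g of
        Rule_A1 \<Rightarrow> True
      | Rule_A2 \<Rightarrow> card (Ext s) = 3
      | Rule_C \<Rightarrow> True
      | Rule_D1 \<Rightarrow> comparable Q y x
      | Rule_D2 \<Rightarrow> card (Ext s) = 3 \<and> comparable Q z x
      | Rule_F \<Rightarrow> card (Ext s) = 3 \<and> comparable Q y x \<and> comparable Q z x)"

text \<open>
  The union of the two relations is already transitive, because identified elements are
  minimal in both posets or maximal in both.
\<close>

definition glued :: "gluing \<Rightarrow> nat rel \<Rightarrow> nat rel \<Rightarrow> nat rel \<Rightarrow> bool" where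
  "glued g s Q Q' \<longleftrightarrow>
     ext_names g s \<and> rule_applicable g s Q \<and>
     inj_on (emb g) (Field s) \<and>
     emb g ` Field s \<inter> Field Q = emb g ` identified g \<and>
     (\<forall>e\<in>identified g. e \<in> min_elems s \<and> emb g e \<in> min_elems Q \<or>
                        e \<in> max_elems s \<and> emb g e \<in> max_elems Q) \<and>
     Q' = Q \<union> copy g s"


section \<open>Contact sequences and contact toral one-forms\<close>

definition contact_sequence ::
    "nat \<Rightarrow> (nat \<Rightarrow> nat rel) \<Rightarrow> (nat \<Rightarrow> nat rel) \<Rightarrow> (nat \<Rightarrow> gluing) \<Rightarrow> (nat \<Rightarrow> nat rel) \<Rightarrow> bool" where
  "contact_sequence n s S g Q \<longleftrightarrow>
     (\<forall>i\<in>{1..n}. toral_pair (s i) (S i) \<or> contact_toral_pair (s i) (S i)) \<and>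
     {i \<in> {1..n}. contact_toral_pair (s i) (S i)} = {1} \<and>
     Q 1 = s 1 \<and>
     (\<forall>i\<in>{2..n}. glued (g i) (s i) (Q (i - 1)) (Q i))"

text \<open>
  The coordinate functional of the glued edge between \<open>c\<close> and \<open>e\<close>, where \<open>e\<close> is \<open>a\<^sub>1\<close> or
  \<open>a\<^sub>2\<close>; if \<open>c\<close> is not the unique minimal element of \<open>s\<close>, it is the unique maximal one.
\<close>

definition glued_edge :: "gluing \<Rightarrow> nat rel \<Rightarrow> nat \<Rightarrow> nat form" where
  "glued_edge g s e =
     (if min_elems s = {el_c g} then Estar (emb g (el_c g)) (emb g e)
      else Estar (emb g e) (emb g (el_c g)))"

definition glue_correction :: "gluing \<Rightarrow> nat rel \<Rightarrow> nat form" where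
  "glue_correction g s = (case rule_of g of
      Rule_A1 \<Rightarrow> 0
    | Rule_A2 \<Rightarrow> 0
    | Rule_C \<Rightarrow> 0
    | Rule_D1 \<Rightarrow> glued_edge g s (el_a1 g)
    | Rule_D2 \<Rightarrow> glued_edge g s (el_a2 g)
    | Rule_F \<Rightarrow> glued_edge g s (el_a1 g) + glued_edge g s (el_a2 g))"

definition contact_toral_forms ::
    "nat \<Rightarrow> (nat \<Rightarrow> nat rel) \<Rightarrow> (nat \<Rightarrow> nat rel) \<Rightarrow> (nat \<Rightarrow> gluing) \<Rightarrow> (nat \<Rightarrow> nat form) \<Rightarrow> bool" where
  "contact_toral_forms n s S g \<phi> \<longleftrightarrow>
     \<phi> 1 = phi_of (S 1) \<and>
     (\<forall>i\<in>{2..n}. \<phi> i = \<phi> (i - 1) + phi_of (copy (g i) (S i)) - glue_correction (g i) (s i))"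

end

theory Submission
  imports Defs
begin

text \<open>
  A one-form \<open>\<phi>\<close> is contact exactly if it maps the kernel of \<open>d\<phi>\<close> isomorphically onto the ground
  field (\<open>contact_form_iff\<close>). On a trace-zero Lie poset algebra the kernel is the trace-zero part of
  the kernel on the full algebra \<open>\<gg>(\<P>)\<close>, which contains the identity \<open>I\<close>. So contactness of
  \<open>\<phi>\<^sub>S + E\<^sup>*\<^bsub>1,1\<^esub>\<close> is a statement about the kernel \<open>K\<close> of \<open>d\<phi>\<^sub>S\<close> on \<open>\<gg>(\<P>)\<close>, because \<open>E\<^sup>*\<^bsub>1,1\<^esub>\<close> vanishes on
  brackets, \<open>1\<close> being minimal.

  For the contact toral-pair, \<open>\<phi>\<^sub>S\<close> vanishes on \<open>K\<close>, hence the contact form takes the value \<open>B\<^bsub>1,1\<^esub>\<close> at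
  \<open>B \<in> K\<close>, and \<open>K\<close> is spanned by \<open>I\<close> and an element \<open>R\<close> with \<open>R\<^bsub>1,1\<^esub> = 0\<close> and nonzero trace. The
  nonvanishing of this trace is what contactness amounts to, and it is what gluing might destroy:
  the trace of \<open>R\<close> grows by a multiple of a diagonal entry. The remedy is that \<open>K\<close> is closed under the
  associative product. So \<open>R\<^sup>2\<close> is a multiple of \<open>R\<close>, and after scaling all diagonal entries of \<open>R\<close>
  are \<open>0\<close> or \<open>1\<close> (\<open>contact_stateI\<close>). Positivity of the trace is then preserved.

  When a toral-pair is glued on, the kernel does not change (\<open>contact_state_Un\<close>). On the new poset a
  kernel element satisfies all equations of the toral-pair except possibly the diagonal ones at the
  glued elements. As the glued elements form a star whose edges are shared by both one-forms, these can
  be corrected by changing entries at the shared edges, and the kernel condition in the definition of a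
  toral-pair forces the result to be scalar. Hence restriction to the old poset is an isomorphism
  of kernels, whose inverse continues an element by a scalar that already occurs on its diagonal.
\<close>

section \<open>Wedge products as signed sums\<close>

text \<open>
  Antisymmetrization without normalizing factor. It serves to turn the iterated wedge products
  into a single signed sum over permutations.
\<close>

definition alternation :: "nat \<Rightarrow> ((nat \<Rightarrow> 'b) \<Rightarrow> complex) \<Rightarrow> (nat \<Rightarrow> 'b) \<Rightarrow> complex" where
  "alternation N \<alpha> v = (\<Sum>\<sigma> | \<sigma> permutes {..<N}. of_int (sign \<sigma>) * \<alpha> (\<lambda>i. v (\<sigma> i)))"

lemma wedge_eq_alternation:
  "wedge p q \<alpha> \<beta> v = alternation (p + q) (\<lambda>v. \<alpha> v * \<beta> (\<lambda>i. v (p + i))) v / (fact p * fact q)"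
  by (simp add: wedge_def alternation_def mult.assoc)

text \<open>
  Reindexing the sum over \<open>\<sigma>\<close> by \<open>\<tau> \<circ> \<sigma>\<close>; this needs no antisymmetry of \<open>\<alpha>\<close>, so wedge products of
  arbitrary forms are alternating.
\<close>

lemma alternation_compose:
  assumes "\<tau> permutes {..<N}"
  shows "alternation N \<alpha> (\<lambda>i. v (\<tau> i)) = of_int (sign \<tau>) * alternation N \<alpha> v"
proof -
  let ?P = "{\<sigma>. \<sigma> permutes {..<N}}"
  have "of_int (sign \<tau>) * alternation N \<alpha> v
      = (\<Sum>\<sigma>\<in>?P. of_int (sign \<tau>) * (of_int (sign (\<tau> \<circ> \<sigma>)) * \<alpha> (\<lambda>i. v ((\<tau> \<circ> \<sigma>) i))))"
    unfolding alternation_def sum_distrib_left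
    by (rule setum_permutations_compose_left[OF assms])
  also have "\<dots> = (\<Sum>\<sigma>\<in>?P. of_int (sign \<sigma>) * \<alpha> (\<lambda>i. v (\<tau> (\<sigma> i))))"
  proof (rule sum.cong[OF refl])
    fix \<sigma> assume "\<sigma> \<in> ?P"
    then have "sign (\<tau> \<circ> \<sigma>) = sign \<tau> * sign \<sigma>"
      using assms by (auto intro!: sign_compose intro: permutes_imp_permutation)
    moreover have "sign \<tau> * sign \<tau> = 1"
      by (simp add: sign_def)
    then have "of_int (sign \<tau>) * (of_int (sign \<tau>) :: complex) = 1"
      by (metis of_int_1 of_int_mult)
    ultimately show "of_int (sign \<tau>) * (of_int (sign (\<tau> \<circ> \<sigma>)) * \<alpha> (\<lambda>i. v ((\<tau> \<circ> \<sigma>) i)))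
        = of_int (sign \<sigma>) * \<alpha> (\<lambda>i. v (\<tau> (\<sigma> i)))"
      by (simp add: o_def mult.assoc[symmetric])
  qed
  finally show ?thesis
    by (simp add: alternation_def)
qed

lemma alternation_eq_0:
  assumes "a < N" "b < N" "a \<noteq> b" "v a = v b"
  shows "alternation N \<alpha> v = 0"
proof -
  have "alternation N \<alpha> (\<lambda>i. v (transpose a b i)) = of_int (sign (transpose a b)) * alternation N \<alpha> v"
    using assms by (intro alternation_compose permutes_swap_id) auto
  moreover have "(\<lambda>i. v (transpose a b i)) = v"
    using assms by (auto simp: fun_eq_iff transpose_def)
  ultimately show ?thesis
    using assms by (simp add: sign_swap_id)
qed

definition shift_perm :: "nat \<Rightarrow> (nat \<Rightarrow> nat) \<Rightarrow> nat \<Rightarrow> nat" where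
  "shift_perm p \<tau> j = (if j < p then j else p + \<tau> (j - p))"

lemma shift_perm_permutes_sign:
  assumes "\<tau> permutes {..<q}"
  shows "shift_perm p \<tau> permutes {..<p + q} \<and> sign (shift_perm p \<tau>) = sign \<tau>"
  using assms finite_lessThan[of q]
proof (induction rule: permutes_induct)
  case id
  have "shift_perm p id = id"
    by (auto simp: shift_perm_def fun_eq_iff)
  then show ?case
    by (metis permutes_id sign_id)
next
  case (swap a b \<tau>)
  have eq: "shift_perm p (transpose a b \<circ> \<tau>) = transpose (p + a) (p + b) \<circ> shift_perm p \<tau>"
    by (auto simp: shift_perm_def fun_eq_iff transpose_def)
  have t: "transpose (p + a) (p + b) permutes {..<p + q}"
    using swap by (intro permutes_swap_id) auto
  have "sign (transpose (p + a) (p + b) \<circ> shift_perm p \<tau>) = sign (transpose (p + a) (p + b)) * sign \<tau>"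
    using swap.IH t by (metis finite_lessThan permutes_imp_permutation sign_compose)
  also have "\<dots> = sign (transpose a b \<circ> \<tau>)"
    using swap by (subst sign_compose) (auto simp: sign_swap_id intro: permutes_imp_permutation permutation_swap_id)
  finally show ?case
    using permutes_compose[OF conjunct1[OF swap.IH] t] by (simp only: eq)
qed

text \<open>
  An inner antisymmetrization of the last \<open>q\<close> arguments is redundant under an outer one: by
  reindexing the outer sum with a shifted permutation, each of the \<open>q!\<close> inner terms contributes the
  same amount. This cancels the factorials in the definition of the wedge product.
\<close>

lemma alternation_absorb:
  assumes loc: "\<And>v w. (\<And>i. i < p \<Longrightarrow> v i = w i) \<Longrightarrow> \<alpha> v = \<alpha> w"
  shows "alternation (p + q) (\<lambda>v. \<alpha> v * alternation q \<beta> (\<lambda>i. v (p + i))) v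
       = fact q * alternation (p + q) (\<lambda>v. \<alpha> v * \<beta> (\<lambda>i. v (p + i))) v"
proof -
  let ?P = "{\<sigma>. \<sigma> permutes {..<p + q}}" and ?T = "{\<tau>. \<tau> permutes {..<q}}"
  let ?f = "\<lambda>v. \<alpha> v * \<beta> (\<lambda>i. v (p + i))"
  have "alternation (p + q) (\<lambda>v. \<alpha> v * alternation q \<beta> (\<lambda>i. v (p + i))) v
      = (\<Sum>\<sigma>\<in>?P. \<Sum>\<tau>\<in>?T. of_int (sign \<sigma>) * (\<alpha> (\<lambda>i. v (\<sigma> i)) *
           (of_int (sign \<tau>) * \<beta> (\<lambda>i. v (\<sigma> (p + \<tau> i))))))"
    by (simp add: alternation_def sum_distrib_left)
  also have "\<dots> = (\<Sum>\<tau>\<in>?T. \<Sum>\<sigma>\<in>?P. of_int (sign \<sigma>) * (\<alpha> (\<lambda>i. v (\<sigma> i)) *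
           (of_int (sign \<tau>) * \<beta> (\<lambda>i. v (\<sigma> (p + \<tau> i))))))"
    by (rule sum.swap)
  also have "\<dots> = (\<Sum>\<tau>\<in>?T. alternation (p + q) ?f v)"
  proof (rule sum.cong[OF refl])
    fix \<tau> assume \<tau>: "\<tau> \<in> ?T"
    have s: "shift_perm p \<tau> permutes {..<p + q}" "sign (shift_perm p \<tau>) = sign \<tau>"
      using shift_perm_permutes_sign \<tau> by auto
    have "alternation (p + q) ?f v = (\<Sum>\<sigma>\<in>?P. of_int (sign (\<sigma> \<circ> shift_perm p \<tau>)) * ?f (\<lambda>i. v ((\<sigma> \<circ> shift_perm p \<tau>) i)))"
      unfolding alternation_def by (rule sum_permutations_compose_right[OF s(1)])
    also have "\<dots> = (\<Sum>\<sigma>\<in>?P. of_int (sign \<sigma>) * (\<alpha> (\<lambda>i. v (\<sigma> i)) *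
           (of_int (sign \<tau>) * \<beta> (\<lambda>i. v (\<sigma> (p + \<tau> i))))))"
    proof (rule sum.cong[OF refl])
      fix \<sigma> assume "\<sigma> \<in> ?P"
      then have "sign (\<sigma> \<circ> shift_perm p \<tau>) = sign \<sigma> * sign \<tau>"
        using s by (metis finite_lessThan mem_Collect_eq permutes_imp_permutation sign_compose)
      moreover have "\<alpha> (\<lambda>i. v ((\<sigma> \<circ> shift_perm p \<tau>) i)) = \<alpha> (\<lambda>i. v (\<sigma> i))"
        by (rule loc) (simp add: shift_perm_def)
      moreover have "(\<lambda>i. v ((\<sigma> \<circ> shift_perm p \<tau>) (p + i))) = (\<lambda>i. v (\<sigma> (p + \<tau> i)))"
        by (simp add: shift_perm_def)
      ultimately show "of_int (sign (\<sigma> \<circ> shift_perm p \<tau>)) * ?f (\<lambda>i. v ((\<sigma> \<circ> shift_perm p \<tau>) i))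
          = of_int (sign \<sigma>) * (\<alpha> (\<lambda>i. v (\<sigma> i)) * (of_int (sign \<tau>) * \<beta> (\<lambda>i. v (\<sigma> (p + \<tau> i)))))"
        by (simp add: mult_ac)
    qed
    finally show "(\<Sum>\<sigma>\<in>?P. of_int (sign \<sigma>) * (\<alpha> (\<lambda>i. v (\<sigma> i)) *
           (of_int (sign \<tau>) * \<beta> (\<lambda>i. v (\<sigma> (p + \<tau> i)))))) = alternation (p + q) ?f v" by simp
  qed
  also have "\<dots> = fact q * alternation (p + q) ?f v"
    by (simp add: card_permutations)
  finally show ?thesis .
qed

lemma alternation_cmult: "alternation N (\<lambda>v. c * \<alpha> v) v = c * alternation N \<alpha> v"
  by (simp add: alternation_def sum_distrib_left mult_ac)

lemma wedge_power_eq_alternation: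
  "wedge_power (\<lambda>v. \<omega> (v 0) (v 1)) k v
     = alternation (2 * k) (\<lambda>v. \<Prod>i<k. \<omega> (v (2 * i)) (v (2 * i + 1))) v / 2 ^ k"
proof (induction k arbitrary: v)
  case 0
  show ?case by (simp add: alternation_def)
next
  case (Suc k)
  let ?\<beta> = "\<lambda>v. \<Prod>i<k. \<omega> (v (2 * i)) (v (2 * i + 1))"
  have "wedge_power (\<lambda>v. \<omega> (v 0) (v 1)) (Suc k) v
     = alternation (2 + 2 * k) (\<lambda>v. (1 / 2 ^ k) * (\<omega> (v 0) (v 1) * alternation (2 * k) ?\<beta> (\<lambda>i. v (2 + i)))) v / (fact 2 * fact (2 * k))"
    by (simp only: wedge_power.simps wedge_eq_alternation Suc.IH) simp
  also have "\<dots> = (1 / 2 ^ k) * alternation (2 + 2 * k) (\<lambda>v. \<omega> (v 0) (v 1) * alternation (2 * k) ?\<beta> (\<lambda>i. v (2 + i))) v / (fact 2 * fact (2 * k))"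
    by (simp only: alternation_cmult)
  also have "\<dots> = alternation (2 + 2 * k) (\<lambda>v. \<omega> (v 0) (v 1) * ?\<beta> (\<lambda>i. v (2 + i))) v / 2 ^ Suc k"
    by (subst alternation_absorb) (auto simp: fact_numeral)
  also have "(\<lambda>v. \<omega> (v 0) (v 1) * ?\<beta> (\<lambda>i. v (2 + i))) = (\<lambda>v. \<Prod>i<Suc k. \<omega> (v (2 * i)) (v (2 * i + 1)))"
    by (rule ext, subst prod.lessThan_Suc_shift) simp
  finally show ?case by simp
qed

text \<open>
  Linearity on the whole ambient space of functions, not only on one Lie algebra. All forms that
  occur are of this kind, which spares membership side conditions when they are expanded.
\<close>

definition functional :: "('a elt \<Rightarrow> complex) \<Rightarrow> bool" where
  "functional f \<longleftrightarrow> (\<forall>x y. f (x + y) = f x + f y) \<and> (\<forall>c x. f (cscale c x) = c * f x)"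

lemma functional_add: "functional f \<Longrightarrow> f (x + y) = f x + f y"
  and functional_scale: "functional f \<Longrightarrow> f (cscale c x) = c * f x"
  by (auto simp: functional_def)

lemma cscale_minus_one: "cscale (- 1) x = - x"
  by (simp add: cscale_def fun_eq_iff)

lemma functional_0: "functional f \<Longrightarrow> f 0 = 0"
  using functional_scale[of f 0 0] by simp

lemma functional_minus: "functional f \<Longrightarrow> f (- x) = - f x"
  using functional_scale[of f "- 1" x] by (simp add: cscale_minus_one)

lemma functional_diff: "functional f \<Longrightarrow> f (x - y) = f x - f y"
  using functional_add[of f x "- y"] by (simp add: functional_minus)

lemma functional_sum: "functional f \<Longrightarrow> f (\<Sum>i\<in>I. g i) = (\<Sum>i\<in>I. f (g i))"
  by (induction I rule: infinite_finite_induct) (auto simp: functional_0 functional_add)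

lemma functional_dual: "functional f \<Longrightarrow> f \<in> dual L"
  by (simp add: functional_def dual_def)

lemma elt_span_image:
  assumes "finite I" "inj_on v I" "x \<in> elt.span (v ` I)"
  obtains c where "x = (\<Sum>i\<in>I. cscale (c i) (v i))"
proof -
  obtain u where "x = (\<Sum>y\<in>v ` I. cscale (u y) y)"
    using assms by (auto simp: elt.span_finite)
  also have "\<dots> = (\<Sum>i\<in>I. cscale (u (v i)) (v i))"
    using assms by (simp add: sum.reindex)
  finally show thesis by (rule that)
qed

lemma elt_independent_family:
  assumes I: "finite I"
    and coeff: "\<And>c i. (\<Sum>i\<in>I. cscale (c i) (v i)) = 0 \<Longrightarrow> i \<in> I \<Longrightarrow> c i = 0"
  shows "inj_on v I" "elt.independent (v ` I)"
proof -
  show inj: "inj_on v I"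
  proof (rule inj_onI, rule ccontr)
    fix i j assume ij: "i \<in> I" "j \<in> I" "v i = v j" "i \<noteq> j"
    let ?c = "\<lambda>l. if l = i then 1 else if l = j then - 1 else (0::complex)"
    have "(\<Sum>l\<in>I. cscale (?c l) (v l)) = (\<Sum>l\<in>{i, j}. cscale (?c l) (v l))"
      using ij I by (intro sum.mono_neutral_right) auto
    also have "\<dots> = 0"
      using ij by (simp add: cscale_minus_one)
    finally have "?c i = 0"
      using coeff[of ?c i] ij(1) by blast
    then show False by simp
  qed
  show "elt.independent (v ` I)"
  proof
    assume "elt.dependent (v ` I)"
    then obtain u y where u: "y \<in> v ` I" "u y \<noteq> 0" "(\<Sum>y\<in>v ` I. cscale (u y) y) = 0"
      using I by (auto simp: elt.dependent_finite)
    then have "(\<Sum>i\<in>I. cscale (u (v i)) (v i)) = 0"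
      using inj by (simp add: sum.reindex)
    then show False
      using coeff[of "\<lambda>i. u (v i)"] u by auto
  qed
qed

section \<open>Hyperbolic sequences and the top form\<close>

text \<open>
  The Gram matrix of a hyperbolic sequence \<open>v\<^sub>1, v\<^sub>2, \<dots>\<close>, in which the consecutive vectors
  \<open>v\<^sub>1, v\<^sub>2\<close>, then \<open>v\<^sub>3, v\<^sub>4\<close>, and so on, are paired to \<open>1\<close>. Counting starts at \<open>1\<close> because index \<open>0\<close> is
  reserved for the argument of the one-form.
\<close>

definition hyp_matrix :: "nat \<Rightarrow> nat \<Rightarrow> int" where
  "hyp_matrix a b = (if odd a \<and> b = Suc a then 1 else if odd b \<and> a = Suc b then - 1 else 0)"

text \<open>
  One summand of the Pfaffian of the matrix above, up to the common normalization.
\<close>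

definition matching_term :: "nat \<Rightarrow> (nat \<Rightarrow> nat) \<Rightarrow> int" where
  "matching_term k \<sigma> = sign \<sigma> * (\<Prod>i<k. hyp_matrix (\<sigma> (2 * i + 1)) (\<sigma> (2 * i + 2)))"

lemma hyp_matrix_skew: "hyp_matrix b a = - hyp_matrix a b"
  by (auto simp: hyp_matrix_def)

text \<open>
  Exchanging the two members of a pair changes the sign of the permutation and the sign of one
  factor.
\<close>

lemma matching_term_flip:
  assumes \<sigma>: "permutation \<sigma>" and "j < k"
  shows "matching_term k (\<sigma> \<circ> transpose (2 * j + 1) (2 * j + 2)) = matching_term k \<sigma>"
proof -
  let ?\<tau> = "transpose (2 * j + 1) (2 * j + 2)"
  let ?h = "\<lambda>\<sigma> i. hyp_matrix (\<sigma> (2 * i + 1)) (\<sigma> (2 * i + 2))"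
  have "?h (\<sigma> \<circ> ?\<tau>) i = ?h \<sigma> i" if "i \<noteq> j" for i
  proof -
    have "?\<tau> (2 * i + 1) = 2 * i + 1" "?\<tau> (2 * i + 2) = 2 * i + 2"
      using that by (auto simp: transpose_def; presburger)+
    then show ?thesis by simp
  qed
  moreover have "?h (\<sigma> \<circ> ?\<tau>) j = - ?h \<sigma> j"
    by (simp add: transpose_def) (rule hyp_matrix_skew)
  ultimately have "(\<Prod>i<k. ?h (\<sigma> \<circ> ?\<tau>) i) = - (\<Prod>i<k. ?h \<sigma> i)"
    using \<open>j < k\<close> by (simp add: prod.remove[of _ j])
  moreover have "sign (\<sigma> \<circ> ?\<tau>) = - sign \<sigma>"
    using \<sigma> by (simp add: sign_compose permutation_swap_id sign_swap_id)
  ultimately show ?thesis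
    by (simp add: matching_term_def)
qed

text \<open>
  Exchanging two whole pairs is a product of two transpositions, hence even, and only permutes the
  factors.
\<close>

lemma matching_term_swap:
  assumes \<sigma>: "permutation \<sigma>" and "j < k" "l < k"
  shows "matching_term k (\<sigma> \<circ> (transpose (2 * j + 1) (2 * l + 1) \<circ> transpose (2 * j + 2) (2 * l + 2)))
       = matching_term k \<sigma>"
proof -
  let ?t1 = "transpose (2 * j + 1) (2 * l + 1)" and ?t2 = "transpose (2 * j + 2) (2 * l + 2)"
  let ?h = "\<lambda>\<sigma> i. hyp_matrix (\<sigma> (2 * i + 1)) (\<sigma> (2 * i + 2))"
  have "sign (\<sigma> \<circ> (?t1 \<circ> ?t2)) = sign \<sigma> * (sign ?t1 * sign ?t2)"
    using \<sigma> by (simp only: sign_compose permutation_swap_id permutation_compose)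
  also have "sign ?t1 * sign ?t2 = 1"
    by (simp add: sign_swap_id)
  finally have "sign (\<sigma> \<circ> (?t1 \<circ> ?t2)) = sign \<sigma>" by (simp only: mult_1_right)
  have "(\<Prod>i<k. ?h (\<sigma> \<circ> (?t1 \<circ> ?t2)) i) = (\<Prod>i<k. ?h \<sigma> (transpose j l i))"
  proof (rule prod.cong[OF refl])
    fix i
    have "(?t1 \<circ> ?t2) (2 * i + 1) = 2 * transpose j l i + 1"
      by (auto simp: transpose_def; presburger)
    moreover have "(?t1 \<circ> ?t2) (2 * i + 2) = 2 * transpose j l i + 2"
      by (auto simp: transpose_def; presburger)
    ultimately show "?h (\<sigma> \<circ> (?t1 \<circ> ?t2)) i = ?h \<sigma> (transpose j l i)"
      by (simp only: o_apply)
  qed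
  also have "\<dots> = (\<Prod>i<k. ?h \<sigma> i)"
    using assms by (intro prod.reindex_bij_betw permutes_imp_bij permutes_swap_id) auto
  finally show ?thesis
    using \<open>sign (\<sigma> \<circ> (?t1 \<circ> ?t2)) = sign \<sigma>\<close> by (simp only: matching_term_def)
qed

text \<open>
  No cancellation takes place in the Pfaffian: up to flips and exchanges of pairs, which do not change
  the term, a permutation whose term is nonzero is the identity. The induction moves the largest
  index to the last position.
\<close>

lemma matching_term_01:
  assumes "\<sigma> permutes {1..2 * k}"
  shows "matching_term k \<sigma> \<in> {0, 1}"
  using assms
proof (induction k arbitrary: \<sigma>)
  case 0
  then show ?case
    by (simp add: matching_term_def)
next
  case (Suc k)
  have last: "matching_term (Suc k) \<rho> \<in> {0, 1}"
    if \<rho>: "\<rho> permutes {1..2 * Suc k}" and top: "\<rho> (2 * k + 2) = 2 * k + 2" for \<rho>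
  proof (cases "\<rho> (2 * k + 1) = 2 * k + 1")
    case True
    have "\<rho> permutes {1..2 * k}"
    proof (rule permutes_superset[OF \<rho>])
      show "\<rho> x = x" if "x \<in> {1..2 * Suc k} - {1..2 * k}" for x
      proof -
        have "x = 2 * k + 1 \<or> x = 2 * k + 2"
          using that by auto
        then show ?thesis
          using True top by auto
      qed
    qed
    moreover have "matching_term (Suc k) \<rho> = matching_term k \<rho>"
      using True top by (simp add: matching_term_def hyp_matrix_def)
    ultimately show ?thesis
      using Suc.IH by simp
  next
    case False
    then show ?thesis
      using top by (simp add: matching_term_def hyp_matrix_def)
  qed
  have even: "matching_term (Suc k) \<rho> \<in> {0, 1}"
    if \<rho>: "\<rho> permutes {1..2 * Suc k}" and j: "j < Suc k" "\<rho> (2 * j + 2) = 2 * k + 2" for \<rho> j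
  proof -
    let ?\<tau> = "transpose (2 * j + 1) (2 * k + 1) \<circ> transpose (2 * j + 2) (2 * k + 2)"
    have "(\<rho> \<circ> ?\<tau>) permutes {1..2 * Suc k}"
      using \<rho> j by (intro permutes_compose permutes_swap_id) auto
    moreover have "(\<rho> \<circ> ?\<tau>) (2 * k + 2) = 2 * k + 2"
      using j by (auto simp: transpose_def; presburger)
    ultimately have "matching_term (Suc k) (\<rho> \<circ> ?\<tau>) \<in> {0, 1}"
      by (rule last)
    moreover have "permutation \<rho>"
      using \<rho> by (rule permutes_imp_permutation[rotated]) simp
    ultimately show ?thesis
      using matching_term_swap[of \<rho> j "Suc k" k] j by (simp only: lessI)
  qed
  have "2 * k + 2 \<in> \<sigma> ` {1..2 * Suc k}"
    using permutes_image[OF Suc.prems] by simp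
  then obtain p where p: "p \<in> {1..2 * Suc k}" "\<sigma> p = 2 * k + 2"
    by (metis imageE)
  obtain j where "p = 2 * j + 1 \<or> p = 2 * j + 2" "j < Suc k"
  proof -
    from p(1) have "1 \<le> p" "p \<le> 2 * Suc k" by simp_all
    then have "\<exists>j. (p = 2 * j + 1 \<or> p = 2 * j + 2) \<and> j < Suc k" by presburger
    then show thesis using that by blast
  qed
  then consider "p = 2 * j + 1" | "p = 2 * j + 2" by blast
  then show ?case
  proof cases
    case 1
    let ?\<tau> = "transpose (2 * j + 1) (2 * j + 2)"
    have "(\<sigma> \<circ> ?\<tau>) permutes {1..2 * Suc k}"
      using Suc.prems \<open>j < Suc k\<close> by (intro permutes_compose permutes_swap_id) auto
    moreover have "(\<sigma> \<circ> ?\<tau>) (2 * j + 2) = 2 * k + 2"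
      using 1 p by (simp add: transpose_def)
    ultimately have "matching_term (Suc k) (\<sigma> \<circ> ?\<tau>) \<in> {0, 1}"
      using \<open>j < Suc k\<close> by (intro even)
    moreover have "permutation \<sigma>"
      using Suc.prems by (rule permutes_imp_permutation[rotated]) simp
    ultimately show ?thesis
      using matching_term_flip[of \<sigma> j "Suc k"] \<open>j < Suc k\<close> by (simp only:)
  next
    case 2
    then show ?thesis
      using even[OF Suc.prems \<open>j < Suc k\<close>] p by simp
  qed
qed

text \<open>
  A one-form \<open>\<phi>\<close> and a skew bilinear form \<open>\<omega>\<close>, to be specialized to \<open>\<omega> = d\<phi>\<close>.
\<close>

locale form_pair =
  fixes \<phi> :: "'a form" and \<omega> :: "'a elt \<Rightarrow> 'a elt \<Rightarrow> complex"
  assumes \<phi>: "functional \<phi>"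
    and \<omega>: "functional (\<omega> x)"
    and skew: "\<omega> y x = - \<omega> x y"
begin

lemma functional_cmult: "functional f \<Longrightarrow> functional (\<lambda>x. c * f x)" for f :: "'a form"
  by (simp add: functional_def distrib_left mult_ac)

lemma \<omega>_left: "functional (\<lambda>x. \<omega> x y)"
  using \<omega> unfolding functional_def by (metis skew minus_add_distrib mult_minus_right)

definition volume_term :: "nat \<Rightarrow> 'a multiform" where
  "volume_term k v = \<phi> (v 0) * (\<Prod>i<k. \<omega> (v (2 * i + 1)) (v (2 * i + 2)))"

text \<open>
  The form \<open>\<phi> \<and> \<omega>\<^sup>k\<close> up to the factor \<open>2\<^sup>k\<close>.
\<close>

abbreviation volume :: "nat \<Rightarrow> 'a multiform" where
  "volume k \<equiv> alternation (Suc (2 * k)) (volume_term k)"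

lemma wedge_eq_volume:
  "wedge 1 (2 * k) (one_form \<phi>) (wedge_power (\<lambda>v. \<omega> (v 0) (v 1)) k) v = volume k v / 2 ^ k"
proof -
  let ?\<beta> = "\<lambda>v. \<Prod>i<k. \<omega> (v (2 * i)) (v (2 * i + 1))"
  have "wedge 1 (2 * k) (one_form \<phi>) (wedge_power (\<lambda>v. \<omega> (v 0) (v 1)) k) v
      = alternation (1 + 2 * k) (\<lambda>v. (1 / 2 ^ k) * (\<phi> (v 0) * alternation (2 * k) ?\<beta> (\<lambda>i. v (1 + i)))) v
          / (fact 1 * fact (2 * k))"
    by (simp only: wedge_eq_alternation wedge_power_eq_alternation one_form_def) simp
  also have "\<dots> = (1 / 2 ^ k) * alternation (1 + 2 * k) (\<lambda>v. \<phi> (v 0) * alternation (2 * k) ?\<beta> (\<lambda>i. v (1 + i))) v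
          / (fact 1 * fact (2 * k))"
    by (simp only: alternation_cmult)
  also have "\<dots> = alternation (1 + 2 * k) (\<lambda>v. \<phi> (v 0) * ?\<beta> (\<lambda>i. v (1 + i))) v / 2 ^ k"
    by (subst alternation_absorb) auto
  also have "(\<lambda>v. \<phi> (v 0) * ?\<beta> (\<lambda>i. v (1 + i))) = volume_term k"
    by (simp add: volume_term_def fun_eq_iff)
  finally show ?thesis by simp
qed

lemma volume_term_functional:
  "m < Suc (2 * k) \<Longrightarrow> functional (\<lambda>x. volume_term k (v(m := x)))"
proof (induction k)
  case 0
  then show ?case
    using \<phi> by (simp add: volume_term_def)
next
  case (Suc k)
  have split: "volume_term (Suc k) w = volume_term k w * \<omega> (w (2 * k + 1)) (w (2 * k + 2))" for w
    by (simp add: volume_term_def)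
  consider "m < Suc (2 * k)" | "m = 2 * k + 1" | "m = 2 * k + 2"
    using Suc.prems by (cases "m < Suc (2 * k)"; cases "m = 2 * k + 1") auto
  then show ?case
  proof cases
    case 1
    then have "(\<lambda>x. volume_term (Suc k) (v(m := x)))
        = (\<lambda>x. \<omega> (v (2 * k + 1)) (v (2 * k + 2)) * volume_term k (v(m := x)))"
      by (simp add: split mult.commute)
    then show ?thesis
      using functional_cmult[OF Suc.IH[OF 1]] by (simp only:)
  next
    case 2
    have "volume_term k (v(m := x)) = volume_term k v" for x
      using 2 by (auto simp: volume_term_def intro!: prod.cong)
    then have "(\<lambda>x. volume_term (Suc k) (v(m := x))) = (\<lambda>x. volume_term k v * \<omega> x (v (2 * k + 2)))"
      using 2 by (simp only: split) simp
    then show ?thesis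
      using functional_cmult[OF \<omega>_left] by (simp only:)
  next
    case 3
    have "volume_term k (v(m := x)) = volume_term k v" for x
      using 3 by (auto simp: volume_term_def intro!: prod.cong)
    then have "(\<lambda>x. volume_term (Suc k) (v(m := x))) = (\<lambda>x. volume_term k v * \<omega> (v (2 * k + 1)) x)"
      using 3 by (simp only: split) simp
    then show ?thesis
      using functional_cmult[OF \<omega>] by (simp only:)
  qed
qed

lemma volume_functional:
  assumes "j < Suc (2 * k)"
  shows "functional (\<lambda>x. volume k (v(j := x)))"
proof -
  have "functional (\<lambda>x. volume_term k (\<lambda>i. (v(j := x)) (\<sigma> i)))" if "\<sigma> permutes {..<Suc (2 * k)}" for \<sigma>
  proof -
    have "(\<lambda>i. (v(j := x)) (\<sigma> i)) = (\<lambda>i. v (\<sigma> i))(inv \<sigma> j := x)" for x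
      using that by (auto simp: fun_eq_iff permutes_inv_eq permutes_inverses)
    moreover have "inv \<sigma> j < Suc (2 * k)"
      using permutes_in_image[OF permutes_inv[OF that], of j] assms by simp
    ultimately show ?thesis
      using volume_term_functional by simp
  qed
  then show ?thesis
    by (simp add: alternation_def functional_def sum.distrib distrib_left sum_distrib_left mult_ac)
qed

text \<open>
  An alternating multilinear form vanishes on dependent families: replacing the \<open>j\<close>-th argument by
  a vanishing linear combination leaves only the coefficient at \<open>j\<close>.
\<close>

lemma volume_nonzero_independent:
  assumes "volume k v \<noteq> 0"
  shows "inj_on v {..<Suc (2 * k)}" "elt.independent (v ` {..<Suc (2 * k)})"
proof -
  have 0: "(\<Sum>i\<in>{..<Suc (2 * k)}. cscale (c i) (v i)) = 0 \<Longrightarrow> j \<in> {..<Suc (2 * k)} \<Longrightarrow> c j = 0" for c j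
  proof -
    assume sum: "(\<Sum>i\<in>{..<Suc (2 * k)}. cscale (c i) (v i)) = 0" and j: "j \<in> {..<Suc (2 * k)}"
    let ?f = "\<lambda>x. volume k (v(j := x))"
    have f: "functional ?f"
      using j by (simp add: volume_functional)
    have rep: "?f (v i) = 0" if "i < Suc (2 * k)" "i \<noteq> j" for i
      using j that by (intro alternation_eq_0[of j _ i]) auto
    have "0 = ?f (\<Sum>i\<in>{..<Suc (2 * k)}. cscale (c i) (v i))"
      unfolding sum using functional_0[OF f] by simp
    also have "\<dots> = (\<Sum>i\<in>{..<Suc (2 * k)}. c i * ?f (v i))"
      by (simp only: functional_sum[OF f] functional_scale[OF f])
    also have "\<dots> = (\<Sum>i\<in>{j}. c i * ?f (v i))"
      using j by (intro sum.mono_neutral_right) (auto simp: rep)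
    also have "\<dots> = c j * volume k v" by simp
    finally show "c j = 0" using assms by simp
  qed
  show "inj_on v {..<Suc (2 * k)}" "elt.independent (v ` {..<Suc (2 * k)})"
    by (rule elt_independent_family, rule finite_lessThan, erule (1) 0)+
qed

definition rad :: "'a elt set \<Rightarrow> 'a elt set" where
  "rad L = {x \<in> L. \<forall>y\<in>L. \<omega> x y = 0}"

definition hyperbolic :: "nat \<Rightarrow> (nat \<Rightarrow> 'a elt) \<Rightarrow> bool" where
  "hyperbolic k v \<longleftrightarrow> (\<forall>a\<in>{1..2 * k}. \<forall>b\<in>{1..2 * k}. \<omega> (v a) (v b) = of_int (hyp_matrix a b))"

text \<open>
  Since \<open>v\<^sub>0\<close> lies in the radical, only the permutations that fix \<open>0\<close> contribute, and their terms are
  \<open>\<phi> v\<^sub>0\<close> times numbers \<open>0\<close> or \<open>1\<close>, with the identity contributing \<open>1\<close>.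
\<close>

lemma volume_hyperbolic:
  assumes hyp: "hyperbolic k v" and x0: "\<And>i. \<omega> (v 0) (v i) = 0" "\<phi> (v 0) \<noteq> 0"
  shows "volume k v \<noteq> 0"
proof -
  let ?P = "{\<sigma>. \<sigma> permutes {..<Suc (2 * k)}}" and ?P1 = "{\<sigma>. \<sigma> permutes {1..2 * k}}"
  let ?g = "\<lambda>\<sigma>. of_int (sign \<sigma>) * volume_term k (\<lambda>i. v (\<sigma> i))"
  have "volume k v = sum ?g ?P"
    unfolding alternation_def by (rule refl)
  also have "\<dots> = sum ?g ?P1"
  proof (rule sum.mono_neutral_right)
    show "finite ?P" by (rule finite_permutations) simp
    have "{1..2 * k} \<subseteq> {..<Suc (2 * k)}" by auto
    then show "?P1 \<subseteq> ?P"
      using permutes_subset by blast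
    show "\<forall>\<sigma>\<in>?P - ?P1. ?g \<sigma> = 0"
    proof
      fix \<sigma> assume \<sigma>: "\<sigma> \<in> ?P - ?P1"
      have "\<sigma> 0 \<noteq> 0"
      proof
        assume "\<sigma> 0 = 0"
        have "\<sigma> permutes {1..2 * k}"
        proof (rule permutes_superset)
          show "\<sigma> permutes {..<Suc (2 * k)}" using \<sigma> by blast
          show "\<sigma> x = x" if "x \<in> {..<Suc (2 * k)} - {1..2 * k}" for x
          proof -
            have "x = 0" using that by (cases x) auto
            then show ?thesis using \<open>\<sigma> 0 = 0\<close> by simp
          qed
        qed
        then show False using \<sigma> by blast
      qed
      have "\<sigma> ` {..<Suc (2 * k)} = {..<Suc (2 * k)}"
        using \<sigma> by (intro permutes_image) blast
      then have "0 \<in> \<sigma> ` {..<Suc (2 * k)}"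
        by (simp only: lessThan_iff zero_less_Suc)
      then obtain p where p: "p < Suc (2 * k)" "\<sigma> p = 0"
        by (metis imageE lessThan_iff)
      then have "p \<noteq> 0" using \<open>\<sigma> 0 \<noteq> 0\<close> by metis
      then have "\<exists>i. (p = 2 * i + 1 \<or> p = 2 * i + 2) \<and> i < k"
        using p(1) by presburger
      then obtain i where i: "p = 2 * i + 1 \<or> p = 2 * i + 2" "i < k" by blast
      have "\<omega> (v (\<sigma> (2 * i + 1))) (v (\<sigma> (2 * i + 2))) = 0"
        using i(1)
      proof
        assume "p = 2 * i + 1"
        then have "\<sigma> (2 * i + 1) = 0" using p(2) by simp
        then show ?thesis by (simp only: x0(1))
      next
        assume "p = 2 * i + 2"
        then have "\<sigma> (2 * i + 2) = 0" using p(2) by simp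
        show ?thesis
          unfolding \<open>\<sigma> (2 * i + 2) = 0\<close> by (subst skew) (simp only: x0(1) minus_zero)
      qed
      then have "(\<Prod>i<k. \<omega> (v (\<sigma> (2 * i + 1))) (v (\<sigma> (2 * i + 2)))) = 0"
        using i(2) by (intro prod_zero) auto
      then show "?g \<sigma> = 0" by (simp add: volume_term_def)
    qed
  qed
  also have "\<dots> = (\<Sum>\<sigma>\<in>?P1. \<phi> (v 0) * of_int (matching_term k \<sigma>))"
  proof (rule sum.cong[OF refl])
    fix \<sigma> assume \<sigma>: "\<sigma> \<in> ?P1"
    then have \<sigma>0: "\<sigma> 0 = 0"
      by (auto intro: permutes_not_in)
    have "\<omega> (v (\<sigma> (2 * i + 1))) (v (\<sigma> (2 * i + 2))) = of_int (hyp_matrix (\<sigma> (2 * i + 1)) (\<sigma> (2 * i + 2)))"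
      if "i < k" for i
      using hyp that \<sigma> permutes_in_image[of \<sigma> "{1..2 * k}"] unfolding hyperbolic_def by auto
    then show "?g \<sigma> = \<phi> (v 0) * of_int (matching_term k \<sigma>)"
      by (simp add: volume_term_def \<sigma>0 matching_term_def)
  qed
  also have "\<dots> = \<phi> (v 0) * of_int (\<Sum>\<sigma>\<in>?P1. matching_term k \<sigma>)"
    by (simp add: sum_distrib_left)
  also have "\<dots> \<noteq> 0"
  proof -
    have "matching_term k id = 1"
      by (simp add: matching_term_def hyp_matrix_def)
    moreover have "matching_term k id \<le> (\<Sum>\<sigma>\<in>?P1. matching_term k \<sigma>)"
    proof (rule member_le_sum)
      show "id \<in> ?P1"
        unfolding mem_Collect_eq by (rule permutes_id)
      show "0 \<le> matching_term k \<sigma>" if "\<sigma> \<in> ?P1 - {id}" for \<sigma>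
        using matching_term_01[of \<sigma> k] that by force
    qed (simp add: finite_permutations)
    ultimately have "(\<Sum>\<sigma>\<in>?P1. matching_term k \<sigma>) \<noteq> 0"
      by linarith
    then show ?thesis
      using x0(2) by (simp only: of_int_eq_0_iff mult_eq_0_iff simp_thms)
  qed
  finally show ?thesis .
qed

text \<open>
  Pairing a linear relation with the partner of a vector isolates the coefficient of that vector.
\<close>

lemma hyperbolic_independent:
  assumes hyp: "hyperbolic k v"
  shows "inj_on v {1..2 * k}" "elt.independent (v ` {1..2 * k})"
proof -
  have 0: "c b = 0" if s: "(\<Sum>i\<in>{1..2 * k}. cscale (c i) (v i)) = 0" and b: "b \<in> {1..2 * k}" for c b
  proof -
    have "\<exists>m<k. b = 2 * m + 1 \<or> b = 2 * m + 2"
      using b unfolding atLeastAtMost_iff by presburger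
    then obtain m where m: "m < k" "b = 2 * m + 1 \<or> b = 2 * m + 2" by blast
    \<comment> \<open>The partner of \<open>b\<close>.\<close>
    define b' where "b' = (if b = 2 * m + 1 then 2 * m + 2 else 2 * m + 1)"
    have b': "b' \<in> {1..2 * k}"
      using m by (auto simp: b'_def)
    have nz: "hyp_matrix b b' \<noteq> 0"
      using m(2) by (auto simp: b'_def hyp_matrix_def)
    have z: "hyp_matrix i b' = 0" if "i \<noteq> b" for i
      using m(2) that by (cases "b = 2 * m + 1") (auto simp: b'_def hyp_matrix_def)
    have f: "functional (\<lambda>x. \<omega> x (v b'))"
      by (rule \<omega>_left)
    have "0 = (\<Sum>i\<in>{1..2 * k}. c i * \<omega> (v i) (v b'))"
      using s functional_sum[OF f, of "\<lambda>i. cscale (c i) (v i)" "{1..2 * k}"]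
      by (simp add: functional_0[OF f] functional_scale[OF f])
    also have "\<dots> = (\<Sum>i\<in>{1..2 * k}. c i * of_int (hyp_matrix i b'))"
      using hyp b' by (intro sum.cong) (auto simp: hyperbolic_def)
    also have "\<dots> = (\<Sum>i\<in>{b}. c i * of_int (hyp_matrix i b'))"
      using b by (intro sum.mono_neutral_right) (auto simp: z)
    finally show "c b = 0"
      using nz by simp
  qed
  show "inj_on v {1..2 * k}" "elt.independent (v ` {1..2 * k})"
    by (rule elt_independent_family, rule finite_atLeastAtMost, erule (1) 0)+
qed

end

section \<open>Contact forms and the radical\<close>

lemma elt_card_independent_le:
  assumes "finite C" "L \<subseteq> elt.span C" "elt.independent B" "B \<subseteq> L"
  shows "finite B \<and> card B \<le> elt.dim L"
proof -
  obtain B0 where B0: "B0 \<subseteq> L" "elt.independent B0" "L \<subseteq> elt.span B0" "card B0 = elt.dim L"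
    using elt.basis_exists by blast
  have "finite B0"
    using elt.independent_span_bound[of C B0] assms B0 by blast
  then show ?thesis
    using elt.independent_span_bound[of B0 B] assms B0 by auto
qed

lemma elt_spans_if_card_ge_dim:
  assumes "finite C" "L \<subseteq> elt.span C" "elt.independent B" "B \<subseteq> L" "card B = elt.dim L"
  shows "L \<subseteq> elt.span B"
proof
  fix x assume x: "x \<in> L"
  show "x \<in> elt.span B"
  proof (rule ccontr)
    assume "x \<notin> elt.span B"
    then have "elt.independent (insert x B)" "x \<notin> B"
      using assms(3) by (auto simp: elt.independent_insert elt.span_base)
    moreover have "finite B"
      using elt_card_independent_le assms by blast
    ultimately show False
      using elt_card_independent_le[of C L "insert x B"] assms x by auto
  qed
qed

context form_pair
begin

lemma skew_0: "\<omega> x y = 0 \<Longrightarrow> \<omega> y x = 0"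
  by (subst skew) simp

text \<open>
  The projection to the span of a hyperbolic sequence along its \<open>\<omega>\<close>-orthogonal complement.
\<close>

definition hyp_part :: "nat \<Rightarrow> (nat \<Rightarrow> 'a elt) \<Rightarrow> 'a elt \<Rightarrow> 'a elt" where
  "hyp_part k v x = (\<Sum>i<k. cscale (\<omega> x (v (2 * i + 2))) (v (2 * i + 1)) - cscale (\<omega> x (v (2 * i + 1))) (v (2 * i + 2)))"

lemma hyp_part_in_span: "hyp_part k v x \<in> elt.span (v ` {1..2 * k})"
  unfolding hyp_part_def by (intro elt.span_sum elt.span_diff elt.span_scale elt.span_base) auto

lemma hyp_part_pairing:
  assumes hyp: "hyperbolic k v" and b: "b \<in> {1..2 * k}"
  shows "\<omega> (hyp_part k v x) (v b) = \<omega> x (v b)"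
proof -
  have f: "functional (\<lambda>x. \<omega> x (v b))"
    by (rule \<omega>_left)
  have "\<exists>m<k. b = 2 * m + 1 \<or> b = 2 * m + 2"
    using b unfolding atLeastAtMost_iff by presburger
  then obtain m where m: "m < k" "b = 2 * m + 1 \<or> b = 2 * m + 2" by blast
  let ?t = "\<lambda>i. \<omega> x (v (2 * i + 2)) * of_int (hyp_matrix (2 * i + 1) b)
      - \<omega> x (v (2 * i + 1)) * of_int (hyp_matrix (2 * i + 2) b)"
  have "\<omega> (hyp_part k v x) (v b) = (\<Sum>i<k. ?t i)"
    unfolding hyp_part_def functional_sum[OF f] functional_diff[OF f] functional_scale[OF f]
  proof (rule sum.cong[OF refl])
    fix i assume "i \<in> {..<k}"
    then have "\<omega> (v (2 * i + 1)) (v b) = of_int (hyp_matrix (2 * i + 1) b)"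
      "\<omega> (v (2 * i + 2)) (v b) = of_int (hyp_matrix (2 * i + 2) b)"
      using hyp b unfolding hyperbolic_def by auto
    then show "\<omega> x (v (2 * i + 2)) * \<omega> (v (2 * i + 1)) (v b) - \<omega> x (v (2 * i + 1)) * \<omega> (v (2 * i + 2)) (v b) = ?t i"
      by (simp only:)
  qed
  also have "\<dots> = (\<Sum>i\<in>{m}. ?t i)"
  proof (rule sum.mono_neutral_right)
    show "\<forall>i\<in>{..<k} - {m}. ?t i = 0"
      using m(2) by (auto simp: hyp_matrix_def)
  qed (use m in auto)
  also have "\<dots> = \<omega> x (v b)"
    using m(2) by (auto simp: hyp_matrix_def)
  finally show ?thesis .
qed

lemma hyperbolic_extend:
  assumes hyp: "hyperbolic k v" and perp: "\<And>b. b \<in> {1..2 * k} \<Longrightarrow> \<omega> x (v b) = 0 \<and> \<omega> y (v b) = 0"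
    and xy: "\<omega> x y = 1"
  shows "hyperbolic (Suc k) (v(2 * k + 1 := x, 2 * k + 2 := y))"
  unfolding hyperbolic_def
proof (intro ballI)
  let ?w = "v(2 * k + 1 := x, 2 * k + 2 := y)"
  have self: "\<omega> z z = 0" for z
  proof -
    have "\<omega> z z + \<omega> z z = 0" by (subst (1) skew) simp
    then have "2 * \<omega> z z = 0" by (simp only: mult_2)
    then show ?thesis by simp
  qed
  have perp': "\<omega> (v b) x = 0" "\<omega> (v b) y = 0" if "b \<in> {1..2 * k}" for b
    using perp[OF that] by (simp_all add: skew_0)
  have yx: "\<omega> y x = - 1"
    by (subst skew) (simp add: xy)
  fix a b assume ab: "a \<in> {1..2 * Suc k}" "b \<in> {1..2 * Suc k}"
  consider "a \<in> {1..2 * k}" | "a = 2 * k + 1" | "a = 2 * k + 2" using ab(1) by force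
  note ca = this
  consider "b \<in> {1..2 * k}" | "b = 2 * k + 1" | "b = 2 * k + 2" using ab(2) by force
  note cb = this
  show "\<omega> (?w a) (?w b) = of_int (hyp_matrix a b)"
  proof (cases rule: ca)
    case 1
    show ?thesis
    proof (cases rule: cb)
      case 1
      then show ?thesis
        using hyp \<open>a \<in> {1..2 * k}\<close> by (auto simp: hyperbolic_def)
    next
      case 2
      then show ?thesis
        using \<open>a \<in> {1..2 * k}\<close> perp' by (auto simp: hyp_matrix_def)
    next
      case 3
      then show ?thesis
        using \<open>a \<in> {1..2 * k}\<close> perp' by (auto simp: hyp_matrix_def)
    qed
  next
    case 2
    show ?thesis
      by (cases rule: cb) (use 2 perp xy self in \<open>auto simp: hyp_matrix_def\<close>)
  next
    case 3
    show ?thesis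
      by (cases rule: cb) (use 3 perp yx self in \<open>auto simp: hyp_matrix_def\<close>)
  qed
qed

text \<open>
  Take a hyperbolic sequence of maximal length. On its orthogonal complement \<open>\<omega>\<close> vanishes, since
  two vectors that pair nontrivially would prolong the sequence; so the complement is the radical.
\<close>

lemma hyperbolic_decomposition:
  assumes L: "elt.subspace L" and fin: "finite C" "L \<subseteq> elt.span C"
  obtains k v where "hyperbolic k v" "\<And>i. v i \<in> L" "\<And>x. x \<in> L \<Longrightarrow> x - hyp_part k v x \<in> rad L"
proof -
  let ?H = "\<lambda>k. \<exists>v. hyperbolic k v \<and> (\<forall>i. v i \<in> L)"
  have "?H 0"
    using elt.subspace_0[OF L] by (auto simp: hyperbolic_def)
  moreover have "k \<le> elt.dim L" if H: "?H k" for k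
  proof -
    obtain v where v: "hyperbolic k v" "\<forall>i. v i \<in> L" using H by blast
    have "card (v ` {1..2 * k}) = 2 * k"
      using hyperbolic_independent(1)[OF v(1)] by (simp add: card_image)
    moreover have "v ` {1..2 * k} \<subseteq> L"
      using v(2) by blast
    ultimately show ?thesis
      using elt_card_independent_le[OF fin hyperbolic_independent(2)[OF v(1)]] by linarith
  qed
  ultimately obtain k where k: "?H k" "\<And>k'. ?H k' \<Longrightarrow> k' \<le> k"
    using Nat.ex_has_greatest_nat[of ?H 0 "elt.dim L"] by blast
  then obtain v where v: "hyperbolic k v" and v_all: "\<forall>i. v i \<in> L" by blast
  then have v_L: "v i \<in> L" for i by simp
  have in_L: "x - hyp_part k v x \<in> L" if "x \<in> L" for x
  proof -
    have "hyp_part k v x \<in> L"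
      unfolding hyp_part_def using v_L L by (intro elt.subspace_sum elt.subspace_diff elt.subspace_scale)
    then show ?thesis using that L by (intro elt.subspace_diff)
  qed
  have perp: "\<omega> (x - hyp_part k v x) (v b) = 0" if "b \<in> {1..2 * k}" for x b
    using hyp_part_pairing[OF v that] functional_diff[OF \<omega>_left] by simp
  have isotropic: "\<omega> (x - hyp_part k v x) (y - hyp_part k v y) = 0" if "x \<in> L" "y \<in> L" for x y
  proof (rule ccontr)
    let ?x = "x - hyp_part k v x" and ?y = "y - hyp_part k v y"
    assume nz: "\<omega> ?x ?y \<noteq> 0"
    \<comment> \<open>Rescaling makes the new pair hyperbolic.\<close>
    let ?y' = "cscale (1 / \<omega> ?x ?y) ?y"
    let ?w = "v(2 * k + 1 := ?x, 2 * k + 2 := ?y')"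
    have "hyperbolic (Suc k) ?w"
      using v nz by (intro hyperbolic_extend) (simp_all add: perp functional_scale[OF \<omega>] functional_scale[OF \<omega>_left])
    moreover have "?w i \<in> L" for i
      using v_L in_L that L by (auto intro: elt.subspace_scale)
    ultimately have "?H (Suc k)" by blast
    then show False using k(2) by fastforce
  qed
  have "x - hyp_part k v x \<in> rad L" if x: "x \<in> L" for x
    unfolding rad_def
  proof (intro CollectI conjI ballI in_L[OF x])
    fix y assume y: "y \<in> L"
    let ?x = "x - hyp_part k v x"
    have "\<omega> ?x (hyp_part k v y) = 0"
      unfolding hyp_part_def[of k v y] functional_sum[OF \<omega>] functional_diff[OF \<omega>] functional_scale[OF \<omega>]
      by (intro sum.neutral) (auto simp: perp)
    then show "\<omega> ?x y = 0"
      using isotropic[OF x y] functional_diff[OF \<omega>, of ?x y "hyp_part k v y"] by simp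
  qed
  with v v_L show thesis by (rule that)
qed

text \<open>
  Expand \<open>x\<close> in the basis on which the top form is nonzero. Inserting \<open>x\<close> at position \<open>j\<close> multiplies the
  value by the \<open>j\<close>-th coefficient of \<open>x\<close>, but it also gives \<open>0\<close>, because neither \<open>\<phi>\<close> nor \<open>\<omega>\<close> sees \<open>x\<close>.
\<close>

lemma volume_nonzero_rad:
  assumes fin: "finite C" "L \<subseteq> elt.span C" and dim: "elt.dim L = Suc (2 * k)"
    and v: "\<And>i. v i \<in> L" "volume k v \<noteq> 0"
    and x: "x \<in> rad L" "\<phi> x = 0"
  shows "x = 0"
proof -
  let ?I = "{..<Suc (2 * k)}"
  note ind = volume_nonzero_independent[OF v(2)]
  have "L \<subseteq> elt.span (v ` ?I)"
    using fin ind v(1) dim by (intro elt_spans_if_card_ge_dim[OF fin]) (auto simp: card_image)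
  then have "x \<in> elt.span (v ` ?I)"
    using x(1) unfolding rad_def by blast
  then obtain c where c: "x = (\<Sum>i\<in>?I. cscale (c i) (v i))"
    by (rule elt_span_image[OF finite_lessThan ind(1)])
  have "c j = 0" if j: "j \<in> ?I" for j
  proof -
    let ?f = "\<lambda>x. volume k (v(j := x))"
    have f: "functional ?f"
      using j by (simp add: volume_functional)
    have rep: "?f (v i) = 0" if "i < Suc (2 * k)" "i \<noteq> j" for i
      using j that by (intro alternation_eq_0[of j _ i]) auto
    have "?f x = (\<Sum>i\<in>?I. c i * ?f (v i))"
      by (subst c) (simp only: functional_sum[OF f] functional_scale[OF f])
    also have "\<dots> = (\<Sum>i\<in>{j}. c i * ?f (v i))"
      using j by (intro sum.mono_neutral_right) (auto simp: rep)
    also have "\<dots> = c j * volume k v" by simp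
    finally have "?f x = c j * volume k v" .
    moreover have "?f x = 0"
    proof -
      have xr: "\<omega> x y = 0" "\<omega> y x = 0" if "y \<in> L" for y
        using x(1) that by (simp_all add: rad_def skew_0)
      have xx: "x \<in> L" using x(1) by (simp add: rad_def)
      have "volume_term k (\<lambda>i. (v(j := x)) (\<sigma> i)) = 0" if \<sigma>: "\<sigma> permutes ?I" for \<sigma>
      proof -
        have "\<sigma> ` ?I = ?I"
          using \<sigma> by (rule permutes_image)
        then obtain p where p: "p < Suc (2 * k)" "\<sigma> p = j"
          using j by (metis imageE lessThan_iff)
        show ?thesis
        proof (cases "p = 0")
          case True
          then show ?thesis using p x(2) by (simp add: volume_term_def)
        next
          case False
          then have "\<exists>i. (p = 2 * i + 1 \<or> p = 2 * i + 2) \<and> i < k"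
            using p(1) by presburger
          then obtain i where i: "p = 2 * i + 1 \<or> p = 2 * i + 2" "i < k" by blast
          have "\<omega> ((v(j := x)) (\<sigma> (2 * i + 1))) ((v(j := x)) (\<sigma> (2 * i + 2))) = 0"
            using i(1) p(2) xr v(1) xx by auto
          then have "(\<Prod>i<k. \<omega> ((v(j := x)) (\<sigma> (2 * i + 1))) ((v(j := x)) (\<sigma> (2 * i + 2)))) = 0"
            using i(2) by (intro prod_zero[OF finite_lessThan bexI[of _ i]]) (simp only: lessThan_iff)+
          then show ?thesis
            unfolding volume_term_def by simp
        qed
      qed
      then show ?thesis
        unfolding alternation_def by (intro sum.neutral) simp
    qed
    ultimately show ?thesis using v(2) by simp
  qed
  then have "cscale (c j) (v j) = 0" if "j \<in> ?I" for j
    using that by simp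
  then show ?thesis
    unfolding c by (rule sum.neutral[OF ballI])
qed

text \<open>
  The radical is a complement of the span of a hyperbolic sequence, so its dimension has the parity
  of \<open>dim L\<close>. If the top form is nonzero then \<open>\<phi>\<close> is injective on the radical, and odd dimension
  makes the radical nonzero. Conversely the hyperbolic sequence together with a vector of the
  radical on which \<open>\<phi>\<close> does not vanish is a basis on which the top form is nonzero.
\<close>

theorem volume_nonzero_iff:
  assumes L: "elt.subspace L" and fin: "finite C" "L \<subseteq> elt.span C"
  shows "(\<exists>k. elt.dim L = 2 * k + 1 \<and> (\<exists>v. (\<forall>i. v i \<in> L) \<and> volume k v \<noteq> 0)) \<longleftrightarrow>
    (\<exists>x\<in>rad L. \<phi> x \<noteq> 0) \<and> (\<forall>x\<in>rad L. \<phi> x = 0 \<longrightarrow> x = 0)" (is "?l \<longleftrightarrow> ?r")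
proof
  assume ?l
  then obtain k v where kv: "elt.dim L = 2 * k + 1" "\<And>i. v i \<in> L" "volume k v \<noteq> 0" by blast
  have inj: "\<forall>x\<in>rad L. \<phi> x = 0 \<longrightarrow> x = 0"
    using volume_nonzero_rad[OF fin _ kv(2,3)] kv(1) by simp
  moreover have "\<exists>x\<in>rad L. \<phi> x \<noteq> 0"
  proof (rule ccontr)
    assume "\<not> (\<exists>x\<in>rad L. \<phi> x \<noteq> 0)"
    then have rad0: "x = 0" if "x \<in> rad L" for x
      using inj that by blast
    obtain l w where w: "hyperbolic l w" "\<And>i. w i \<in> L" "\<And>x. x \<in> L \<Longrightarrow> x - hyp_part l w x \<in> rad L"
      using hyperbolic_decomposition[OF L fin] by blast
    have "x \<in> elt.span (w ` {1..2 * l})" if "x \<in> L" for x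
      using rad0[OF w(3)[OF that]] hyp_part_in_span[of l w x] by simp
    then have "card (w ` {1..2 * l}) = elt.dim L"
      using w(2) hyperbolic_independent(2)[OF w(1)] by (intro elt.basis_card_eq_dim) auto
    moreover have "card (w ` {1..2 * l}) = 2 * l"
      using hyperbolic_independent(1)[OF w(1)] by (simp add: card_image)
    ultimately show False
      using kv(1) by presburger
  qed
  ultimately show ?r by blast
next
  assume ?r
  then obtain x0 where x0: "x0 \<in> rad L" "\<phi> x0 \<noteq> 0" and inj: "\<And>x. x \<in> rad L \<Longrightarrow> \<phi> x = 0 \<Longrightarrow> x = 0"
    by blast
  obtain k w where w: "hyperbolic k w" "\<And>i. w i \<in> L" "\<And>x. x \<in> L \<Longrightarrow> x - hyp_part k w x \<in> rad L"
    using hyperbolic_decomposition[OF L fin] by blast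
  \<comment> \<open>Hyperbolicity only concerns the indices from \<open>1\<close> on, so slot \<open>0\<close> is free for \<open>x0\<close>.\<close>
  define v where "v = w(0 := x0)"
  have v_L: "v i \<in> L" for i
    using w(2) x0(1) by (simp add: v_def rad_def)
  have "hyperbolic k v"
    using w(1) by (simp add: hyperbolic_def v_def)
  moreover have "\<omega> (v 0) (v i) = 0" for i
    using x0(1) v_L[of i] by (simp add: rad_def v_def)
  ultimately have vol: "volume k v \<noteq> 0"
    using x0(2) by (intro volume_hyperbolic) (auto simp: v_def)
  let ?B = "v ` {..<Suc (2 * k)}"
  have "L \<subseteq> elt.span ?B"
  proof
    fix x assume x: "x \<in> L"
    define r where "r = x - hyp_part k w x"
    let ?c = "\<phi> r / \<phi> x0"
    have r: "r \<in> rad L"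
      using w(3)[OF x] by (simp add: r_def)
    have "r - cscale ?c x0 \<in> rad L"
      using r x0(1) L unfolding rad_def
      by (auto simp: functional_diff[OF \<omega>_left] functional_scale[OF \<omega>_left] intro!: elt.subspace_diff elt.subspace_scale)
    moreover have "\<phi> (r - cscale ?c x0) = 0"
      using x0(2) by (simp add: functional_diff[OF \<phi>] functional_scale[OF \<phi>])
    ultimately have "r - cscale ?c x0 = 0"
      by (rule inj)
    then have "x = cscale ?c (v 0) + hyp_part k w x"
      by (simp add: r_def v_def algebra_simps)
    moreover have "cscale ?c (v 0) \<in> elt.span ?B"
      by (intro elt.span_scale elt.span_base) simp
    moreover have "w ` {1..2 * k} \<subseteq> ?B"
      by (auto simp: v_def intro!: image_eqI)
    then have "hyp_part k w x \<in> elt.span ?B"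
      using hyp_part_in_span[of k w x] elt.span_mono by blast
    ultimately show "x \<in> elt.span ?B"
      by (metis elt.span_add)
  qed
  then have "card ?B = elt.dim L"
    using v_L volume_nonzero_independent(2)[OF vol] by (intro elt.basis_card_eq_dim) auto
  then have "elt.dim L = 2 * k + 1"
    using volume_nonzero_independent(1)[OF vol] by (simp add: card_image)
  then show ?l
    using v_L vol by blast
qed

end

text \<open>
  Contactness in terms of the kernel of \<open>d\<phi>\<close>: \<open>\<phi>\<close> maps the kernel isomorphically onto \<open>\<complex>\<close>. This is
  the only form in which contactness is used below.
\<close>

theorem contact_form_iff:
  assumes "functional \<phi>" "\<And>x. functional (\<lambda>y. \<phi> (br x y))" "\<And>x y. br y x = - br x y"
    and "elt.subspace L" "finite C" "L \<subseteq> elt.span C"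
  shows "contact_form L br \<phi> \<longleftrightarrow>
    (\<exists>x\<in>form_ker L br \<phi>. \<phi> x \<noteq> 0) \<and> (\<forall>x\<in>form_ker L br \<phi>. \<phi> x = 0 \<longrightarrow> x = 0)"
proof -
  interpret form_pair \<phi> "\<lambda>x y. - \<phi> (br x y)"
  proof
    show "functional \<phi>" by fact
    show "functional (\<lambda>y. - \<phi> (br x y))" for x
      using assms(2)[of x] by (simp add: functional_def)
    show "- \<phi> (br y x) = - (- \<phi> (br x y))" for x y
      using assms(3)[of x y] by (simp add: functional_minus[OF assms(1)])
  qed
  have "form_ker L br \<phi> = rad L"
    by (simp add: form_ker_def rad_def)
  then show ?thesis
    using volume_nonzero_iff[OF assms(4-6)] functional_dual[OF assms(1), of L]
    unfolding contact_form_def d_form_def by (simp add: wedge_eq_volume del: One_nat_def)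
qed

section \<open>Kernels of one-forms on Lie poset algebras\<close>

lemma phi_of_apply: "phi_of S B = (\<Sum>(a, b)\<in>S. B a b)"
  unfolding phi_of_def by (induction S rule: infinite_finite_induct) (auto simp: Estar_def)

lemma functional_Estar: "functional (Estar p q)"
  by (simp add: functional_def Estar_def cscale_def)

lemma functional_phi_of: "functional (phi_of S)"
  by (simp add: functional_def phi_of_apply cscale_def case_prod_beta sum.distrib sum_distrib_left)

lemma functional_plus: "functional f \<Longrightarrow> functional g \<Longrightarrow> functional (f + g)"
  by (simp add: functional_def algebra_simps)

definition unit_elt :: "'a \<Rightarrow> 'a \<Rightarrow> 'a elt" where
  "unit_elt p q = (\<lambda>a b. if a = p \<and> b = q then 1 else 0)"

definition id_elt :: "'a rel \<Rightarrow> 'a elt" where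
  "id_elt r = (\<lambda>a b. if a = b \<and> a \<in> Field r then 1 else 0)"

definition trace :: "'a rel \<Rightarrow> 'a elt \<Rightarrow> complex" where
  "trace r B = (\<Sum>p\<in>Field r. B p p)"

text \<open>
  The value \<open>\<phi>\<^sub>S([B, E\<^bsub>p,q\<^esub>])\<close>. It does not refer to the poset, so the values for a
  poset and for a subposet can be compared directly.
\<close>

definition bracket_coeff :: "'a rel \<Rightarrow> 'a elt \<Rightarrow> 'a \<Rightarrow> 'a \<Rightarrow> complex" where
  "bracket_coeff S B p q = (\<Sum>(a, b)\<in>S. (if b = q then B a p else 0) - (if a = p then B q b else 0))"

text \<open>
  The kernel of \<open>d\<phi>\<^sub>S\<close> on \<open>\<gg>(r)\<close>, described by finitely many linear equations.
\<close>

definition kern :: "'a rel \<Rightarrow> 'a rel \<Rightarrow> 'a elt set" where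
  "kern r S = {B \<in> lie_g r. \<forall>(p, q)\<in>r. bracket_coeff S B p q = 0}"

lemma kernD: "B \<in> kern r S \<Longrightarrow> (p, q) \<in> r \<Longrightarrow> bracket_coeff S B p q = 0"
  by (auto simp: kern_def)

lemma lie_gD: "B \<in> lie_g r \<Longrightarrow> (p, q) \<notin> r \<Longrightarrow> B p q = 0"
  by (simp add: lie_g_def)

text \<open>
  Expansion of the second argument in the basis \<open>E\<^bsub>p,q\<^esub>\<close>.
\<close>

lemma phi_of_bracket:
  assumes F: "finite (Field r)" and S: "S \<subseteq> Field r \<times> Field r"
  shows "phi_of S (bracket r B y) = (\<Sum>p\<in>Field r. \<Sum>q\<in>Field r. y p q * bracket_coeff S B p q)"
proof -
  let ?F = "Field r"
  let ?t = "\<lambda>ab p q. y p q * ((if snd ab = q then B (fst ab) p else 0) - (if fst ab = p then B q (snd ab) else 0))"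
  have "(\<Sum>p\<in>?F. \<Sum>q\<in>?F. y p q * bracket_coeff S B p q) = (\<Sum>p\<in>?F. \<Sum>q\<in>?F. \<Sum>ab\<in>S. ?t ab p q)"
    by (simp only: bracket_coeff_def sum_distrib_left case_prod_beta)
  also have "\<dots> = (\<Sum>p\<in>?F. \<Sum>ab\<in>S. \<Sum>q\<in>?F. ?t ab p q)"
    by (intro sum.cong refl sum.swap)
  also have "\<dots> = (\<Sum>ab\<in>S. \<Sum>p\<in>?F. \<Sum>q\<in>?F. ?t ab p q)"
    by (rule sum.swap)
  also have "\<dots> = (\<Sum>ab\<in>S. bracket r B y (fst ab) (snd ab))"
  proof (rule sum.cong[OF refl])
    fix ab assume "ab \<in> S"
    then have ab: "fst ab \<in> ?F" "snd ab \<in> ?F" using S by auto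
    have "(\<Sum>p\<in>?F. \<Sum>q\<in>?F. ?t ab p q)
        = (\<Sum>p\<in>?F. \<Sum>q\<in>?F. if snd ab = q then y p q * B (fst ab) p else 0)
        - (\<Sum>p\<in>?F. \<Sum>q\<in>?F. if fst ab = p then y p q * B q (snd ab) else 0)"
      by (simp only: sum_subtractf[symmetric]) (intro sum.cong refl, simp add: algebra_simps)
    also have "(\<Sum>p\<in>?F. \<Sum>q\<in>?F. if snd ab = q then y p q * B (fst ab) p else 0) = (\<Sum>p\<in>?F. y p (snd ab) * B (fst ab) p)"
      using F ab by (simp add: sum.delta')
    also have "(\<Sum>p\<in>?F. \<Sum>q\<in>?F. if fst ab = p then y p q * B q (snd ab) else 0)
        = (\<Sum>q\<in>?F. \<Sum>p\<in>?F. if fst ab = p then y p q * B q (snd ab) else 0)"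
      by (rule sum.swap)
    also have "\<dots> = (\<Sum>q\<in>?F. y (fst ab) q * B q (snd ab))"
      using F ab by (simp add: sum.delta')
    finally show "(\<Sum>p\<in>?F. \<Sum>q\<in>?F. ?t ab p q) = bracket r B y (fst ab) (snd ab)"
      by (simp add: bracket_def elt_prod_def mult.commute)
  qed
  finally show ?thesis
    by (simp add: phi_of_apply case_prod_beta)
qed

lemma form_ker_lie_g:
  assumes F: "finite (Field r)" and S: "S \<subseteq> Field r \<times> Field r"
  shows "form_ker (lie_g r) (bracket r) (phi_of S) = kern r S"
proof (intro set_eqI iffI)
  fix B assume B: "B \<in> form_ker (lie_g r) (bracket r) (phi_of S)"
  have "bracket_coeff S B p q = 0" if pq: "(p, q) \<in> r" for p q
  proof -
    have in_F: "p \<in> Field r" "q \<in> Field r" using pq by (auto simp: Field_def)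
    have "unit_elt p q \<in> lie_g r"
      using pq by (auto simp: lie_g_def unit_elt_def)
    then have "0 = phi_of S (bracket r B (unit_elt p q))"
      using B by (simp add: form_ker_def)
    also have "\<dots> = (\<Sum>a\<in>Field r. \<Sum>b\<in>Field r. unit_elt p q a b * bracket_coeff S B a b)"
      by (rule phi_of_bracket[OF F S])
    also have "\<dots> = (\<Sum>a\<in>Field r. if a = p then bracket_coeff S B p q else 0)"
    proof (rule sum.cong[OF refl])
      fix a
      have "(\<Sum>b\<in>Field r. unit_elt p q a b * bracket_coeff S B a b)
          = (\<Sum>b\<in>Field r. if b = q then (if a = p then bracket_coeff S B p q else 0) else 0)"
        by (rule sum.cong) (auto simp: unit_elt_def)
      then show "(\<Sum>b\<in>Field r. unit_elt p q a b * bracket_coeff S B a b) = (if a = p then bracket_coeff S B p q else 0)"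
        using F in_F by (simp add: sum.delta)
    qed
    also have "\<dots> = bracket_coeff S B p q"
      using F in_F by (simp add: sum.delta)
    finally show ?thesis by simp
  qed
  then show "B \<in> kern r S"
    using B by (auto simp: kern_def form_ker_def)
next
  fix B assume B: "B \<in> kern r S"
  have "phi_of S (bracket r B y) = 0" if "y \<in> lie_g r" for y
  proof -
    have "y p q * bracket_coeff S B p q = 0" for p q
      using that B by (cases "(p, q) \<in> r") (auto simp: kernD lie_gD)
    then show ?thesis
      by (simp only: phi_of_bracket[OF F S] sum.neutral_const)
  qed
  then show "B \<in> form_ker (lie_g r) (bracket r) (phi_of S)"
    using B by (auto simp: kern_def form_ker_def)
qed

lemma functional_bracket_coeff: "functional (\<lambda>B. bracket_coeff S B p q)"
proof -
  have "functional (\<lambda>B. \<Sum>ab\<in>S. (if snd ab = q then B (fst ab) p else 0) - (if fst ab = p then B q (snd ab) else 0))"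
    unfolding functional_def cscale_def
    by (auto simp: sum.distrib[symmetric] sum_distrib_left algebra_simps intro!: sum.cong)
  then show ?thesis
    by (simp add: bracket_coeff_def case_prod_beta)
qed

lemma functional_trace: "functional (trace r)"
  by (simp add: functional_def trace_def cscale_def sum.distrib sum_distrib_left)

lemma subspace_lie_g: "elt.subspace (lie_g r)"
  by (auto simp: elt.subspace_def lie_g_def cscale_def)

lemma subspace_kern: "elt.subspace (kern r S)"
  using subspace_lie_g[of r]
  by (fastforce simp: elt.subspace_def kern_def functional_add[OF functional_bracket_coeff]
      functional_scale[OF functional_bracket_coeff] functional_0[OF functional_bracket_coeff])

lemma lie_gA_eq: "lie_gA r = {B \<in> lie_g r. trace r B = 0}"
  by (simp add: lie_gA_def trace_def)

lemma subspace_lie_gA: "elt.subspace (lie_gA r)"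
  using subspace_lie_g[of r]
  by (auto simp: elt.subspace_def lie_gA_eq functional_add[OF functional_trace]
      functional_scale[OF functional_trace] functional_0[OF functional_trace])

lemma finite_rel_if_finite_Field: "finite (Field r) \<Longrightarrow> finite r"
  by (rule finite_subset[of _ "Field r \<times> Field r"]) (auto simp: Field_def)

lemma lie_g_subset_span:
  assumes "finite r"
  shows "lie_g r \<subseteq> elt.span ((\<lambda>(p, q). unit_elt p q) ` r)"
proof
  fix B assume B: "B \<in> lie_g r"
  have sum_apply: "(\<Sum>i\<in>r. f i) a b = (\<Sum>i\<in>r. f i a b)" for f :: "'a \<times> 'a \<Rightarrow> 'a elt" and a b
    by (induction r rule: infinite_finite_induct) auto
  have "B = (\<Sum>pq\<in>r. cscale (B (fst pq) (snd pq)) (unit_elt (fst pq) (snd pq)))"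
  proof (intro ext)
    fix a b
    have "(\<Sum>pq\<in>r. cscale (B (fst pq) (snd pq)) (unit_elt (fst pq) (snd pq))) a b
        = (\<Sum>pq\<in>r. if pq = (a, b) then B a b else 0)"
      unfolding sum_apply by (rule sum.cong) (auto simp: cscale_def unit_elt_def)
    then show "B a b = (\<Sum>pq\<in>r. cscale (B (fst pq) (snd pq)) (unit_elt (fst pq) (snd pq))) a b"
      using assms B by (simp add: sum.delta lie_gD)
  qed
  also have "\<dots> \<in> elt.span ((\<lambda>(p, q). unit_elt p q) ` r)"
    by (intro elt.span_sum elt.span_scale elt.span_base) auto
  finally show "B \<in> elt.span ((\<lambda>(p, q). unit_elt p q) ` r)" .
qed

lemma elt_prod_add_right: "elt_prod r B (x + y) = elt_prod r B x + elt_prod r B y"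
  by (simp add: elt_prod_def fun_eq_iff distrib_left sum.distrib)

lemma elt_prod_add_left: "elt_prod r (x + y) B = elt_prod r x B + elt_prod r y B"
  by (simp add: elt_prod_def fun_eq_iff distrib_right sum.distrib)

lemma elt_prod_scale: "elt_prod r B (cscale c x) = cscale c (elt_prod r B x)"
    "elt_prod r (cscale c x) B = cscale c (elt_prod r x B)"
  by (simp_all add: elt_prod_def fun_eq_iff cscale_def sum_distrib_left mult_ac)

lemma elt_prod_assoc: "elt_prod r (elt_prod r A B) C = elt_prod r A (elt_prod r B C)"
proof (intro ext)
  fix p s
  have "elt_prod r (elt_prod r A B) C p s = (\<Sum>q\<in>Field r. \<Sum>t\<in>Field r. A p t * B t q * C q s)"
    by (simp add: elt_prod_def sum_distrib_right)
  also have "\<dots> = (\<Sum>t\<in>Field r. \<Sum>q\<in>Field r. A p t * B t q * C q s)"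
    by (rule sum.swap)
  finally show "elt_prod r (elt_prod r A B) C p s = elt_prod r A (elt_prod r B C) p s"
    by (simp add: elt_prod_def sum_distrib_left mult.assoc)
qed

lemma functional_bracket: "functional \<phi> \<Longrightarrow> functional (\<lambda>y. \<phi> (bracket r x y))"
proof -
  assume \<phi>: "functional \<phi>"
  have "bracket r x (y + z) = bracket r x y + bracket r x z" for y z
    by (simp add: bracket_def elt_prod_add_right elt_prod_add_left)
  moreover have "bracket r x (cscale c y) = cscale c (bracket r x y)" for c y
    by (simp add: bracket_def elt_prod_scale elt.scale_right_diff_distrib)
  ultimately show ?thesis
    using \<phi> by (simp add: functional_def)
qed

lemma elt_prod_lie_g:
  assumes "trans r" "B \<in> lie_g r" "C \<in> lie_g r"
  shows "elt_prod r B C \<in> lie_g r"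
  unfolding lie_g_def
proof (intro CollectI allI impI)
  fix p s assume "(p, s) \<notin> r"
  then have "B p q * C q s = 0" for q
    using assms lie_gD[of B r p q] lie_gD[of C r q s] by (metis mult_eq_0_iff transE)
  then show "elt_prod r B C p s = 0"
    by (simp only: elt_prod_def sum.neutral_const)
qed

text \<open>
  The kernel of \<open>d\<phi>\<close> is an associative subalgebra, for any form \<open>\<phi>\<close> on an associative algebra,
  because \<open>[BC, y] = [B, Cy] + [C, yB]\<close>.
\<close>

lemma kern_prod:
  assumes r: "trans r" and F: "finite (Field r)" and S: "S \<subseteq> Field r \<times> Field r"
    and B: "B \<in> kern r S" and C: "C \<in> kern r S"
  shows "elt_prod r B C \<in> kern r S"
proof -
  have ker: "phi_of S (bracket r B y) = 0" "phi_of S (bracket r C y) = 0" if "y \<in> lie_g r" for y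
    using B C that by (auto simp: form_ker_lie_g[OF F S, symmetric] form_ker_def)
  have BC: "B \<in> lie_g r" "C \<in> lie_g r"
    using B C by (auto simp: kern_def)
  have "phi_of S (bracket r (elt_prod r B C) y) = 0" if y: "y \<in> lie_g r" for y
  proof -
    have "bracket r (elt_prod r B C) y = bracket r B (elt_prod r C y) + bracket r C (elt_prod r y B)"
      by (simp add: bracket_def elt_prod_assoc)
    then show ?thesis
      using BC y by (simp add: functional_add[OF functional_phi_of] ker elt_prod_lie_g[OF r])
  qed
  then show ?thesis
    using elt_prod_lie_g[OF r BC] by (simp add: form_ker_lie_g[OF F S, symmetric] form_ker_def)
qed

lemma elt_prod_id:
  assumes "finite (Field r)" "B \<in> lie_g r"
  shows "elt_prod r B (id_elt r) = B" "elt_prod r (id_elt r) B = B"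
proof -
  have 0: "B p q = 0" if "p \<notin> Field r \<or> q \<notin> Field r" for p q
    using that assms(2) by (intro lie_gD[of B r]) (auto simp: Field_def)
  show "elt_prod r B (id_elt r) = B"
  proof (intro ext)
    fix p s
    have "elt_prod r B (id_elt r) p s = (\<Sum>q\<in>Field r. if q = s then B p s else 0)"
      unfolding elt_prod_def by (rule sum.cong) (auto simp: id_elt_def)
    then show "elt_prod r B (id_elt r) p s = B p s"
      using assms(1) 0 by (auto simp: sum.delta)
  qed
  show "elt_prod r (id_elt r) B = B"
  proof (intro ext)
    fix p s
    have "elt_prod r (id_elt r) B p s = (\<Sum>q\<in>Field r. if q = p then B p s else 0)"
      unfolding elt_prod_def by (rule sum.cong) (auto simp: id_elt_def)
    then show "elt_prod r (id_elt r) B p s = B p s"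
      using assms(1) 0 by (auto simp: sum.delta)
  qed
qed

lemma id_elt_lie_g: "Refl r \<Longrightarrow> id_elt r \<in> lie_g r"
  by (auto simp: lie_g_def id_elt_def refl_on_def)

lemma bracket_id:
  assumes "finite (Field r)" "B \<in> lie_g r"
  shows "bracket r (id_elt r) B = 0" "bracket r B (id_elt r) = 0"
  using elt_prod_id[OF assms] by (simp_all add: bracket_def)

lemma id_elt_kern:
  assumes "Refl r" "finite (Field r)" "S \<subseteq> Field r \<times> Field r"
  shows "id_elt r \<in> kern r S"
  using assms
  by (auto simp: bracket_id form_ker_lie_g[symmetric] form_ker_def id_elt_lie_g functional_0[OF functional_phi_of])

lemma trace_id_elt: "finite (Field r) \<Longrightarrow> trace r (id_elt r) = of_nat (card (Field r))"
  by (simp add: trace_def id_elt_def)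

text \<open>
  Elements are triangular with respect to the order, so diagonal entries multiply.
\<close>

lemma elt_prod_diag:
  assumes "finite (Field r)" "antisym r" "B \<in> lie_g r" "C \<in> lie_g r" "p \<in> Field r"
  shows "elt_prod r B C p p = B p p * C p p"
proof -
  have "elt_prod r B C p p = (\<Sum>q\<in>Field r. if q = p then B p p * C p p else 0)"
    unfolding elt_prod_def
  proof (rule sum.cong[OF refl])
    fix q
    show "B p q * C q p = (if q = p then B p p * C p p else 0)"
      using assms lie_gD[of B r p q] lie_gD[of C r q p] by (metis antisymD mult_eq_0_iff)
  qed
  then show ?thesis using assms by (simp add: sum.delta)
qed

lemma min_elems_lie_gD:
  assumes "e \<in> min_elems r" "B \<in> lie_g r" "q \<noteq> e"
  shows "B q e = 0"
  using assms by (intro lie_gD[of B r]) (auto simp: min_elems_def)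

text \<open>
  Two reductions. Every element differs from a trace-zero one by a multiple of the central
  identity, so it does not matter over which of the two algebras \<open>y\<close> ranges; and \<open>E\<^sup>*\<^bsub>e,e\<^esub>\<close> vanishes on
  brackets for a minimal element \<open>e\<close>, so that this summand does not affect the kernel.
\<close>

lemma form_ker_lie_gA:
  assumes r: "Partial_order r" and F: "finite (Field r)" and S: "S \<subseteq> Field r \<times> Field r"
    and e: "e \<in> min_elems r"
  shows "form_ker (lie_gA r) (bracket r) (phi_of S + Estar e e) = {B \<in> kern r S. trace r B = 0}"
proof -
  have r': "Refl r" "antisym r" "e \<in> Field r"
    using r e by (auto simp: partial_order_on_def preorder_on_def min_elems_def)
  have ee: "bracket r B y e e = 0" if "B \<in> lie_g r" "y \<in> lie_g r" for B y
    using elt_prod_diag[OF F r'(2) that r'(3)] elt_prod_diag[OF F r'(2) that(2,1) r'(3)]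
    by (simp add: bracket_def)
  have "(\<forall>y\<in>lie_gA r. phi_of S (bracket r B y) + bracket r B y e e = 0) \<longleftrightarrow> (\<forall>y\<in>lie_g r. phi_of S (bracket r B y) = 0)"
    if B: "B \<in> lie_g r" for B
  proof
    assume A: "\<forall>y\<in>lie_gA r. phi_of S (bracket r B y) + bracket r B y e e = 0"
    show "\<forall>y\<in>lie_g r. phi_of S (bracket r B y) = 0"
    proof
      fix y assume y: "y \<in> lie_g r"
      let ?c = "trace r y / trace r (id_elt r)"
      let ?y = "y - cscale ?c (id_elt r)"
      have "trace r (id_elt r) \<noteq> 0"
        using F r'(3) by (auto simp: trace_id_elt)
      then have "?y \<in> lie_gA r"
        using y id_elt_lie_g[OF r'(1)] subspace_lie_g[of r]
        by (auto simp: lie_gA_eq functional_diff[OF functional_trace] functional_scale[OF functional_trace]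
            intro!: elt.subspace_diff elt.subspace_scale)
      then have "phi_of S (bracket r B ?y) = 0"
        using A ee[OF B, of ?y] by (auto simp: lie_gA_eq)
      moreover have f: "functional (\<lambda>y. phi_of S (bracket r B y))"
        by (rule functional_bracket[OF functional_phi_of])
      have "phi_of S (bracket r B ?y) = phi_of S (bracket r B y)"
        by (simp only: functional_diff[OF f] functional_scale[OF f] bracket_id(2)[OF F B]
            functional_0[OF functional_phi_of] mult_zero_right diff_zero)
      ultimately show "phi_of S (bracket r B y) = 0" by simp
    qed
  next
    assume "\<forall>y\<in>lie_g r. phi_of S (bracket r B y) = 0"
    then show "\<forall>y\<in>lie_gA r. phi_of S (bracket r B y) + bracket r B y e e = 0"
      using ee[OF B] by (auto simp: lie_gA_eq)
  qed
  then show ?thesis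
    unfolding form_ker_lie_g[OF F S, symmetric] form_ker_def lie_gA_eq[of r]
    by (auto simp: Estar_def lie_gA_eq)
qed

theorem contact_form_lie_gA_iff:
  assumes r: "Partial_order r" and F: "finite (Field r)" and S: "S \<subseteq> Field r \<times> Field r"
    and e: "e \<in> min_elems r"
  shows "contact_form (lie_gA r) (bracket r) (phi_of S + Estar e e) \<longleftrightarrow>
    (\<exists>B\<in>kern r S. trace r B = 0 \<and> phi_of S B + B e e \<noteq> 0) \<and>
    (\<forall>B\<in>kern r S. trace r B = 0 \<and> phi_of S B + B e e = 0 \<longrightarrow> B = 0)"
proof -
  let ?\<phi> = "phi_of S + Estar e e"
  have \<phi>: "functional ?\<phi>"
    by (intro functional_plus functional_phi_of functional_Estar)
  have "finite r" by (rule finite_rel_if_finite_Field[OF F])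
  then have "contact_form (lie_gA r) (bracket r) ?\<phi> \<longleftrightarrow>
    (\<exists>x\<in>form_ker (lie_gA r) (bracket r) ?\<phi>. ?\<phi> x \<noteq> 0) \<and> (\<forall>x\<in>form_ker (lie_gA r) (bracket r) ?\<phi>. ?\<phi> x = 0 \<longrightarrow> x = 0)"
    using lie_g_subset_span[of r]
    by (intro contact_form_iff[where C = "(\<lambda>(p, q). unit_elt p q) ` r"] \<phi> functional_bracket subspace_lie_gA)
      (auto simp: bracket_def lie_gA_eq)
  then show ?thesis
    unfolding form_ker_lie_gA[OF assms] by (auto simp: Estar_def)
qed

section \<open>The invariant and the contact toral-pair\<close>

text \<open>
  A generator \<open>R\<close> of the kernel elements with vanishing \<open>(e, e)\<close> entry. The diagonal entries \<open>0\<close> and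
  \<open>1\<close> are the point: the trace of such an element stays positive when the poset is enlarged. The
  projection of \<open>R\<close> to trace zero along the identity is a multiple of the Reeb vector.
\<close>

definition reeb_projection :: "'a \<Rightarrow> 'a rel \<Rightarrow> 'a rel \<Rightarrow> 'a elt \<Rightarrow> bool" where
  "reeb_projection e r S R \<longleftrightarrow>
     R \<in> kern r S \<and> R e e = 0 \<and> (\<forall>p\<in>Field r. R p p \<in> {0, 1}) \<and> (\<exists>p\<in>Field r. R p p = 1) \<and>
     (\<forall>B\<in>kern r S. B e e = 0 \<longrightarrow> (\<exists>\<beta>. B = cscale \<beta> R))"

text \<open>
  The invariant of the gluing procedure, for the form \<open>\<phi>\<^sub>S + E\<^sup>*\<^bsub>e,e\<^esub>\<close>. The edges between extremal
  elements have to be in \<open>S\<close> so that the next gluing can identify them, and \<open>e\<close> must not be maximal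
  so that it remains minimal after identifications.
\<close>

definition contact_state :: "'a \<Rightarrow> 'a rel \<Rightarrow> 'a rel \<Rightarrow> bool" where
  "contact_state e r S \<longleftrightarrow>
     Partial_order r \<and> finite (Field r) \<and> e \<in> min_elems r \<and> e \<notin> max_elems r \<and> S \<subseteq> Rel r \<and>
     (\<forall>p\<in>Ext r. \<forall>q\<in>Ext r. (p, q) \<in> Rel r \<longrightarrow> (p, q) \<in> S) \<and>
     (\<forall>B\<in>kern r S. phi_of S B = 0) \<and> (\<exists>R. reeb_projection e r S R)"

lemma contact_stateD:
  assumes "contact_state e r S"
  shows "Partial_order r" "finite (Field r)" "e \<in> min_elems r" "e \<notin> max_elems r" "S \<subseteq> Rel r"
    and "\<forall>p\<in>Ext r. \<forall>q\<in>Ext r. (p, q) \<in> Rel r \<longrightarrow> (p, q) \<in> S"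
    and "\<forall>B\<in>kern r S. phi_of S B = 0" "\<exists>R. reeb_projection e r S R"
  using assms unfolding contact_state_def by - (elim conjE, assumption)+

lemma reeb_projectionD:
  assumes "reeb_projection e r S R"
  shows "R \<in> kern r S" "R e e = 0" "\<forall>p\<in>Field r. R p p \<in> {0, 1}" "\<exists>p\<in>Field r. R p p = 1"
    "\<forall>B\<in>kern r S. B e e = 0 \<longrightarrow> (\<exists>\<beta>. B = cscale \<beta> R)"
  using assms unfolding reeb_projection_def by - (elim conjE, assumption)+

lemma Rel_subset: "Rel r \<subseteq> Field r \<times> Field r"
  by (auto simp: Rel_def Field_def)

lemma sum_01_eq_card:
  assumes "finite F" "\<And>p. p \<in> F \<Longrightarrow> f p \<in> {0, 1 :: complex}"
  shows "sum f F = of_nat (card {p \<in> F. f p = 1})"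
proof -
  have "sum f F = (\<Sum>p\<in>F. if f p = 1 then 1 else 0)"
    using assms(2) by (intro sum.cong) auto
  also have "\<dots> = of_nat (card {p \<in> F. f p = 1})"
    using assms(1) by (simp add: sum.If_cases Int_def)
  finally show ?thesis .
qed

text \<open>
  The kernel is spanned by the identity and \<open>R\<close>, and the form takes the value of the \<open>(e, e)\<close> entry
  there. Its trace-zero part is spanned by \<open>R - (tr R / tr I) I\<close>, whose \<open>(e, e)\<close> entry is nonzero
  since \<open>R\<close> has positive trace.
\<close>

lemma contact_state_imp_contact_form:
  assumes st: "contact_state e r S"
  shows "contact_form (lie_gA r) (bracket r) (phi_of S + Estar e e)"
proof -
  note r = contact_stateD(1)[OF st] and F = contact_stateD(2)[OF st] and e = contact_stateD(3)[OF st]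
    and S = contact_stateD(5)[OF st]
  have phi0: "phi_of S B = 0" if "B \<in> kern r S" for B
    using contact_stateD(7)[OF st] that by (rule bspec)
  obtain R where "reeb_projection e r S R" using contact_stateD(8)[OF st] by blast
  note R = reeb_projectionD(1-4)[OF this] and uniq = reeb_projectionD(5)[OF this]
  have SF: "S \<subseteq> Field r \<times> Field r" using S Rel_subset by blast
  have eF: "e \<in> Field r" using e by (simp add: min_elems_def)
  have trR: "trace r R \<noteq> 0"
    unfolding trace_def using sum_01_eq_card[OF F, of "\<lambda>p. R p p"] R(3,4) F by (auto simp: card_eq_0_iff)
  have trI: "trace r (id_elt r) \<noteq> 0"
    using F eF by (auto simp: trace_id_elt)
  have I: "id_elt r \<in> kern r S"
    using r F SF by (intro id_elt_kern) (auto simp: partial_order_on_def preorder_on_def)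
  let ?c = "trace r R / trace r (id_elt r)"
  let ?x = "R - cscale ?c (id_elt r)"
  have "?x \<in> kern r S"
    using R(1) I subspace_kern by (intro elt.subspace_diff elt.subspace_scale)
  moreover have "trace r ?x = 0"
    using trI by (simp add: functional_diff[OF functional_trace] functional_scale[OF functional_trace])
  moreover have "?x e e = - ?c"
    using R(2) eF by (simp add: cscale_def id_elt_def)
  then have "?x e e \<noteq> 0" using trR trI by simp
  moreover have "B = 0" if B: "B \<in> kern r S" "trace r B = 0" "phi_of S B + B e e = 0" for B
  proof -
    have "B e e = 0" using B(3) phi0[OF B(1)] by simp
    then obtain \<beta> where \<beta>: "B = cscale \<beta> R" using uniq B(1) by blast
    then have "\<beta> * trace r R = 0"
      using B(2) by (simp add: functional_scale[OF functional_trace])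
    then have "\<beta> = 0" using trR by simp
    then show ?thesis using \<beta> by (simp add: cscale_def fun_eq_iff)
  qed
  ultimately show ?thesis
    unfolding contact_form_lie_gA_iff[OF r F SF e] using phi0 by (intro conjI bexI[of _ ?x] ballI impI) auto
qed

text \<open>
  Every edge runs from a source to a vertex that is not a source, so \<open>\<phi>([B, E]) = - \<phi>(B)\<close> for the
  sum \<open>E\<close> of the \<open>E\<^bsub>p,p\<^esub>\<close> over all sources \<open>p\<close>.
\<close>

lemma phi_of_kern_eq_0:
  assumes F: "finite (Field r)" and refl: "Refl r" and S: "S \<subseteq> Field r \<times> Field r" and oth: "others r S = {}"
    and B: "B \<in> kern r S"
  shows "phi_of S B = 0"
proof -
  let ?D = "sources r S"
  have D: "?D \<subseteq> Field r" by (auto simp: sources_def)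
  then have fin: "finite ?D" using F finite_subset by blast
  have edge: "a \<in> ?D \<and> b \<notin> ?D" if "(a, b) \<in> S" for a b
    using that S oth by (auto simp: others_def sinks_def sources_def)
  have "0 = (\<Sum>p\<in>?D. bracket_coeff S B p p)"
  proof (rule sum.neutral[symmetric], rule ballI)
    fix p assume "p \<in> ?D"
    then show "bracket_coeff S B p p = 0"
      using D refl by (intro kernD[OF B]) (auto simp: refl_on_def)
  qed
  also have "\<dots> = (\<Sum>ab\<in>S. \<Sum>p\<in>?D. (if snd ab = p then B (fst ab) p else 0) - (if fst ab = p then B p (snd ab) else 0))"
    unfolding bracket_coeff_def case_prod_beta by (rule sum.swap)
  also have "\<dots> = (\<Sum>ab\<in>S. - B (fst ab) (snd ab))"
    using edge fin by (intro sum.cong) (auto simp: sum_subtractf sum.delta')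
  also have "\<dots> = - phi_of S B"
    by (simp add: phi_of_apply case_prod_beta sum_negf)
  finally show ?thesis by simp
qed

text \<open>
  Contactness makes the space of kernel elements with vanishing \<open>(e, e)\<close> entry one-dimensional,
  spanned by some \<open>B\<close> of nonzero trace. This space is closed under multiplication, hence
  \<open>B\<^sup>2 = \<alpha> B\<close>; the diagonal entries of the triangular \<open>B\<close> are then \<open>0\<close> or \<open>\<alpha>\<close>, and \<open>\<alpha> \<noteq> 0\<close> because
  the trace is nonzero.
\<close>

theorem contact_stateI:
  assumes r: "Partial_order r" and F: "finite (Field r)" and e: "e \<in> min_elems r" "e \<notin> max_elems r"
    and S: "S \<subseteq> Rel r" and ext: "\<forall>p\<in>Ext r. \<forall>q\<in>Ext r. (p, q) \<in> Rel r \<longrightarrow> (p, q) \<in> S"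
    and oth: "others r S = {}"
    and contact: "contact_form (lie_gA r) (bracket r) (phi_of S + Estar e e)"
  shows "contact_state e r S"
proof -
  have r': "Refl r" "trans r" "antisym r"
    using r by (auto simp: partial_order_on_def preorder_on_def)
  have SF: "S \<subseteq> Field r \<times> Field r" using S Rel_subset by blast
  have eF: "e \<in> Field r" using e by (simp add: min_elems_def)
  have phi0: "phi_of S B = 0" if "B \<in> kern r S" for B
    by (rule phi_of_kern_eq_0[OF F r'(1) SF oth that])
  have I: "id_elt r \<in> kern r S"
    by (rule id_elt_kern[OF r'(1) F SF])
  have trI: "trace r (id_elt r) \<noteq> 0"
    using F eF by (auto simp: trace_id_elt)
  note K = subspace_kern[of r S]
  from contact[unfolded contact_form_lie_gA_iff[OF r F SF e(1)]]
  obtain x where x: "x \<in> kern r S" "trace r x = 0" "x e e \<noteq> 0"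
    and inj: "\<And>B. B \<in> kern r S \<Longrightarrow> trace r B = 0 \<Longrightarrow> B e e = 0 \<Longrightarrow> B = 0"
    using phi0 by fastforce
  \<comment> \<open>Subtracting the identity moves the nonzero \<open>(e, e)\<close> entry of \<open>x\<close> into the trace.\<close>
  define B where "B = x - cscale (x e e) (id_elt r)"
  have B: "B \<in> kern r S"
    unfolding B_def using x(1) I K by (intro elt.subspace_diff elt.subspace_scale)
  have Be: "B e e = 0"
    using eF by (simp add: B_def cscale_def id_elt_def)
  have trB: "trace r B \<noteq> 0"
    using x(2,3) trI by (simp add: B_def functional_diff[OF functional_trace] functional_scale[OF functional_trace])
  have Bg: "B \<in> lie_g r" using B by (simp add: kern_def)
  have uniq: "C = cscale (trace r C / trace r B) B" if C: "C \<in> kern r S" "C e e = 0" for C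
  proof -
    have "C - cscale (trace r C / trace r B) B = 0"
    proof (rule inj)
      show "C - cscale (trace r C / trace r B) B \<in> kern r S"
        using C(1) B K by (intro elt.subspace_diff elt.subspace_scale)
      show "trace r (C - cscale (trace r C / trace r B) B) = 0"
        using trB by (simp add: functional_diff[OF functional_trace] functional_scale[OF functional_trace])
      show "(C - cscale (trace r C / trace r B) B) e e = 0"
        using C(2) Be by (simp add: cscale_def)
    qed
    then show ?thesis by simp
  qed
  obtain \<alpha> where \<alpha>: "elt_prod r B B = cscale \<alpha> B"
    using uniq[OF kern_prod[OF r'(2) F SF B B]] elt_prod_diag[OF F r'(3) Bg Bg eF] Be
    by (metis mult_zero_left)
  have diag: "B p p = 0 \<or> B p p = \<alpha>" if "p \<in> Field r" for p
    using fun_cong[OF fun_cong[OF \<alpha>], of p p] elt_prod_diag[OF F r'(3) Bg Bg that] by (auto simp: cscale_def)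
  obtain p where p: "p \<in> Field r" "B p p \<noteq> 0"
    using trB unfolding trace_def by (meson sum.neutral)
  then have \<alpha>0: "\<alpha> \<noteq> 0" "B p p = \<alpha>" using diag by auto
  define R where "R = cscale (1 / \<alpha>) B"
  have R: "R \<in> kern r S"
    unfolding R_def using B K by (intro elt.subspace_scale)
  have Re: "R e e = 0" using Be by (simp add: R_def cscale_def)
  have Rd: "\<forall>p\<in>Field r. R p p \<in> {0, 1}"
    using diag \<alpha>0 by (auto simp: R_def cscale_def)
  have R1: "\<exists>p\<in>Field r. R p p = 1"
    using p \<alpha>0 by (auto simp: R_def cscale_def)
  have Ru: "\<exists>\<beta>. C = cscale \<beta> R" if C: "C \<in> kern r S" "C e e = 0" for C
  proof -
    obtain \<kappa> where "C = cscale \<kappa> B" using uniq[OF C] by blast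
    then have "C = cscale (\<kappa> * \<alpha>) R"
      using \<alpha>0 by (simp add: R_def cscale_def fun_eq_iff)
    then show ?thesis by blast
  qed
  have "reeb_projection e r S R"
    unfolding reeb_projection_def by (intro conjI ballI impI R Re Rd R1 Ru)
  then show ?thesis
    unfolding contact_state_def by (intro conjI r F e S ext ballI phi0 exI)
qed

section \<open>Gluing two posets along a star\<close>

definition restr :: "'a rel \<Rightarrow> 'a elt \<Rightarrow> 'a elt" where
  "restr r B = (\<lambda>a b. if (a, b) \<in> r then B a b else 0)"

lemma restr_lie_g: "restr r B \<in> lie_g r"
  by (simp add: restr_def lie_g_def)

lemma bracket_coeff_cong:
  assumes "\<And>a. (a, q) \<in> S \<Longrightarrow> B a p = C a p" "\<And>b. (p, b) \<in> S \<Longrightarrow> B q b = C q b"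
  shows "bracket_coeff S B p q = bracket_coeff S C p q"
  unfolding bracket_coeff_def using assms by (intro sum.cong) auto

lemma bracket_coeff_eq_0:
  assumes "\<And>a. (a, q) \<in> S \<Longrightarrow> B a p = 0" "\<And>b. (p, b) \<in> S \<Longrightarrow> B q b = 0"
  shows "bracket_coeff S B p q = 0"
  unfolding bracket_coeff_def using assms by (intro sum.neutral) auto

lemma bracket_coeff_Un:
  assumes "finite S" "finite T" "S \<inter> T = {}"
  shows "bracket_coeff (S \<union> T) B p q = bracket_coeff S B p q + bracket_coeff T B p q"
  unfolding bracket_coeff_def using assms by (rule sum.union_disjoint)

text \<open>
  The bracket with the identity vanishes. This yields the last diagonal equation from the others.
\<close>

lemma sum_bracket_coeff_diag:
  assumes "finite F" "S \<subseteq> F \<times> F"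
  shows "(\<Sum>p\<in>F. bracket_coeff S B p p) = 0"
proof -
  have "(\<Sum>p\<in>F. bracket_coeff S B p p)
      = (\<Sum>ab\<in>S. \<Sum>p\<in>F. (if snd ab = p then B (fst ab) p else 0) - (if fst ab = p then B p (snd ab) else 0))"
    unfolding bracket_coeff_def case_prod_beta by (rule sum.swap)
  also have "\<dots> = (\<Sum>ab\<in>S. 0)"
    using assms by (intro sum.cong) (auto simp: sum_subtractf sum.delta')
  finally show ?thesis by simp
qed

lemma min_elemsD: "v \<in> min_elems r \<Longrightarrow> (u, v) \<in> r \<Longrightarrow> u = v"
  and max_elemsD: "v \<in> max_elems r \<Longrightarrow> (v, u) \<in> r \<Longrightarrow> u = v"
  by (auto simp: min_elems_def max_elems_def)

lemma RelD: "(u, v) \<in> Rel r \<Longrightarrow> (u, v) \<in> r \<and> u \<noteq> v \<and> u \<in> Field r \<and> v \<in> Field r"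
  by (auto simp: Rel_def Field_def)

lemma RelI: "(u, v) \<in> r \<Longrightarrow> u \<noteq> v \<Longrightarrow> (u, v) \<in> Rel r"
  by (simp add: Rel_def)

lemma FieldD: "(u, v) \<in> r \<Longrightarrow> u \<in> Field r \<and> v \<in> Field r"
  by (auto simp: Field_def)

text \<open>
  Two posets that meet in elements extremal in both of them in the same sense, with the same relations
  among these. The situation is symmetric, and \<open>swap\<close> exchanges the roles.
\<close>

locale glued_posets =
  fixes Q P :: "'a rel"
  assumes Q: "Partial_order Q" and P: "Partial_order P"
    and extremal: "v \<in> Field Q \<Longrightarrow> v \<in> Field P \<Longrightarrow>
      v \<in> min_elems Q \<and> v \<in> min_elems P \<or> v \<in> max_elems Q \<and> v \<in> max_elems P"
    and agree: "u \<in> Field Q \<Longrightarrow> u \<in> Field P \<Longrightarrow> v \<in> Field Q \<Longrightarrow> v \<in> Field P \<Longrightarrow>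
      (u, v) \<in> Rel Q \<longleftrightarrow> (u, v) \<in> Rel P"
begin

lemma swap: "glued_posets P Q"
  using Q P extremal agree by unfold_locales blast+

lemma reflQ: "v \<in> Field Q \<Longrightarrow> (v, v) \<in> Q" and reflP: "v \<in> Field P \<Longrightarrow> (v, v) \<in> P"
  using Q P by (auto simp: partial_order_on_def preorder_on_def refl_on_def)

lemma upper_is_max:
  assumes "(u, v) \<in> Rel Q \<or> (u, v) \<in> Rel P" "v \<in> Field Q" "v \<in> Field P"
  shows "v \<in> max_elems Q" "v \<in> max_elems P"
  using extremal[OF assms(2,3)] assms(1) min_elemsD RelD by metis+

lemma lower_is_min:
  assumes "(u, v) \<in> Rel Q \<or> (u, v) \<in> Rel P" "u \<in> Field Q" "u \<in> Field P"
  shows "u \<in> min_elems Q" "u \<in> min_elems P"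
  using extremal[OF assms(2,3)] assms(1) max_elemsD RelD by metis+

text \<open>
  The union of the orders has no new relations between elements of \<open>Q\<close>.
\<close>

lemma lie_g_Un_eq_0:
  assumes "B \<in> lie_g (Q \<union> P)" "a \<in> Field Q" "b \<in> Field Q" "(a, b) \<notin> Q"
  shows "B a b = 0"
proof (rule lie_gD[OF assms(1)], rule notI)
  assume "(a, b) \<in> Q \<union> P"
  then have "(a, b) \<in> P" using assms(4) by simp
  moreover have "a \<noteq> b" using assms reflQ by auto
  ultimately have "(a, b) \<in> Rel P" "a \<in> Field P" "b \<in> Field P"
    by (auto intro: RelI dest: FieldD)
  then show False
    using agree[of a b] assms RelD by metis
qed

lemma bracket_coeff_restr:
  assumes "B \<in> lie_g (Q \<union> P)" "S \<subseteq> Rel Q" "(p, q) \<in> Q"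
  shows "bracket_coeff S (restr Q B) p q = bracket_coeff S B p q"
proof (rule bracket_coeff_cong)
  have pq: "p \<in> Field Q" "q \<in> Field Q" using FieldD[OF assms(3)] by auto
  show "restr Q B a p = B a p" if "(a, q) \<in> S" for a
    using that assms(2) RelD[of a q Q] pq lie_g_Un_eq_0[OF assms(1)] by (auto simp: restr_def)
  show "restr Q B q b = B q b" if "(p, b) \<in> S" for b
    using that assms(2) RelD[of p b Q] pq lie_g_Un_eq_0[OF assms(1)] by (auto simp: restr_def)
qed

text \<open>
  Edges that belong to one poset only do not influence the equations of the other one, except for
  the diagonal equations at the glued elements: a relation meeting such an edge would have to run
  below a minimal or above a maximal element, or make the edge a shared one.
\<close>

lemma bracket_coeff_cross:
  assumes B: "B \<in> lie_g (Q \<union> P)" and T: "T \<subseteq> Rel P - Rel Q" and pq: "(p, q) \<in> Q"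
    and off: "p \<noteq> q \<or> p \<notin> Field P"
  shows "bracket_coeff T B p q = 0"
proof (rule bracket_coeff_eq_0)
  have pqF: "p \<in> Field Q" "q \<in> Field Q" using FieldD[OF pq] by auto
  fix a assume "(a, q) \<in> T"
  then have aq: "(a, q) \<in> Rel P" "(a, q) \<notin> Rel Q" using T by auto
  then have F: "a \<in> Field P" "q \<in> Field P" using RelD by metis+
  then have pq': "(p, q) \<in> Rel Q" using off pq by (auto intro: RelI)
  show "B a p = 0"
  proof (rule lie_gD[OF B], rule notI)
    assume ap: "(a, p) \<in> Q \<union> P"
    show False
    proof (cases "p \<in> Field P")
      case True
      then have "a = p"
        using ap lower_is_min[of p q] pq' pqF min_elemsD by (metis UnE)
      then show False using aq pq' by simp
    next
      case False
      then have "(a, p) \<in> Q" using ap FieldD[of a p P] by auto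
      then have "a \<in> Field Q" by (auto dest: FieldD)
      then show False using agree[of a q] F pqF aq by simp
    qed
  qed
next
  have pqF: "p \<in> Field Q" "q \<in> Field Q" using FieldD[OF pq] by auto
  fix b assume "(p, b) \<in> T"
  then have pb: "(p, b) \<in> Rel P" "(p, b) \<notin> Rel Q" using T by auto
  then have F: "p \<in> Field P" "b \<in> Field P" using RelD by metis+
  then have pq': "(p, q) \<in> Rel Q" using off pq by (auto intro: RelI)
  show "B q b = 0"
  proof (rule lie_gD[OF B], rule notI)
    assume qb: "(q, b) \<in> Q \<union> P"
    show False
    proof (cases "q \<in> Field P")
      case True
      then have "b = q"
        using qb upper_is_max[of p q] pq' pqF max_elemsD by (metis UnE)
      then show False using pb pq' by simp
    next
      case False
      then have "(q, b) \<in> Q" using qb FieldD[of q b P] by auto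
      then have "b \<in> Field Q" by (auto dest: FieldD)
      then show False using agree[of p b] F pqF pb by simp
    qed
  qed
qed

lemma Partial_order_Un: "Partial_order (Q \<union> P)"
proof -
  have Q': "Refl Q" "trans Q" "antisym Q" and P': "Refl P" "trans P" "antisym P"
    using Q P by (auto simp: partial_order_on_def preorder_on_def)
  have mixed: "a = b \<or> b = c"
    if "(a, b) \<in> Q \<and> (b, c) \<in> P \<or> (a, b) \<in> P \<and> (b, c) \<in> Q" for a b c
  proof -
    have "b \<in> Field Q" "b \<in> Field P" using that by (auto dest: FieldD)
    from extremal[OF this] show ?thesis
      using that by (metis min_elemsD max_elemsD)
  qed
  have "Refl (Q \<union> P)"
    using Q' P' by (auto simp: refl_on_def Field_Un)
  moreover have "trans (Q \<union> P)"
  proof (rule transI)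
    fix a b c assume "(a, b) \<in> Q \<union> P" "(b, c) \<in> Q \<union> P"
    then show "(a, c) \<in> Q \<union> P"
      using mixed[of a b c] transD[OF Q'(2), of a b c] transD[OF P'(2), of a b c] by auto
  qed
  moreover have "antisym (Q \<union> P)"
  proof (rule antisymI)
    fix a b assume "(a, b) \<in> Q \<union> P" "(b, a) \<in> Q \<union> P"
    then show "a = b"
      using mixed[of a b a] antisymD[OF Q'(3), of a b] antisymD[OF P'(3), of a b] by auto
  qed
  moreover have "Q \<union> P \<subseteq> Field (Q \<union> P) \<times> Field (Q \<union> P)"
    by (auto simp: Field_def)
  ultimately show ?thesis
    by (simp add: partial_order_on_def preorder_on_def)
qed

end

text \<open>
  In all gluing rules the glued elements form a star: a centre \<open>x\<close> that is comparable to each of the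
  others. The poset \<open>P\<close> is the one attached, and rigidity is what its toral-pair provides.
\<close>

locale star_gluing = glued_posets +
  fixes S T :: "'a rel" and x :: 'a
  assumes finQ: "finite (Field Q)" and finP: "finite (Field P)"
    and S: "S \<subseteq> Rel Q" and T: "T \<subseteq> Rel P"
    and shared: "Rel Q \<inter> Rel P \<subseteq> S \<inter> T"
    and x: "x \<in> Field Q" "x \<in> Field P"
    and star: "(\<forall>y\<in>Field Q \<inter> Field P - {x}. (x, y) \<in> Rel Q) \<or> (\<forall>y\<in>Field Q \<inter> Field P - {x}. (y, x) \<in> Rel Q)"
    and rigid: "\<And>B. B \<in> kern P T \<Longrightarrow> \<exists>\<mu>. B = cscale \<mu> (id_elt P)"
begin

lemma finite_S: "finite S"
  by (rule finite_subset[OF order_trans[OF S Rel_subset]]) (simp add: finQ)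

lemma finite_T: "finite T"
  by (rule finite_subset[OF order_trans[OF T Rel_subset]]) (simp add: finP)

lemma bracket_coeff_Un_S: "bracket_coeff (S \<union> T) B p q = bracket_coeff S B p q + bracket_coeff (T - Rel Q) B p q"
proof -
  have "S \<union> T = S \<union> (T - Rel Q)" "S \<inter> (T - Rel Q) = {}"
    using shared S T by auto
  then show ?thesis
    using finite_S finite_T bracket_coeff_Un[of S "T - Rel Q"] by simp
qed

lemma bracket_coeff_Un_T: "bracket_coeff (S \<union> T) B p q = bracket_coeff T B p q + bracket_coeff (S - Rel P) B p q"
proof -
  have "S \<union> T = T \<union> (S - Rel P)" "T \<inter> (S - Rel P) = {}"
    using shared S T by auto
  then show ?thesis
    using finite_S finite_T bracket_coeff_Un[of T "S - Rel P"] by simp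
qed

lemma bracket_coeff_Un_Q:
  assumes "B \<in> lie_g (Q \<union> P)" "(p, q) \<in> Q" "p \<noteq> q \<or> p \<notin> Field P"
  shows "bracket_coeff (S \<union> T) B p q = bracket_coeff S (restr Q B) p q"
  using bracket_coeff_cross[of B "T - Rel Q" p q] bracket_coeff_restr[of B S p q] assms S T
  by (auto simp: bracket_coeff_Un_S)

lemma bracket_coeff_Un_P:
  assumes "B \<in> lie_g (Q \<union> P)" "(p, q) \<in> P" "p \<noteq> q \<or> p \<notin> Field Q"
  shows "bracket_coeff (S \<union> T) B p q = bracket_coeff T (restr P B) p q"
  using glued_posets.bracket_coeff_cross[OF swap, of B "S - Rel P" p q]
    glued_posets.bracket_coeff_restr[OF swap, of B T p q] assms S T
  by (auto simp: bracket_coeff_Un_T Un_commute)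

lemma shared_minD: "(u, v) \<in> Rel Q \<inter> Rel P \<Longrightarrow> u \<in> min_elems P \<and> u \<in> min_elems Q"
  and shared_maxD: "(u, v) \<in> Rel Q \<inter> Rel P \<Longrightarrow> v \<in> max_elems P \<and> v \<in> max_elems Q"
  using lower_is_min[of u v] upper_is_max[of u v] by (auto dest: RelD)

text \<open>
  Entries at the glued relations change the equations of \<open>P\<close> only on the diagonal.
\<close>

lemma bracket_coeff_shared:
  assumes Z: "\<And>a b. (a, b) \<notin> Rel Q \<inter> Rel P \<Longrightarrow> Z a b = 0" and pq: "(p, q) \<in> P"
  shows "bracket_coeff T Z p q = (if p = q then bracket_coeff (Rel Q \<inter> Rel P) Z q q else 0)"
proof (cases "p = q")
  case True
  have "bracket_coeff (Rel Q \<inter> Rel P) Z q q = bracket_coeff T Z q q"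
    unfolding bracket_coeff_def
  proof (rule sum.mono_neutral_left)
    show "finite T" by (rule finite_T)
    show "Rel Q \<inter> Rel P \<subseteq> T" using shared by blast
    show "\<forall>i\<in>T - Rel Q \<inter> Rel P. (case i of (a, b) \<Rightarrow> (if b = q then Z a q else 0) - (if a = q then Z q b else 0)) = 0"
    proof (clarify, rename_tac a b)
      fix a b assume "(a, b) \<notin> Rel Q \<inter> Rel P"
      from Z[OF this] show "(if b = q then Z a q else 0) - (if a = q then Z q b else 0) = 0" by auto
    qed
  qed
  then show ?thesis using True by simp
next
  case False
  have "bracket_coeff T Z p q = 0"
  proof (rule bracket_coeff_eq_0)
    show "Z a p = 0" if "(a, q) \<in> T" for a
    proof (rule Z, rule notI)
      assume "(a, p) \<in> Rel Q \<inter> Rel P"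
      then show False using shared_maxD[of a p] max_elemsD pq False by metis
    qed
    show "Z q b = 0" if "(p, b) \<in> T" for b
    proof (rule Z, rule notI)
      assume "(q, b) \<in> Rel Q \<inter> Rel P"
      then show False using shared_minD[of q b] min_elemsD pq False by metis
    qed
  qed
  then show ?thesis using False by simp
qed

lemma star_edges:
  "Rel Q \<inter> Rel P = {x} \<times> (Field Q \<inter> Field P - {x}) \<or> Rel Q \<inter> Rel P = (Field Q \<inter> Field P - {x}) \<times> {x}"
  using star
proof
  assume A: "\<forall>y\<in>Field Q \<inter> Field P - {x}. (x, y) \<in> Rel Q"
  have "Rel Q \<inter> Rel P = {x} \<times> (Field Q \<inter> Field P - {x})"
  proof (intro equalityI subsetI)
    fix e assume e: "e \<in> Rel Q \<inter> Rel P"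
    obtain u v where uv: "e = (u, v)" by force
    have F: "u \<in> Field Q" "u \<in> Field P" "v \<in> Field Q" "v \<in> Field P" "u \<noteq> v"
      using e uv RelD by (metis IntE)+
    have "u = x"
    proof (rule ccontr)
      assume "u \<noteq> x"
      then have "(x, u) \<in> Rel Q" using A F by blast
      then have "(x, u) \<in> Q \<and> x \<noteq> u" using RelD by metis
      then show False using shared_minD[of u v] e uv min_elemsD by metis
    qed
    then show "e \<in> {x} \<times> (Field Q \<inter> Field P - {x})" using F uv by auto
  next
    fix e assume "e \<in> {x} \<times> (Field Q \<inter> Field P - {x})"
    then show "e \<in> Rel Q \<inter> Rel P" using A agree x by auto
  qed
  then show ?thesis ..
next
  assume A: "\<forall>y\<in>Field Q \<inter> Field P - {x}. (y, x) \<in> Rel Q"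
  have "Rel Q \<inter> Rel P = (Field Q \<inter> Field P - {x}) \<times> {x}"
  proof (intro equalityI subsetI)
    fix e assume e: "e \<in> Rel Q \<inter> Rel P"
    obtain u v where uv: "e = (u, v)" by force
    have F: "u \<in> Field Q" "u \<in> Field P" "v \<in> Field Q" "v \<in> Field P" "u \<noteq> v"
      using e uv RelD by (metis IntE)+
    have "v = x"
    proof (rule ccontr)
      assume "v \<noteq> x"
      then have "(v, x) \<in> Rel Q" using A F by blast
      then have "(v, x) \<in> Q \<and> x \<noteq> v" using RelD by metis
      then show False using shared_maxD[of u v] e uv max_elemsD by metis
    qed
    then show "e \<in> (Field Q \<inter> Field P - {x}) \<times> {x}" using F uv by auto
  next
    fix e assume "e \<in> (Field Q \<inter> Field P - {x}) \<times> {x}"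
    then show "e \<in> Rel Q \<inter> Rel P" using A agree x by auto
  qed
  then show ?thesis ..
qed

text \<open>
  If only diagonal equations at glued elements fail, they can be repaired: changing the entry at the
  glued relation between \<open>x\<close> and \<open>y\<close> adjusts the equation at \<open>y\<close>, and the equation at \<open>x\<close> then holds
  because all diagonal equations sum to zero. By rigidity the repaired element is scalar.
\<close>

lemma almost_kern_P:
  assumes B: "B \<in> lie_g P"
    and coeff: "\<And>p q. (p, q) \<in> P \<Longrightarrow> p \<noteq> q \<or> p \<notin> Field Q \<Longrightarrow> bracket_coeff T B p q = 0"
  shows "\<exists>\<mu>. \<forall>p q. (p, q) \<notin> Rel Q \<inter> Rel P \<longrightarrow> B p q = \<mu> * id_elt P p q"
proof -
  let ?E = "Rel Q \<inter> Rel P"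
  define d where "d v = bracket_coeff T B v v" for v
  \<comment> \<open>The sign depends on whether \<open>x\<close> is the lower or the upper end of the shared edge.\<close>
  define Z where "Z = (\<lambda>u v. if (u, v) \<in> ?E then if v = x then - d u else d v else 0)"
  have finE: "finite ?E" using shared finite_S finite_subset by blast
  have Z0: "Z a b = 0" if "(a, b) \<notin> ?E" for a b using that by (auto simp: Z_def)
  have Zy: "bracket_coeff ?E Z y y = d y" if y: "y \<in> Field P" "y \<in> Field Q" "y \<noteq> x" for y
  proof -
    from star_edges show ?thesis
    proof
      assume E: "?E = {x} \<times> (Field Q \<inter> Field P - {x})"
      have "bracket_coeff ?E Z y y = (\<Sum>ab\<in>?E. if ab = (x, y) then d y else 0)"
        unfolding bracket_coeff_def
        by (rule sum.cong[OF refl]) (use y in \<open>auto simp: E Z_def split: if_splits\<close>)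
      then show ?thesis using finE E y by (simp add: sum.delta)
    next
      assume E: "?E = (Field Q \<inter> Field P - {x}) \<times> {x}"
      have "bracket_coeff ?E Z y y = (\<Sum>ab\<in>?E. if ab = (y, x) then d y else 0)"
        unfolding bracket_coeff_def
        by (rule sum.cong[OF refl]) (use y in \<open>auto simp: E Z_def split: if_splits\<close>)
      then show ?thesis using finE E y by (simp add: sum.delta)
    qed
  qed
  let ?C = "B - Z"
  have sub: "bracket_coeff T ?C p q = bracket_coeff T B p q - bracket_coeff T Z p q" for p q
    by (rule functional_diff[OF functional_bracket_coeff])
  have almost: "bracket_coeff T ?C p q = 0" if pq: "(p, q) \<in> P" "(p, q) \<noteq> (x, x)" for p q
  proof (cases "p = q \<and> p \<in> Field Q")
    case True
    then have "p \<in> Field P" "p \<noteq> x" using pq by (auto dest: FieldD)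
    then show ?thesis
      using True bracket_coeff_shared[of Z, OF Z0 pq(1)] Zy[of p] by (auto simp: sub d_def)
  next
    case False
    have "bracket_coeff T Z p q = 0"
    proof (cases "p = q")
      case True
      then have "bracket_coeff ?E Z q q = 0"
        using False by (intro bracket_coeff_eq_0) (auto dest: RelD)
      then show ?thesis using bracket_coeff_shared[of Z, OF Z0 pq(1)] by simp
    next
      case False
      then show ?thesis using bracket_coeff_shared[of Z, OF Z0 pq(1)] by simp
    qed
    then show ?thesis using False coeff[OF pq(1)] by (simp add: sub)
  qed
  have "0 = (\<Sum>p\<in>Field P. bracket_coeff T ?C p p)"
    using T Rel_subset by (intro sum_bracket_coeff_diag[symmetric] finP) blast
  also have "\<dots> = (\<Sum>p\<in>{x}. bracket_coeff T ?C p p)"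
    using x finP almost reflP by (intro sum.mono_neutral_right) auto
  finally have "bracket_coeff T ?C x x = 0" by simp
  then have "\<forall>(p, q)\<in>P. bracket_coeff T ?C p q = 0"
    using almost by blast
  moreover have "?C \<in> lie_g P"
    using lie_gD[OF B] by (auto simp: lie_g_def Z_def dest: RelD)
  ultimately obtain \<mu> where \<mu>: "?C = cscale \<mu> (id_elt P)"
    using rigid[of ?C] by (auto simp: kern_def)
  have "B p q = \<mu> * id_elt P p q" if "(p, q) \<notin> ?E" for p q
    using fun_cong[OF fun_cong[OF \<mu>], of p q] Z0[OF that] by (simp add: cscale_def)
  then show ?thesis by blast
qed

text \<open>
  On the attached poset a kernel element is thus scalar up to entries at glued relations.
\<close>

lemma kern_Un_on_P:
  assumes B: "B \<in> kern (Q \<union> P) (S \<union> T)"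
  shows "(p, q) \<in> Rel P - Rel Q \<Longrightarrow> B p q = 0" and "v \<in> Field P \<Longrightarrow> B v v = B x x"
proof -
  have Bg: "B \<in> lie_g (Q \<union> P)" using B by (simp add: kern_def)
  have "bracket_coeff T (restr P B) p q = 0" if "(p, q) \<in> P" "p \<noteq> q \<or> p \<notin> Field Q" for p q
    using bracket_coeff_Un_P[OF Bg that] kernD[OF B, of p q] that by simp
  then obtain \<mu> where \<mu>: "\<And>p q. (p, q) \<notin> Rel Q \<inter> Rel P \<Longrightarrow> restr P B p q = \<mu> * id_elt P p q"
    using almost_kern_P[OF restr_lie_g] by blast
  show "B p q = 0" if "(p, q) \<in> Rel P - Rel Q"
    using \<mu>[of p q] that RelD[of p q P] by (auto simp: restr_def id_elt_def)
  have diag: "B v v = \<mu>" if "v \<in> Field P" for v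
    using \<mu>[of v v] that reflP[OF that] by (auto simp: restr_def id_elt_def Rel_def)
  show "B v v = B x x" if "v \<in> Field P"
    using diag[OF that] diag[OF x(2)] by simp
qed

text \<open>
  At glued diagonal positions the contribution of \<open>P\<close> drops out, as it only involves entries that
  vanish.
\<close>

lemma kern_Un_restr:
  assumes B: "B \<in> kern (Q \<union> P) (S \<union> T)"
  shows "restr Q B \<in> kern Q S"
proof -
  have Bg: "B \<in> lie_g (Q \<union> P)" using B by (simp add: kern_def)
  have "bracket_coeff S (restr Q B) p q = 0" if pq: "(p, q) \<in> Q" for p q
  proof (cases "p = q \<and> p \<in> Field P")
    case True
    have "bracket_coeff (T - Rel Q) B p q = 0"
      using True kern_Un_on_P(1)[OF B] T by (intro bracket_coeff_eq_0) blast+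
    then have "bracket_coeff S B p q = 0"
      using bracket_coeff_Un_S[of B p q] kernD[OF B, of p q] pq by simp
    then show ?thesis using bracket_coeff_restr[OF Bg S pq] by simp
  next
    case False
    then show ?thesis
      using bracket_coeff_Un_Q[OF Bg pq] kernD[OF B, of p q] pq by auto
  qed
  then show ?thesis
    by (auto simp: kern_def restr_lie_g)
qed

lemma kern_Q_diag:
  assumes R: "R \<in> kern Q S" and v: "v \<in> Field Q" "v \<in> Field P"
  shows "R v v = R x x"
proof -
  have edge: "R b b = R a a" if ab: "(a, b) \<in> Rel Q \<inter> Rel P" for a b
  proof -
    have abS: "(a, b) \<in> S" "(a, b) \<in> Q" "a \<noteq> b" using ab shared RelD[of a b Q] by auto
    have Rg: "R \<in> lie_g Q" using R by (simp add: kern_def)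
    have min0: "R c a = 0" if "c \<noteq> a" for c
      using shared_minD[OF ab] that by (auto intro!: min_elems_lie_gD[OF _ Rg])
    have max0: "R b c = 0" if "c \<noteq> b" for c
      using shared_maxD[OF ab] that by (intro lie_gD[OF Rg]) (auto dest: max_elemsD)
    have "0 = bracket_coeff S R a b"
      using kernD[OF R abS(2)] by simp
    also have "\<dots> = (\<Sum>cd\<in>S. if cd = (a, b) then R a a - R b b else 0)"
      unfolding bracket_coeff_def
      by (rule sum.cong[OF refl]) (auto simp: min0 max0 split: if_splits)
    finally show ?thesis using finite_S abS(1) by (simp add: sum.delta)
  qed
  from star_edges show ?thesis
  proof
    assume "Rel Q \<inter> Rel P = {x} \<times> (Field Q \<inter> Field P - {x})"
    then show ?thesis using edge[of x v] v by (cases "v = x") auto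
  next
    assume "Rel Q \<inter> Rel P = (Field Q \<inter> Field P - {x}) \<times> {x}"
    then show ?thesis using edge[of v x] v by (cases "v = x") auto
  qed
qed

text \<open>
  The inverse of the restriction to \<open>Q\<close> on kernels: continue by the scalar found at the centre.
\<close>

definition extend :: "'a elt \<Rightarrow> 'a elt" where
  "extend R = (\<lambda>p q. if (p, q) \<in> Q then R p q else R x x * id_elt P p q)"

lemma extend_kern:
  assumes R: "R \<in> kern Q S"
  shows "extend R \<in> kern (Q \<union> P) (S \<union> T)"
proof -
  let ?R = "extend R"
  have Rg: "R \<in> lie_g Q" using R by (simp add: kern_def)
  have Bg: "?R \<in> lie_g (Q \<union> P)"
    using reflP by (auto simp: extend_def lie_g_def id_elt_def)
  have restrQ: "restr Q ?R = R"
    using lie_gD[OF Rg] by (auto simp: restr_def extend_def fun_eq_iff)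
  define Z where "Z = (\<lambda>p q. if (p, q) \<in> Rel Q \<inter> Rel P then R p q else 0)"
  have Z0: "Z a b = 0" if "(a, b) \<notin> Rel Q \<inter> Rel P" for a b using that by (auto simp: Z_def)
  have restrP: "restr P ?R = cscale (R x x) (id_elt P) + Z"
  proof (intro ext)
    fix p q
    consider "(p, q) \<notin> P" | "(p, q) \<in> P" "(p, q) \<in> Q" "p = q" | "(p, q) \<in> P" "(p, q) \<in> Q" "p \<noteq> q"
      | "(p, q) \<in> P" "(p, q) \<notin> Q" by blast
    then show "restr P ?R p q = (cscale (R x x) (id_elt P) + Z) p q"
    proof cases
      case 1
      then show ?thesis using reflP[of p] by (auto simp: restr_def cscale_def id_elt_def Z_def Rel_def)
    next
      case 2
      then show ?thesis using kern_Q_diag[OF R, of p] FieldD[of p q P] FieldD[of p q Q]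
        by (auto simp: restr_def extend_def cscale_def id_elt_def Z_def Rel_def)
    next
      case 3
      then show ?thesis by (auto simp: restr_def extend_def cscale_def id_elt_def Z_def Rel_def)
    next
      case 4
      then show ?thesis by (auto simp: restr_def extend_def cscale_def id_elt_def Z_def Rel_def)
    qed
  qed
  have "Refl P" using P by (auto simp: partial_order_on_def preorder_on_def)
  then have IdP: "id_elt P \<in> kern P T"
    using T Rel_subset by (intro id_elt_kern finP) blast+
  have "bracket_coeff (S \<union> T) ?R p q = 0" if pq: "(p, q) \<in> Q \<union> P" for p q
  proof (cases "p = q \<and> p \<in> Field Q \<and> p \<in> Field P")
    case True
    then have "(p, q) \<in> Q" using reflQ[of p] by auto
    have "bracket_coeff (T - Rel Q) ?R p q = 0"
      using T by (intro bracket_coeff_eq_0) (auto simp: True extend_def id_elt_def Rel_def)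
    then show ?thesis
      using bracket_coeff_Un_S[of ?R p q] bracket_coeff_restr[OF Bg S \<open>(p, q) \<in> Q\<close>]
        kernD[OF R \<open>(p, q) \<in> Q\<close>] by (simp add: restrQ)
  next
    case off: False
    show ?thesis
    proof (cases "(p, q) \<in> Q")
      case True
      then show ?thesis
        using bracket_coeff_Un_Q[OF Bg True] off kernD[OF R True] by (auto simp: restrQ dest: FieldD)
    next
      case False
      then have pqP: "(p, q) \<in> P" and "p \<noteq> q \<or> p \<notin> Field Q" using pq reflQ by auto
      have "bracket_coeff T Z p q = 0"
      proof (cases "p = q")
        case True
        then have "bracket_coeff (Rel Q \<inter> Rel P) Z q q = 0"
          using \<open>p \<noteq> q \<or> p \<notin> Field Q\<close> by (intro bracket_coeff_eq_0) (auto dest: RelD)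
        then show ?thesis using bracket_coeff_shared[of Z, OF Z0 pqP] by simp
      next
        case False
        then show ?thesis using bracket_coeff_shared[of Z, OF Z0 pqP] by simp
      qed
      then show ?thesis
        using bracket_coeff_Un_P[OF Bg pqP \<open>p \<noteq> q \<or> p \<notin> Field Q\<close>] kernD[OF IdP pqP]
        by (simp add: restrP functional_add[OF functional_bracket_coeff] functional_scale[OF functional_bracket_coeff])
    qed
  qed
  then show ?thesis
    using Bg by (auto simp: kern_def)
qed

lemma phi_of_Un:
  assumes B: "B \<in> kern (Q \<union> P) (S \<union> T)"
  shows "phi_of (S \<union> T) B = phi_of S (restr Q B)"
proof -
  have "S \<union> T = S \<union> (T - Rel Q)"
    using shared T by auto
  moreover have "phi_of (S \<union> (T - Rel Q)) B = phi_of S B + phi_of (T - Rel Q) B"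
    unfolding phi_of_apply using finite_S finite_T S by (intro sum.union_disjoint) auto
  moreover have "phi_of (T - Rel Q) B = 0"
    unfolding phi_of_apply using kern_Un_on_P(1)[OF B] T by (intro sum.neutral) auto
  moreover have "phi_of S B = phi_of S (restr Q B)"
    unfolding phi_of_apply using S RelD[of _ _ Q] by (intro sum.cong) (auto simp: restr_def Rel_def)
  ultimately show ?thesis by simp
qed

lemma Ext_Un_D:
  "p \<in> Ext (Q \<union> P) \<Longrightarrow> p \<in> Field Q \<Longrightarrow> p \<in> Ext Q"
  "p \<in> Ext (Q \<union> P) \<Longrightarrow> p \<in> Field P \<Longrightarrow> p \<in> Ext P"
  by (auto simp: Ext_def min_elems_def max_elems_def)

text \<open>
  Restriction identifies the kernel for the glued poset with the kernel for \<open>Q\<close>, and the diagonal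
  entries of the extension of \<open>R\<close> are repetitions of diagonal entries of \<open>R\<close>.
\<close>

theorem contact_state_Un:
  assumes st: "contact_state e Q S"
    and extP: "\<forall>p\<in>Ext P. \<forall>q\<in>Ext P. (p, q) \<in> Rel P \<longrightarrow> (p, q) \<in> T"
  shows "contact_state e (Q \<union> P) (S \<union> T)"
proof -
  note stD = contact_stateD[OF st]
  have e: "e \<in> min_elems (Q \<union> P)" "e \<notin> max_elems (Q \<union> P)"
  proof -
    have eF: "e \<in> Field Q" using stD(3) by (simp add: min_elems_def)
    show "e \<notin> max_elems (Q \<union> P)"
      using stD(4) eF by (auto simp: max_elems_def)
    have "y = e" if "(y, e) \<in> P" for y
      using extremal[of e] that stD(3,4) eF FieldD[OF that] min_elemsD[OF _ that] by blast
    then show "e \<in> min_elems (Q \<union> P)"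
      using stD(3) by (auto simp: min_elems_def Field_Un)
  qed
  obtain R where "reeb_projection e Q S R" using stD(8) by blast
  note R = reeb_projectionD[OF this]
  have eQ: "(e, e) \<in> Q" using stD(3) reflQ by (simp add: min_elems_def)
  have "reeb_projection e (Q \<union> P) (S \<union> T) (extend R)"
    unfolding reeb_projection_def
  proof (intro conjI ballI impI)
    show "extend R \<in> kern (Q \<union> P) (S \<union> T)" by (rule extend_kern[OF R(1)])
    show "extend R e e = 0" using R(2) eQ by (simp add: extend_def)
    show "extend R p p \<in> {0, 1}" if "p \<in> Field (Q \<union> P)" for p
      using that R(3) reflQ x(1) by (auto simp: extend_def id_elt_def Field_Un dest: FieldD)
    show "\<exists>p\<in>Field (Q \<union> P). extend R p p = 1"
      using R(4) reflQ by (auto simp: extend_def Field_Un)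
  next
    fix C assume C: "C \<in> kern (Q \<union> P) (S \<union> T)" "C e e = 0"
    have "restr Q C e e = 0" using C(2) by (simp add: restr_def)
    then obtain \<beta> where \<beta>: "restr Q C = cscale \<beta> R"
      using R(5) kern_Un_restr[OF C(1)] by blast
    have onQ: "C p q = \<beta> * R p q" if "(p, q) \<in> Q" for p q
      using fun_cong[OF fun_cong[OF \<beta>], of p q] that by (simp add: restr_def cscale_def)
    have "C = cscale \<beta> (extend R)"
    proof (intro ext)
      fix p q
      consider "(p, q) \<in> Q" | "(p, q) \<notin> Q" "(p, q) \<in> P" "p = q" | "(p, q) \<notin> Q" "(p, q) \<in> P" "p \<noteq> q"
        | "(p, q) \<notin> Q \<union> P" by blast
      then show "C p q = cscale \<beta> (extend R) p q"
      proof cases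
        case 1
        then show ?thesis using onQ by (simp add: cscale_def extend_def)
      next
        case 2
        then show ?thesis
          using kern_Un_on_P(2)[OF C(1), of p] onQ[OF reflQ[OF x(1)]] FieldD[of p q P]
          by (simp add: cscale_def extend_def id_elt_def)
      next
        case 3
        then show ?thesis
          using kern_Un_on_P(1)[OF C(1), of p q] by (simp add: cscale_def extend_def id_elt_def Rel_def)
      next
        case 4
        then have "C p q = 0" using C(1) by (intro lie_gD) (auto simp: kern_def)
        then show ?thesis
          using 4 reflP[of p] by (auto simp: cscale_def extend_def id_elt_def)
      qed
    qed
    then show "\<exists>\<beta>. C = cscale \<beta> (extend R)" by blast
  qed
  moreover have "\<forall>B\<in>kern (Q \<union> P) (S \<union> T). phi_of (S \<union> T) B = 0"
    using phi_of_Un kern_Un_restr stD(7) by simp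
  moreover have "\<forall>p\<in>Ext (Q \<union> P). \<forall>q\<in>Ext (Q \<union> P). (p, q) \<in> Rel (Q \<union> P) \<longrightarrow> (p, q) \<in> S \<union> T"
  proof (intro ballI impI)
    fix p q assume pq: "p \<in> Ext (Q \<union> P)" "q \<in> Ext (Q \<union> P)" "(p, q) \<in> Rel (Q \<union> P)"
    then have "(p, q) \<in> Rel Q \<or> (p, q) \<in> Rel P" by (auto simp: Rel_def)
    then show "(p, q) \<in> S \<union> T"
    proof
      assume "(p, q) \<in> Rel Q"
      then show ?thesis using stD(6) Ext_Un_D(1) pq RelD[of p q Q] by blast
    next
      assume "(p, q) \<in> Rel P"
      then show ?thesis using extP Ext_Un_D(2) pq RelD[of p q P] by blast
    qed
  qed
  moreover have "S \<union> T \<subseteq> Rel (Q \<union> P)"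
    using S T by (auto simp: Rel_def)
  moreover have "finite (Field (Q \<union> P))"
    using finQ finP by (simp add: Field_Un)
  ultimately show ?thesis
    unfolding contact_state_def using Partial_order_Un e by (intro conjI exI)
qed

end

section \<open>Copies, gluing rules, and the induction\<close>

lemma Field_map_prod: "Field (map_prod h h ` r) = h ` Field r"
  by (force simp: Field_def)

lemma map_prod_mem_iff:
  assumes "inj_on h (Field r)" "a \<in> Field r" "b \<in> Field r"
  shows "(h a, h b) \<in> map_prod h h ` r \<longleftrightarrow> (a, b) \<in> r"
proof
  assume "(h a, h b) \<in> map_prod h h ` r"
  then obtain a' b' where "(a', b') \<in> r" "h a' = h a" "h b' = h b" by auto
  then show "(a, b) \<in> r"
    using assms by (metis FieldD inj_onD)
qed auto

lemma map_prod_memE: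
  assumes "(u, v) \<in> map_prod h h ` r"
  obtains a b where "u = h a" "v = h b" "(a, b) \<in> r" "a \<in> Field r" "b \<in> Field r"
  using assms by (auto dest: FieldD)

context
  fixes h :: "'a \<Rightarrow> 'b" and r :: "'a rel"
  assumes inj: "inj_on h (Field r)"
begin

lemma Partial_order_map_prod:
  assumes "Partial_order r"
  shows "Partial_order (map_prod h h ` r)"
proof -
  have r: "Refl r" "trans r" "antisym r"
    using assms by (auto simp: partial_order_on_def preorder_on_def)
  have "Refl (map_prod h h ` r)"
    using r(1) by (force simp: refl_on_def Field_map_prod)
  moreover have "trans (map_prod h h ` r)"
  proof (rule transI)
    fix u v w assume "(u, v) \<in> map_prod h h ` r" "(v, w) \<in> map_prod h h ` r"
    then obtain a b b' c where *: "u = h a" "v = h b" "v = h b'" "w = h c" "(a, b) \<in> r" "(b', c) \<in> r"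
      by (elim map_prod_memE) blast
    then have "b = b'" using inj by (metis FieldD inj_onD)
    then show "(u, w) \<in> map_prod h h ` r"
      using * transD[OF r(2), of a b c] by force
  qed
  moreover have "antisym (map_prod h h ` r)"
  proof (rule antisymI)
    fix u v assume "(u, v) \<in> map_prod h h ` r" "(v, u) \<in> map_prod h h ` r"
    then obtain a b b' a' where *: "u = h a" "v = h b" "v = h b'" "u = h a'" "(a, b) \<in> r" "(b', a') \<in> r"
      by (elim map_prod_memE) blast
    then have "b = b'" "a = a'" using inj by (metis FieldD inj_onD)+
    then show "u = v"
      using * antisymD[OF r(3), of a b] by simp
  qed
  moreover have "map_prod h h ` r \<subseteq> Field (map_prod h h ` r) \<times> Field (map_prod h h ` r)"
    by (auto simp: Field_def)
  ultimately show ?thesis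
    by (simp add: partial_order_on_def preorder_on_def)
qed

lemma Rel_map_prod_iff:
  "a \<in> Field r \<Longrightarrow> b \<in> Field r \<Longrightarrow> (h a, h b) \<in> Rel (map_prod h h ` r) \<longleftrightarrow> (a, b) \<in> Rel r"
  using map_prod_mem_iff[OF inj, of a b] inj by (auto simp: Rel_def inj_on_def)

lemma min_elems_map_prod_iff: "a \<in> Field r \<Longrightarrow> h a \<in> min_elems (map_prod h h ` r) \<longleftrightarrow> a \<in> min_elems r"
proof
  assume a: "a \<in> Field r" "h a \<in> min_elems (map_prod h h ` r)"
  have "y = a" if "(y, a) \<in> r" for y
  proof -
    have "h y = h a" using a(2) that by (force simp: min_elems_def)
    then show ?thesis using inj that by (metis FieldD inj_onD)
  qed
  then show "a \<in> min_elems r" using a(1) by (simp add: min_elems_def)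
next
  assume a: "a \<in> Field r" "a \<in> min_elems r"
  have "u = h a" if "(u, h a) \<in> map_prod h h ` r" for u
    using that
  proof (rule map_prod_memE)
    fix b c assume "u = h b" "h a = h c" "(b, c) \<in> r" "c \<in> Field r"
    moreover have "a = c" using inj a(1) \<open>c \<in> Field r\<close> \<open>h a = h c\<close> by (meson inj_onD)
    ultimately show "u = h a" using a(2) min_elemsD by metis
  qed
  then show "h a \<in> min_elems (map_prod h h ` r)" using a(1) by (simp add: min_elems_def Field_map_prod)
qed

lemma max_elems_map_prod_iff: "a \<in> Field r \<Longrightarrow> h a \<in> max_elems (map_prod h h ` r) \<longleftrightarrow> a \<in> max_elems r"
proof
  assume a: "a \<in> Field r" "h a \<in> max_elems (map_prod h h ` r)"
  have "y = a" if "(a, y) \<in> r" for y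
  proof -
    have "h y = h a" using a(2) that by (force simp: max_elems_def)
    then show ?thesis using inj that by (metis FieldD inj_onD)
  qed
  then show "a \<in> max_elems r" using a(1) by (simp add: max_elems_def)
next
  assume a: "a \<in> Field r" "a \<in> max_elems r"
  have "u = h a" if "(h a, u) \<in> map_prod h h ` r" for u
    using that
  proof (rule map_prod_memE)
    fix b c assume "h a = h b" "u = h c" "(b, c) \<in> r" "b \<in> Field r"
    moreover have "a = b" using inj a(1) \<open>b \<in> Field r\<close> \<open>h a = h b\<close> by (meson inj_onD)
    ultimately show "u = h a" using a(2) max_elemsD by metis
  qed
  then show "h a \<in> max_elems (map_prod h h ` r)" using a(1) by (simp add: max_elems_def Field_map_prod)
qed

lemma Ext_map_prod_iff: "a \<in> Field r \<Longrightarrow> h a \<in> Ext (map_prod h h ` r) \<longleftrightarrow> a \<in> Ext r"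
  by (simp add: Ext_def min_elems_map_prod_iff max_elems_map_prod_iff)

text \<open>
  Rigidity is invariant under isomorphism: pull the element back along \<open>h\<close>.
\<close>

lemma kern_scalars_map_prod:
  assumes S: "S \<subseteq> Field r \<times> Field r"
    and rigid: "\<And>B. B \<in> kern r S \<Longrightarrow> \<exists>\<mu>. B = cscale \<mu> (id_elt r)"
    and B: "B \<in> kern (map_prod h h ` r) (map_prod h h ` S)"
  shows "\<exists>\<mu>. B = cscale \<mu> (id_elt (map_prod h h ` r))"
proof -
  let ?B = "\<lambda>a b. if (a, b) \<in> r then B (h a) (h b) else 0"
  have Bg: "B \<in> lie_g (map_prod h h ` r)" using B by (simp add: kern_def)
  have pull: "?B a b = B (h a) (h b)" if "a \<in> Field r" "b \<in> Field r" for a b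
    using map_prod_mem_iff[OF inj that] lie_gD[OF Bg, of "h a" "h b"] by simp
  have heq: "h a = h b \<longleftrightarrow> a = b" if "a \<in> Field r" "b \<in> Field r" for a b
    using inj that by (auto dest: inj_onD)
  have "bracket_coeff S ?B p q = 0" if pq: "(p, q) \<in> r" for p q
  proof -
    have pqF: "p \<in> Field r" "q \<in> Field r" using pq by (auto dest: FieldD)
    have injS: "inj_on (map_prod h h) S"
      using inj S by (auto simp: inj_on_def; blast)
    have "bracket_coeff (map_prod h h ` S) B (h p) (h q)
        = (\<Sum>ab\<in>S. (if h (snd ab) = h q then B (h (fst ab)) (h p) else 0) - (if h (fst ab) = h p then B (h q) (h (snd ab)) else 0))"
      unfolding bracket_coeff_def by (subst sum.reindex[OF injS]) (rule sum.cong, auto)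
    also have "\<dots> = (\<Sum>ab\<in>S. (if snd ab = q then ?B (fst ab) p else 0) - (if fst ab = p then ?B q (snd ab) else 0))"
    proof (rule sum.cong[OF refl])
      fix ab assume "ab \<in> S"
      then have "fst ab \<in> Field r" "snd ab \<in> Field r" using S by auto
      then show "(if h (snd ab) = h q then B (h (fst ab)) (h p) else 0) - (if h (fst ab) = h p then B (h q) (h (snd ab)) else 0)
          = (if snd ab = q then ?B (fst ab) p else 0) - (if fst ab = p then ?B q (snd ab) else 0)"
        by (simp only: heq pqF pull)
    qed
    finally have "bracket_coeff S ?B p q = bracket_coeff (map_prod h h ` S) B (h p) (h q)"
      by (simp add: bracket_coeff_def case_prod_beta)
    also have "\<dots> = 0"
      using pq by (intro kernD[OF B]) force
    finally show ?thesis .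
  qed
  then have "?B \<in> kern r S"
    by (auto simp: kern_def lie_g_def)
  then obtain \<mu> where \<mu>: "?B = cscale \<mu> (id_elt r)"
    using rigid by blast
  have "B u v = cscale \<mu> (id_elt (map_prod h h ` r)) u v" for u v
  proof (cases "u \<in> h ` Field r \<and> v \<in> h ` Field r")
    case True
    then obtain a b where ab: "u = h a" "v = h b" "a \<in> Field r" "b \<in> Field r" by blast
    then have "B u v = cscale \<mu> (id_elt r) a b"
      using pull[of a b] fun_cong[OF fun_cong[OF \<mu>], of a b] by simp
    then show ?thesis
      using ab heq[of a b] by (auto simp: cscale_def id_elt_def Field_map_prod)
  next
    case False
    then have "(u, v) \<notin> map_prod h h ` r"
      using FieldD[of u v "map_prod h h ` r"] unfolding Field_map_prod by blast
    then have "B u v = 0"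
      by (rule lie_gD[OF Bg])
    then show ?thesis
      using False by (auto simp: cscale_def id_elt_def Field_map_prod)
  qed
  then show ?thesis by blast
qed

end

lemma labelled_posetD:
  assumes "labelled_poset r"
  shows "Partial_order r" "finite (Field r)" "(x, y) \<in> r \<Longrightarrow> x \<le> y"
  using assms by (auto simp: labelled_poset_def)

lemma toral_pairD:
  assumes "toral_pair r S"
  shows "Partial_order r" "finite (Field r)" "S \<subseteq> Rel r"
    "\<forall>p\<in>Ext r. \<forall>q\<in>Ext r. (p, q) \<in> Rel r \<longrightarrow> (p, q) \<in> S"
    "B \<in> kern r S \<Longrightarrow> \<exists>\<mu>. B = cscale \<mu> (id_elt r)"
proof -
  have l: "labelled_poset r" using assms by (simp add: toral_pair_def)
  show 1: "Partial_order r" "finite (Field r)" using labelled_posetD[OF l] by blast+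
  show S: "S \<subseteq> Rel r" using assms by (simp add: toral_pair_def)
  show "\<forall>p\<in>Ext r. \<forall>q\<in>Ext r. (p, q) \<in> Rel r \<longrightarrow> (p, q) \<in> S"
    using assms by (simp add: toral_pair_def)
  assume B: "B \<in> kern r S"
  have SF: "S \<subseteq> Field r \<times> Field r" using S Rel_subset by blast
  have "B \<in> form_ker (lie_g r) (bracket r) (phi_of S)"
    using B form_ker_lie_g[OF 1(2) SF] by simp
  then have eq: "\<And>p q. p \<in> Field r \<Longrightarrow> q \<in> Field r \<Longrightarrow> B p p = B q q" and off: "\<And>p q. (p, q) \<in> Rel r \<Longrightarrow> B p q = 0"
    using assms by (auto simp: toral_pair_def Estar_def)
  obtain \<mu> where \<mu>: "\<And>p. p \<in> Field r \<Longrightarrow> B p p = \<mu>"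
    using eq by metis
  have "B p q = cscale \<mu> (id_elt r) p q" for p q
  proof (cases "(p, q) \<in> r")
    case True
    then show ?thesis
      using \<mu>[of p] off[of p q] FieldD[of p q r] by (auto simp: cscale_def id_elt_def Rel_def)
  next
    case False
    then have "B p q = 0" using B by (intro lie_gD[of B r]) (auto simp: kern_def)
    moreover have "p \<noteq> q \<or> p \<notin> Field r"
      using False 1(1) by (auto simp: partial_order_on_def preorder_on_def refl_on_def)
    ultimately show ?thesis by (auto simp: cscale_def id_elt_def)
  qed
  then show "\<exists>\<mu>. B = cscale \<mu> (id_elt r)" by blast
qed

lemma ext_names_star:
  assumes "ext_names g s"
  shows "el_c g \<in> Ext s"
    and "(\<forall>a\<in>Ext s - {el_c g}. (el_c g, a) \<in> Rel s) \<or> (\<forall>a\<in>Ext s - {el_c g}. (a, el_c g) \<in> Rel s)"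
  using assms by (auto simp: ext_names_def Let_def)

text \<open>
  What the six rules have in common. The rules that do not identify \<open>c\<close> identify a single element;
  in all others \<open>c\<close> is the centre of the star.
\<close>

lemma rule_applicable_cases:
  assumes "ext_names g s" "rule_applicable g s Q"
  shows "identified g \<subseteq> Ext s"
    and "el_c g \<notin> identified g \<Longrightarrow> \<exists>e. identified g = {e}"
    and "el_c g \<in> identified g \<Longrightarrow> e \<in> identified g - {el_c g} \<Longrightarrow> comparable Q (emb g e) (emb g (el_c g))"
  using assms
  by (auto simp: identified_def rule_applicable_def ext_names_def Let_def Rel_def split: glue_rule.splits)

lemma glue_correction_eq:
  assumes "ext_names g s" "rule_applicable g s Q"
  shows "glue_correction g s = (if el_c g \<in> identified g then \<Sum>e\<in>identified g - {el_c g}. glued_edge g s e else 0)"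
proof -
  have ne: "el_a1 g \<noteq> el_c g" "card (Ext s) = 3 \<Longrightarrow> el_a2 g \<noteq> el_c g \<and> el_a1 g \<noteq> el_a2 g"
    using assms(1) by (auto simp: ext_names_def Let_def Rel_def)
  show ?thesis
    using ne assms(2)
    by (cases "rule_of g") (auto simp: glue_correction_def identified_def rule_applicable_def Let_def insert_Diff_if)
qed

text \<open>
  The hypotheses on extremal elements determine the relations among the glued elements: in both
  posets they are those between \<open>c\<close> and the others. These are the relations in which the edge sets
  \<open>S0\<close> and \<open>copy g S\<close> meet, so the correction term turns the sum of the two forms into the form of
  the union of the edge sets.
\<close>

theorem contact_state_glued:
  assumes st: "contact_state e0 Q S0" and gl: "glued g s Q Q'" and tp: "toral_pair s S"
  shows "contact_state e0 Q' (S0 \<union> copy g S)"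
    and "phi_of (S0 \<union> copy g S) = phi_of S0 + phi_of (copy g S) - glue_correction g s"
proof -
  define h where "h = emb g"
  define c where "c = el_c g"
  define P where "P = map_prod h h ` s"
  define T where "T = map_prod h h ` S"
  have copyT: "copy g S = T" and copyP: "copy g s = P"
    by (simp_all add: copy_def P_def T_def h_def)
  have gl': "ext_names g s" "rule_applicable g s Q" "inj_on h (Field s)"
    "h ` Field s \<inter> Field Q = h ` identified g"
    "\<forall>e\<in>identified g. e \<in> min_elems s \<and> h e \<in> min_elems Q \<or> e \<in> max_elems s \<and> h e \<in> max_elems Q"
    "Q' = Q \<union> P"
    using gl by (simp_all add: glued_def h_def copyP)
  note inj = gl'(3)
  note star_s = ext_names_star[OF gl'(1), folded c_def]
  note ruleD = rule_applicable_cases[OF gl'(1,2), folded c_def h_def]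
  note tpD = toral_pairD[OF tp]
  note stD = contact_stateD[OF st]
  have idF: "a \<in> Field s" if "a \<in> identified g" for a
    using ruleD(1) that by (auto simp: Ext_def min_elems_def max_elems_def)
  have G: "Field Q \<inter> Field P = h ` identified g"
    using gl'(4) by (auto simp: P_def Field_map_prod)
  have hne: "h a \<noteq> h b" if "(a, b) \<in> Rel s" for a b
    using that RelD[of a b s] inj by (auto dest: inj_onD)
  have lowerQ: "h a \<in> min_elems Q" if "a \<in> identified g" "(a, b) \<in> Rel s" for a b
    using gl'(5) that max_elemsD RelD by metis
  have upperQ: "h b \<in> max_elems Q" if "b \<in> identified g" "(a, b) \<in> Rel s" for a b
    using gl'(5) that min_elemsD RelD by metis
  have lowers: "a \<in> min_elems s" if "a \<in> identified g" "(h a, h b) \<in> Rel Q" for a b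
    using gl'(5) that max_elemsD RelD by metis
  have uppers: "b \<in> max_elems s" if "b \<in> identified g" "(h a, h b) \<in> Rel Q" for a b
    using gl'(5) that min_elemsD RelD by metis
  have toQ: "(h a, h b) \<in> Rel Q" if ab: "a \<in> identified g" "b \<in> identified g" "(a, b) \<in> Rel s" for a b
  proof -
    have ne: "h a \<noteq> h b" by (rule hne[OF ab(3)])
    have "a = c \<or> b = c"
    proof (rule ccontr)
      assume nc: "\<not> (a = c \<or> b = c)"
      then have "a \<in> Ext s - {c}" "b \<in> Ext s - {c}" using ab ruleD(1) by auto
      from star_s(2) show False
      proof
        assume "\<forall>a\<in>Ext s - {c}. (c, a) \<in> Rel s"
        then have "(c, a) \<in> Rel s" using \<open>a \<in> Ext s - {c}\<close> by blast
        then have "a \<notin> min_elems s" using min_elemsD RelD by metis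
        moreover have "a \<notin> max_elems s" using ab(3) max_elemsD RelD by metis
        ultimately show False using \<open>a \<in> Ext s - {c}\<close> by (simp add: Ext_def)
      next
        assume "\<forall>a\<in>Ext s - {c}. (a, c) \<in> Rel s"
        then have "(b, c) \<in> Rel s" using \<open>b \<in> Ext s - {c}\<close> by blast
        then have "b \<notin> max_elems s" using max_elemsD RelD by metis
        moreover have "b \<notin> min_elems s" using ab(3) min_elemsD RelD by metis
        ultimately show False using \<open>b \<in> Ext s - {c}\<close> by (simp add: Ext_def)
      qed
    qed
    then have "comparable Q (h b) (h a) \<or> comparable Q (h a) (h b)"
    proof
      assume "a = c"
      then show ?thesis using ruleD(3)[of b] ab(1,2) ne by blast
    next
      assume "b = c"
      then show ?thesis using ruleD(3)[of a] ab(1,2) ne by blast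
    qed
    moreover have "(h b, h a) \<notin> Q"
      using min_elemsD[OF lowerQ[OF ab(1,3)]] ne by metis
    ultimately have "(h a, h b) \<in> Q"
      unfolding comparable_def by blast
    then show ?thesis using ne by (rule RelI)
  qed
  have fromQ: "(a, b) \<in> Rel s" if ab: "a \<in> identified g" "b \<in> identified g" "(h a, h b) \<in> Rel Q" for a b
  proof -
    have ne: "a \<noteq> b" using ab(3) by (auto simp: Rel_def)
    have m: "a \<in> min_elems s" "b \<in> max_elems s"
      using lowers[OF ab(1,3)] uppers[OF ab(2,3)] by simp_all
    have Ext: "a \<in> Ext s" "b \<in> Ext s" using ab(1,2) ruleD(1) by blast+
    from star_s(2) show ?thesis
    proof
      assume up: "\<forall>a\<in>Ext s - {c}. (c, a) \<in> Rel s"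
      have "a = c"
      proof (rule ccontr)
        assume "a \<noteq> c"
        then have "(c, a) \<in> Rel s" using up Ext by blast
        then show False using m(1) min_elemsD RelD by metis
      qed
      then show ?thesis using up Ext ne by blast
    next
      assume down: "\<forall>a\<in>Ext s - {c}. (a, c) \<in> Rel s"
      have "b = c"
      proof (rule ccontr)
        assume "b \<noteq> c"
        then have "(b, c) \<in> Rel s" using down Ext by blast
        then show False using m(2) max_elemsD RelD by metis
      qed
      then show ?thesis using down Ext ne by blast
    qed
  qed
  have agree: "(h a, h b) \<in> Rel Q \<longleftrightarrow> (a, b) \<in> Rel s" "(h a, h b) \<in> Rel P \<longleftrightarrow> (a, b) \<in> Rel s"
    if "a \<in> identified g" "b \<in> identified g" for a b
    using toQ[OF that] fromQ[OF that] Rel_map_prod_iff[OF inj idF[OF that(1)] idF[OF that(2)]]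
    by (auto simp: P_def)
  have T_Rel: "T \<subseteq> Rel P"
  proof
    fix e assume "e \<in> T"
    then obtain a b where "e = (h a, h b)" "(a, b) \<in> S" by (auto simp: T_def)
    then show "e \<in> Rel P"
      using tpD(3) RelD[of a b s] Rel_map_prod_iff[OF inj, of a b] by (auto simp: P_def)
  qed
  have extP: "\<forall>p\<in>Ext P. \<forall>q\<in>Ext P. (p, q) \<in> Rel P \<longrightarrow> (p, q) \<in> T"
  proof (intro ballI impI)
    fix p q assume pq: "p \<in> Ext P" "q \<in> Ext P" "(p, q) \<in> Rel P"
    then have "(p, q) \<in> P" using RelD by metis
    then obtain a b where ab: "p = h a" "q = h b" "(a, b) \<in> s" "a \<in> Field s" "b \<in> Field s"
      unfolding P_def by (rule map_prod_memE)
    then have "(a, b) \<in> S"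
      using pq tpD(4) Rel_map_prod_iff[OF inj, of a b] Ext_map_prod_iff[OF inj, of a] Ext_map_prod_iff[OF inj, of b]
      by (auto simp: P_def)
    then show "(p, q) \<in> T" using ab by (force simp: T_def)
  qed
  have shared_iff: "(u, v) \<in> Rel Q \<inter> Rel P \<longleftrightarrow> (\<exists>a\<in>identified g. \<exists>b\<in>identified g. u = h a \<and> v = h b \<and> (a, b) \<in> Rel s)" for u v
  proof
    assume uv: "(u, v) \<in> Rel Q \<inter> Rel P"
    then have "u \<in> Field Q \<inter> Field P" "v \<in> Field Q \<inter> Field P" using RelD by (metis IntD1 IntD2 IntI)+
    then show "\<exists>a\<in>identified g. \<exists>b\<in>identified g. u = h a \<and> v = h b \<and> (a, b) \<in> Rel s"
      using uv agree unfolding G by blast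
  next
    assume "\<exists>a\<in>identified g. \<exists>b\<in>identified g. u = h a \<and> v = h b \<and> (a, b) \<in> Rel s"
    then show "(u, v) \<in> Rel Q \<inter> Rel P" using agree by blast
  qed
  have shared: "Rel Q \<inter> Rel P \<subseteq> S0 \<inter> T"
  proof (rule subrelI)
    fix u v assume "(u, v) \<in> Rel Q \<inter> Rel P"
    then obtain a b where ab: "a \<in> identified g" "b \<in> identified g" "u = h a" "v = h b" "(a, b) \<in> Rel s"
      "(u, v) \<in> Rel Q" "(u, v) \<in> Rel P"
      using shared_iff by blast
    have "u \<in> Ext Q" "v \<in> Ext Q"
      using lowerQ[of a b] upperQ[of b a] ab by (auto simp: Ext_def)
    then have "(u, v) \<in> S0" using stD(6) ab by blast
    moreover have "u \<in> Ext P" "v \<in> Ext P"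
      using ab ruleD(1) idF Ext_map_prod_iff[OF inj] by (auto simp: P_def)
    then have "(u, v) \<in> T" using extP ab by blast
    ultimately show "(u, v) \<in> S0 \<inter> T" by blast
  qed
  have idne: "identified g \<noteq> {}" by (auto simp: identified_def split: glue_rule.splits)
  obtain d where d: "d \<in> identified g" "c \<in> identified g \<Longrightarrow> d = c" "c \<notin> identified g \<Longrightarrow> identified g = {d}"
    using ruleD(2) idne by (cases "c \<in> identified g") auto
  have dir: "(\<forall>y\<in>Field Q \<inter> Field P - {h d}. (h d, y) \<in> Rel Q) \<or> (\<forall>y\<in>Field Q \<inter> Field P - {h d}. (y, h d) \<in> Rel Q)"
  proof (cases "c \<in> identified g")
    case True
    from star_s(2) show ?thesis
    proof
      assume up: "\<forall>a\<in>Ext s - {c}. (c, a) \<in> Rel s"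
      have "(h d, h a) \<in> Rel Q" if "a \<in> identified g" "h a \<noteq> h d" for a
        using up that ruleD(1) d(2)[OF True] True by (intro toQ) auto
      then show ?thesis unfolding G by blast
    next
      assume down: "\<forall>a\<in>Ext s - {c}. (a, c) \<in> Rel s"
      have "(h a, h d) \<in> Rel Q" if "a \<in> identified g" "h a \<noteq> h d" for a
        using down that ruleD(1) d(2)[OF True] True by (intro toQ) auto
      then show ?thesis unfolding G by blast
    qed
  next
    case False
    then show ?thesis unfolding G d(3)[OF False] by simp
  qed
  have SF: "S \<subseteq> Field s \<times> Field s" using tpD(3) Rel_subset by blast
  interpret star_gluing Q P S0 T "h d"
  proof
    show "Partial_order Q" by (rule stD(1))
    show "Partial_order P" unfolding P_def by (rule Partial_order_map_prod[OF inj tpD(1)])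
    show "v \<in> min_elems Q \<and> v \<in> min_elems P \<or> v \<in> max_elems Q \<and> v \<in> max_elems P"
      if v: "v \<in> Field Q" "v \<in> Field P" for v
    proof -
      obtain a where a: "a \<in> identified g" "v = h a" using v G by blast
      then show ?thesis
        using gl'(5) min_elems_map_prod_iff[OF inj idF[OF a(1)]] max_elems_map_prod_iff[OF inj idF[OF a(1)]]
        unfolding P_def by blast
    qed
    show "((u, v) \<in> Rel Q) = ((u, v) \<in> Rel P)"
      if uv: "u \<in> Field Q" "u \<in> Field P" "v \<in> Field Q" "v \<in> Field P" for u v
    proof -
      obtain a where "a \<in> identified g" "u = h a" using uv(1,2) G by blast
      moreover obtain b where "b \<in> identified g" "v = h b" using uv(3,4) G by blast
      ultimately show ?thesis using agree by simp
    qed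
    show "finite (Field Q)" by (rule stD(2))
    show "finite (Field P)" using tpD(2) by (simp add: P_def Field_map_prod)
    show "S0 \<subseteq> Rel Q" by (rule stD(5))
    show "T \<subseteq> Rel P" by (rule T_Rel)
    show "Rel Q \<inter> Rel P \<subseteq> S0 \<inter> T" by (rule shared)
    show "h d \<in> Field Q" "h d \<in> Field P" using G d(1) by auto
    show "(\<forall>y\<in>Field Q \<inter> Field P - {h d}. (h d, y) \<in> Rel Q) \<or> (\<forall>y\<in>Field Q \<inter> Field P - {h d}. (y, h d) \<in> Rel Q)"
      by (rule dir)
    show "\<exists>\<mu>. B = cscale \<mu> (id_elt P)" if "B \<in> kern P T" for B
      unfolding P_def
    proof (rule kern_scalars_map_prod[OF inj SF])
      show "\<exists>\<mu>. C = cscale \<mu> (id_elt s)" if "C \<in> kern s S" for C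
        using that by (rule tpD(5))
      show "B \<in> kern (map_prod h h ` s) (map_prod h h ` S)"
        using that unfolding P_def T_def .
    qed
  qed
  show "contact_state e0 Q' (S0 \<union> copy g S)"
    unfolding copyT gl'(6) by (rule contact_state_Un[OF st extP])
  have inter: "S0 \<inter> T = Rel Q \<inter> Rel P"
    using shared stD(5) T_Rel by blast
  have "phi_of (S0 \<union> T) + phi_of (S0 \<inter> T) = phi_of S0 + phi_of T"
    unfolding phi_of_def by (rule sum.union_inter[OF finite_S finite_T])
  moreover have "phi_of (S0 \<inter> T) = glue_correction g s"
  proof (cases "c \<in> identified g")
    case True
    let ?I = "identified g - {c}"
    have I: "a \<in> Ext s - {c}" "a \<in> identified g" if "a \<in> ?I" for a using that ruleD(1) by auto
    have hinj: "inj_on h ?I" using inj idF by (auto simp: inj_on_def)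
    have corr: "glue_correction g s = (\<Sum>a\<in>?I. glued_edge g s a)"
      using glue_correction_eq[OF gl'(1,2)] True by (simp add: c_def)
    from star_s(2) show ?thesis
    proof
      assume up: "\<forall>a\<in>Ext s - {c}. (c, a) \<in> Rel s"
      have "min_elems s = {c}"
      proof -
        have "a \<notin> min_elems s" if "a \<noteq> c" for a
        proof
          assume a: "a \<in> min_elems s"
          then have "(c, a) \<in> Rel s" using up that by (simp add: Ext_def)
          then show False using a min_elemsD RelD by metis
        qed
        moreover have "c \<in> min_elems s"
        proof (cases "Ext s = {c}")
          case True
          moreover have "el_a1 g \<in> Ext s" "el_a1 g \<noteq> c"
            using gl'(1) by (auto simp: ext_names_def Let_def c_def Rel_def)
          ultimately show ?thesis by simp
        next
          case False
          then obtain a where "a \<in> Ext s - {c}" using star_s(1) by blast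
          then have "(c, a) \<in> Rel s" using up by blast
          then have "c \<notin> max_elems s" using max_elemsD RelD by metis
          then show ?thesis using star_s(1) by (simp add: Ext_def)
        qed
        ultimately show ?thesis by blast
      qed
      then have edge: "glued_edge g s a = Estar (h c) (h a)" for a
        by (simp add: glued_edge_def c_def h_def)
      have "Rel Q \<inter> Rel P = (\<lambda>a. (h c, h a)) ` ?I"
      proof (rule set_eqI, clarify)
        fix u v
        have "a = c \<and> b \<in> ?I" if "a \<in> identified g" "b \<in> identified g" "(a, b) \<in> Rel s" for a b
        proof -
          have "a = c"
          proof (rule ccontr)
            assume "a \<noteq> c"
            then have "(c, a) \<in> Rel s" using up that ruleD(1) by blast
            then have "h a \<in> max_elems Q" using upperQ that by blast
            then show False using toQ[OF that] max_elemsD RelD by metis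
          qed
          then show ?thesis using that by (auto simp: Rel_def)
        qed
        then show "(u, v) \<in> Rel Q \<inter> Rel P \<longleftrightarrow> (u, v) \<in> (\<lambda>a. (h c, h a)) ` ?I"
          unfolding shared_iff using up I True by blast
      qed
      then show ?thesis
        unfolding inter corr edge phi_of_def
        using hinj by (simp add: sum.reindex inj_on_def)
    next
      assume down: "\<forall>a\<in>Ext s - {c}. (a, c) \<in> Rel s"
      have "el_a1 g \<in> Ext s - {c}"
        using gl'(1) by (auto simp: ext_names_def Let_def c_def Rel_def)
      then have "(el_a1 g, c) \<in> Rel s" using down by blast
      then have "c \<notin> min_elems s" using min_elemsD RelD by metis
      then have edge: "glued_edge g s a = Estar (h a) (h c)" for a
        by (auto simp: glued_edge_def c_def h_def)
      have "Rel Q \<inter> Rel P = (\<lambda>a. (h a, h c)) ` ?I"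
      proof (rule set_eqI, clarify)
        fix u v
        have "b = c \<and> a \<in> ?I" if "a \<in> identified g" "b \<in> identified g" "(a, b) \<in> Rel s" for a b
        proof -
          have "b = c"
          proof (rule ccontr)
            assume "b \<noteq> c"
            then have "(b, c) \<in> Rel s" using down that ruleD(1) by blast
            then have "h b \<in> min_elems Q" using lowerQ that by blast
            then show False using toQ[OF that] min_elemsD RelD by metis
          qed
          then show ?thesis using that by (auto simp: Rel_def)
        qed
        then show "(u, v) \<in> Rel Q \<inter> Rel P \<longleftrightarrow> (u, v) \<in> (\<lambda>a. (h a, h c)) ` ?I"
          unfolding shared_iff using down I True by blast
      qed
      then show ?thesis
        unfolding inter corr edge phi_of_def
        using hinj by (simp add: sum.reindex inj_on_def)
    qed
  next
    case False
    then have "identified g = {d}" by (rule d(3))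
    then have "Rel Q \<inter> Rel P = {}"
      using shared_iff by (auto simp: Rel_def)
    then show ?thesis
      using glue_correction_eq[OF gl'(1,2)] False by (simp add: inter phi_of_def c_def)
  qed
  ultimately show "phi_of (S0 \<union> copy g S) = phi_of S0 + phi_of (copy g S) - glue_correction g s"
    unfolding copyT by (simp add: algebra_simps)
qed

text \<open>
  The element \<open>1\<close> is minimal by the labelling. It is not maximal, since an element that is both would
  be isolated in the Hasse diagram, and there are at least two extremal elements.
\<close>

lemma contact_toral_pair_contact_state:
  assumes "contact_toral_pair r S"
  shows "contact_state 1 r (S - {(1, 1)})" and "phi_of S = phi_of (S - {(1, 1)}) + Estar 1 1"
proof -
  let ?S = "S - {(1, 1)}"
  have l: "labelled_poset r" and con: "contact_form (lie_gA r) (bracket r) (phi_of S)" "connected_poset r"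
    and ext: "card (Ext r) \<in> {2, 3}" and diag: "\<forall>p\<in>Field r. (p, p) \<in> S \<longleftrightarrow> p = 1"
    and sm: "small r ?S" and oth: "others r ?S = {}"
    and edges: "\<forall>p\<in>Ext r. \<forall>q\<in>Ext r. (p, q) \<in> Rel r \<longrightarrow> (p, q) \<in> ?S"
    using assms unfolding contact_toral_pair_def Let_def by - (elim conjE, assumption)+
  note lD = labelled_posetD[OF l]
  have SR: "?S \<subseteq> Rel r" using sm by (simp add: small_def)
  have ExtF: "Ext r \<subseteq> Field r" by (auto simp: Ext_def min_elems_def max_elems_def)
  have "1 < card (Ext r)" using ext by auto
  then have "1 < card (Field r)"
    using card_mono[OF lD(2) ExtF] by simp
  have "\<not> Field r \<subseteq> {1}"
  proof
    assume "Field r \<subseteq> {1}"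
    then have "card (Field r) \<le> card {1 :: nat}" by (intro card_mono) auto
    then show False using \<open>1 < card (Field r)\<close> by simp
  qed
  then obtain q where q: "q \<in> Field r" "q \<noteq> 1" by blast
  have F1: "Field r = {1..card (Field r)}"
    using l by (auto simp: labelled_poset_def)
  then have one: "1 \<in> Field r" using \<open>1 < card (Field r)\<close> by (metis atLeastAtMost_iff less_imp_le order_refl)
  have min1: "1 \<in> min_elems r"
  proof -
    have "y = 1" if "(y, 1) \<in> r" for y
      using lD(3)[OF that] FieldD[OF that] F1 by (metis atLeastAtMost_iff le_antisym)
    then show ?thesis using one by (simp add: min_elems_def)
  qed
  have max1: "1 \<notin> max_elems r"
  proof
    assume m: "1 \<in> max_elems r"
    have "(1, q) \<in> (Hasse r \<union> (Hasse r)\<inverse>)\<^sup>*"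
      using con(2) one q by (simp add: connected_poset_def graph_connected_def)
    then obtain z where "(1, z) \<in> Hasse r \<union> (Hasse r)\<inverse>"
      using q(2) by (metis converse_rtranclE)
    then have "(1, z) \<in> Rel r \<or> (z, 1) \<in> Rel r" by (auto simp: Hasse_def)
    then show False using min_elemsD[OF min1] max_elemsD[OF m] RelD by metis
  qed
  have fin: "finite ?S"
    using finite_subset[OF order_trans[OF SR Rel_subset]] lD(2) by simp
  have "(1, 1) \<in> S" using diag one by blast
  then have S: "S = insert (1, 1) ?S" by blast
  have "phi_of (insert (1, 1) ?S) = phi_of ?S + Estar 1 1"
    unfolding phi_of_def by (subst sum.insert) (use fin in \<open>auto simp: add.commute\<close>)
  with S show phi: "phi_of S = phi_of ?S + Estar 1 1" by simp
  show "contact_state 1 r ?S"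
    using con(1) by (intro contact_stateI lD(1,2) min1 max1 SR edges oth) (simp only: phi)
qed

theorem theorem50:
  fixes n :: nat
    and s :: "nat \<Rightarrow> nat rel"
    and S :: "nat \<Rightarrow> nat rel"
    and g :: "nat \<Rightarrow> gluing"
    and Q :: "nat \<Rightarrow> nat rel"
    and \<phi> :: "nat \<Rightarrow> nat form"
  assumes "contact_sequence n s S g Q"
    and "contact_toral_forms n s S g \<phi>"
  shows "\<forall>i\<in>{1..n}. contact_form (lie_gA (Q i)) (bracket (Q i)) (\<phi> i)"
proof -
  have pairs: "\<forall>i\<in>{1..n}. toral_pair (s i) (S i) \<or> contact_toral_pair (s i) (S i)"
    and only: "{i \<in> {1..n}. contact_toral_pair (s i) (S i)} = {1}"
    and Q1: "Q 1 = s 1"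
    and Qi: "\<forall>i\<in>{2..n}. glued (g i) (s i) (Q (i - 1)) (Q i)"
    using assms(1) unfolding contact_sequence_def by - (elim conjE, assumption)+
  have \<phi>1: "\<phi> 1 = phi_of (S 1)"
    and \<phi>i: "\<forall>i\<in>{2..n}. \<phi> i = \<phi> (i - 1) + phi_of (copy (g i) (S i)) - glue_correction (g i) (s i)"
    using assms(2) unfolding contact_toral_forms_def by - (elim conjE, assumption)+
  have inv: "\<exists>E. contact_state 1 (Q i) E \<and> \<phi> i = phi_of E + Estar 1 1" if "1 \<le> i" "i \<le> n" for i
    using that
  proof (induction i rule: dec_induct)
    case base
    have "contact_toral_pair (s 1) (S 1)" using only by blast
    note contact_toral_pair_contact_state[OF this]
    then show ?case
      unfolding Q1 \<phi>1 by blast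
  next
    case (step i)
    from step.prems have "i \<le> n" by simp
    from step.IH[OF this] obtain E where E: "contact_state 1 (Q i) E" "\<phi> i = phi_of E + Estar 1 1"
      by blast
    have i: "Suc i \<in> {2..n}" using step.hyps step.prems by simp
    have "Suc i \<noteq> 1" using step.hyps by simp
    have i1: "Suc i \<in> {1..n}" using step.prems by simp
    have "\<not> contact_toral_pair (s (Suc i)) (S (Suc i))"
      using only i1 \<open>Suc i \<noteq> 1\<close> by blast
    then have tp: "toral_pair (s (Suc i)) (S (Suc i))"
      using bspec[OF pairs i1] by simp
    have gl: "glued (g (Suc i)) (s (Suc i)) (Q i) (Q (Suc i))"
      using bspec[OF Qi i] by simp
    have \<phi>_Suc: "\<phi> (Suc i) = \<phi> i + phi_of (copy (g (Suc i)) (S (Suc i))) - glue_correction (g (Suc i)) (s (Suc i))"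
      using bspec[OF \<phi>i i] by simp
    let ?E = "E \<union> copy (g (Suc i)) (S (Suc i))"
    have "\<phi> (Suc i) = phi_of ?E + Estar 1 1"
      unfolding contact_state_glued(2)[OF E(1) gl tp] \<phi>_Suc E(2) by (simp add: algebra_simps)
    then show ?case
      using contact_state_glued(1)[OF E(1) gl tp] by blast
  qed
  show ?thesis
  proof
    fix i assume "i \<in> {1..n}"
    then obtain E where "contact_state 1 (Q i) E" "\<phi> i = phi_of E + Estar 1 1"
      using inv[of i] by auto
    then show "contact_form (lie_gA (Q i)) (bracket (Q i)) (\<phi> i)"
      by (simp only: contact_state_imp_contact_form)
  qed
qed

end
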